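(* Let $\mathcal{G}[-3\le\partial_n,\partial_3\le-1]$ be the set (up to isomorphism) of non-complete connected graphs $G$ of order $n$ ($n\ge 4$) whose distance eigenvalues $\partial_1\ge\partial_2\ge\cdots\ge\partial_n$ satisfy $-3\le\partial_n$ and $\partial_3\le -1$. Then $$\mathcal{G}[-3\le\partial_n,\partial_3\le-1]=\mathcal{S}\cup\mathcal{T}_1\cup\mathcal{T}_2,$$ where, with $S(m,n)=(mK_2\cup nK_1)\vee(K_5\cup K_1)$ for integers $m,n\ge0$ with $m+n\ge1$; $T_1=K_4\cup K_1$; $T_2=K_3\cup 2K_1$; $T_3=K_3\cup K_1$; and $T_4(m,n)=mK_2\cup nK_1$ for integers $m,n\ge0$ with $m+n\ge2$: (1) $\mathcal{S}=\{S(m,n)\mid m+n\ge1\}$; (2) $\mathcal{T}_1=\{K_r\vee T_i\mid r\ge1,\ 1\le i\le3\}\cup\{K_r\vee T_4(m,n)\mid r\ge1,\ m+n\ge2\}$; (3) $\mathcal{T}_2=\{T_i\vee T_j\mid 1\le i,j\le3\}\cup\{T_i\vee T_4(m,n)\mid 1\le i\le3,\ m+n\ge2\}\cup\{T_4(m_1,n_1)\vee T_4(m_2,n_2)\mid m_1+n_1\ge2,\ m_2+n_2\ge2\}$.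
   Context: All graphs are finite and simple. For a connected graph $G$ with vertices $v_1,\ldots,v_n$, $d(v_i,v_j)$ is the length of a shortest path between $v_i$ and $v_j$, and the distance matrix is $D(G)=(d(v_i,v_j))_{n\times n}$. The distance eigenvalues of $G$ are the eigenvalues of $D(G)$, listed with multiplicity as $\partial_1\ge\partial_2\ge\cdots\ge\partial_n$. $G\vee H$ denotes the join of vertex-disjoint graphs (all edges between $G$ and $H$ added to $G\cup H$), $\cup$ denotes disjoint union, $K_s$ is the complete graph on $s$ vertices, and $mK_s$ is the disjoint union of $m$ copies of $K_s$ (empty if $m=0$). In the parametrised families, the letters $m,n,m_i,n_i$ are non-negative integer parameters; there $n$ is not the order of the graph.
   Formalization: The right-hand side is also restricted to graphs of order at least 4: the family T_1 contains K_1 ∨ T_4(0,2) = P_3, of order 3, which the left-hand class excludes, so the literal equality fails; only P_3 is removed. *)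

theory Defs
  imports
    "Graph_Theory.Graph_Theory"
    "Jordan_Normal_Form.Char_Poly"
    "HOL-Library.Multiset"
begin

text \<open>
  A finite simple graph is a \<^term>\<open>G\<close> satisfying \<^const>\<open>pair_graph\<close>, an edge \<open>uv\<close> being
  represented by the two arcs \<open>(u, v)\<close> and \<open>(v, u)\<close>.
\<close>

subsection \<open>Distance eigenvalues\<close>

definition gdist :: "'a pair_pre_digraph \<Rightarrow> 'a \<Rightarrow> 'a \<Rightarrow> nat" where
  "gdist G u v = (LEAST k. \<exists>p. pre_digraph.apath (with_proj G) u p v \<and> length p = k)"

definition distance_matrix :: "'a pair_pre_digraph \<Rightarrow> 'a list \<Rightarrow> real mat" where
  "distance_matrix G vs =
     mat (length vs) (length vs) (\<lambda>(i, j). real (gdist G (vs ! i) (vs ! j)))"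

text \<open>
  The enumeration \<open>v\<^sub>1, \<dots>, v\<^sub>n\<close> of the vertices is chosen arbitrarily; a different one
  conjugates the distance matrix by a permutation and leaves the spectrum unchanged.
\<close>

definition vertex_enum :: "'a pair_pre_digraph \<Rightarrow> 'a list" where
  "vertex_enum G = (SOME vs. distinct vs \<and> set vs = pverts G)"

text \<open>
  All roots of the characteristic polynomial are real, the distance matrix being symmetric,
  so this list has length \<open>n\<close>.
\<close>

definition distance_spectrum :: "'a pair_pre_digraph \<Rightarrow> real list" where
  "distance_spectrum G =
     rev (sorted_list_of_multiset (proots (char_poly (distance_matrix G (vertex_enum G)))))"

text \<open>\<open>distance_eigenvalue G k\<close> is \<open>\<partial>\<^sub>k\<close>, counted from 1.\<close>

definition distance_eigenvalue :: "'a pair_pre_digraph \<Rightarrow> nat \<Rightarrow> real" where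
  "distance_eigenvalue G k = distance_spectrum G ! (k - 1)"

subsection \<open>Graph constructions\<close>

definition disjoint_union ::
  "'a pair_pre_digraph \<Rightarrow> 'b pair_pre_digraph \<Rightarrow> ('a + 'b) pair_pre_digraph"
  (infixl "\<union>\<^sub>G" 65) where
  "G \<union>\<^sub>G H =
     \<lparr> pverts = pverts G <+> pverts H,
       parcs = map_prod Inl Inl ` parcs G \<union> map_prod Inr Inr ` parcs H \<rparr>"

definition join ::
  "'a pair_pre_digraph \<Rightarrow> 'b pair_pre_digraph \<Rightarrow> ('a + 'b) pair_pre_digraph"
  (infixl "\<or>\<^sub>G" 60) where
  "G \<or>\<^sub>G H =
     \<lparr> pverts = pverts (G \<union>\<^sub>G H),
       parcs = parcs (G \<union>\<^sub>G H) \<union> Inl ` pverts G \<times> Inr ` pverts H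
                             \<union> Inr ` pverts H \<times> Inl ` pverts G \<rparr>"

definition K :: "nat \<Rightarrow> nat pair_pre_digraph" where
  "K s = \<lparr> pverts = {..<s}, parcs = {(u, v). u < s \<and> v < s \<and> u \<noteq> v} \<rparr>"

text \<open>
  \<open>copies_K m s\<close> is \<open>mK\<^sub>s\<close> for \<open>s \<ge> 1\<close>: its \<open>i\<close>-th copy of \<open>K\<^sub>s\<close> lives on the block
  \<open>{i * s ..< (i + 1) * s}\<close>.
\<close>

definition copies_K :: "nat \<Rightarrow> nat \<Rightarrow> nat pair_pre_digraph" where
  "copies_K m s =
     \<lparr> pverts = {..<m * s},
       parcs = {(u, v). u < m * s \<and> v < m * s \<and> u \<noteq> v \<and> u div s = v div s} \<rparr>"

subsection \<open>The classes of graphs\<close>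

definition S :: "nat \<Rightarrow> nat \<Rightarrow> ((nat + nat) + (nat + nat)) pair_pre_digraph" where
  "S m n = (copies_K m 2 \<union>\<^sub>G copies_K n 1) \<or>\<^sub>G (K 5 \<union>\<^sub>G K 1)"

definition T1 :: "(nat + nat) pair_pre_digraph" where
  "T1 = K 4 \<union>\<^sub>G K 1"

definition T2 :: "(nat + nat) pair_pre_digraph" where
  "T2 = K 3 \<union>\<^sub>G copies_K 2 1"

definition T3 :: "(nat + nat) pair_pre_digraph" where
  "T3 = K 3 \<union>\<^sub>G K 1"

definition T4 :: "nat \<Rightarrow> nat \<Rightarrow> (nat + nat) pair_pre_digraph" where
  "T4 m n = copies_K m 2 \<union>\<^sub>G copies_K n 1"

definition up_to_iso :: "'b pair_pre_digraph set \<Rightarrow> 'a pair_pre_digraph set" where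
  "up_to_iso \<H> = {G. \<exists>H \<in> \<H>. digraph_iso (with_proj G) (with_proj H)}"

definition class_S :: "'a pair_pre_digraph set" where
  "class_S = up_to_iso {S m n | m n. m + n \<ge> 1}"

text \<open>
  \<open>class_T1\<close> contains one graph of order less than 4, the path \<open>K 1 \<or>\<^sub>G T4 0 2\<close> of order 3. It lies
  outside the range \<open>n \<ge> 4\<close> of the classification, so orders below 4 must be excluded on both sides.
\<close>

definition class_T1 :: "'a pair_pre_digraph set" where
  "class_T1 = up_to_iso
     ({K r \<or>\<^sub>G T | r T. r \<ge> 1 \<and> T \<in> {T1, T2, T3}}
      \<union> {K r \<or>\<^sub>G T4 m n | r m n. r \<ge> 1 \<and> m + n \<ge> 2})"

definition class_T2 :: "'a pair_pre_digraph set" where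
  "class_T2 = up_to_iso
     ({T \<or>\<^sub>G T' | T T'. T \<in> {T1, T2, T3} \<and> T' \<in> {T1, T2, T3}}
      \<union> {T \<or>\<^sub>G T4 m n | T m n. T \<in> {T1, T2, T3} \<and> m + n \<ge> 2}
      \<union> {T4 m1 n1 \<or>\<^sub>G T4 m2 n2 | m1 n1 m2 n2. m1 + n1 \<ge> 2 \<and> m2 + n2 \<ge> 2})"

definition class_G :: "'a pair_pre_digraph set" where
  "class_G = {G. pair_graph G \<and> Digraph_Component.connected (with_proj G)
     \<and> card (pverts G) \<ge> 4
     \<and> \<not> complete_digraph (card (pverts G)) (with_proj G)
     \<and> - 3 \<le> distance_eigenvalue G (card (pverts G))
     \<and> distance_eigenvalue G 3 \<le> - 1}"

end

theory Submission
  imports Defs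
begin

text \<open>
  Diagonalising \<open>D\<close> turns \<open>\<partial>\<^sub>n \<ge> -3\<close> into \<open>D + 3I \<ge> 0\<close>, and \<open>\<partial>\<^sub>3 \<le> -1\<close> into the existence of two linear forms
  on whose common kernel \<open>D + I \<le> 0\<close>. The first condition excludes an isometric path with four
  vertices, so the diameter is 2 and \<open>D + I = J + E\<close>, where \<open>E\<close> is the adjacency matrix of the complement.
  Both conditions are now inherited by induced subgraphs of the complement. Excluding \<open>C\<^sub>5\<close>, \<open>P\<^sub>5\<close> and
  \<open>P\<^sub>4 \<union> K\<^sub>1\<close> makes the complement free of \<open>P\<^sub>4\<close>; excluding the extensions of the paw makes its components
  complete multipartite; excluding \<open>2K\<^sub>2 \<union> K\<^sub>1\<close> leaves a join of two disjoint unions of cliques. A few more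
  forbidden complete multipartite graphs bound the clique sizes. Conversely, for a join of disjoint
  unions of cliques the two linear forms are the sums over the two sides, and \<open>D + 3I \<ge> 0\<close> is a sum of
  squares.
\<close>

section \<open>Diagonalisation of real symmetric matrices\<close>

text \<open>P4 and the paw cannot be excluded by themselves: for either of them E has least
  eigenvalue above -2 and J + E has only two positive eigenvalues. A fifth vertex is needed, and
  diameter 2 supplies it: a vertex not E-adjacent to either end of a chosen edge of E. The clique
  sizes come from one inequality. Let x have sum a on an independent set of alpha vertices and sum b
  on a clique of gamma vertices, with no edges between the two. By Cauchy-Schwarz x^T (E + 2I) x is
  at least (1 + 1/alpha) a^2 + 2 a b + (2/gamma) b^2, a form that is nonnegative iff alpha gamma <=
  2 (alpha + 1). The pairs (1, 4), (2, 3), (1, 3) of \<open>T1\<close>, \<open>T2\<close>,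
  \<open>T3\<close> satisfy it. The pair (1, 5) does not. K_5 u K_1 survives only because J adds the
  square of the total sum, which involves the opposite part: a part of maximum degree one
  contributes enough to compensate, a part with a triangle does not. Hence \<open>S\<close> is a
  family of its own, with m K_2 u n K_1 as the only partner.\<close>

lemma real_symmetric_char_poly_root:
  fixes A :: "real mat"
  assumes A: "A \<in> carrier_mat n n" and sym: "A\<^sup>T = A" and n: "n > 0"
  obtains e where "poly (char_poly A) e = 0"
proof -
  let ?C = "map_mat complex_of_real A"
  have C: "?C \<in> carrier_mat n n" using A by simp
  have "degree (char_poly ?C) = n" using degree_monic_char_poly[OF C] by simp
  then obtain z where z: "poly (char_poly ?C) z = 0"
    using n fundamental_theorem_of_algebra[of "char_poly ?C"]
    by (auto simp: constant_degree)
  then have "eigenvalue ?C z" using eigenvalue_root_char_poly[OF C] by simp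
  then obtain v where v: "v \<in> carrier_vec n" "v \<noteq> 0\<^sub>v n" "?C *\<^sub>v v = z \<cdot>\<^sub>v v"
    using C unfolding eigenvalue_def eigenvector_def by auto
  have ev: "(\<Sum>j<n. of_real (A $$ (i,j)) * v $ j) = z * v $ i" if "i < n" for i
  proof -
    have "(\<Sum>j<n. of_real (A $$ (i,j)) * v $ j) = (?C *\<^sub>v v) $ i"
      using that A v(1) by (simp add: scalar_prod_def atLeast0LessThan)
    then show ?thesis using that v by simp
  qed
  have symA: "A $$ (i,j) = A $$ (j,i)" if "i < n" "j < n" for i j
    using arg_cong[OF sym, of "\<lambda>B. B $$ (j,i)"] A that by simp
  let ?s = "\<Sum>i<n. cnj (v $ i) * v $ i"
  \<comment> \<open>\<open>?q\<close> is the Hermitian form of \<open>A\<close> at \<open>v\<close>.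
    It is real by symmetry and equals \<open>z\<close> times the nonzero real number
    \<open>?s\<close>, so \<open>z\<close> is real.\<close>
  let ?q = "\<Sum>i<n. \<Sum>j<n. cnj (v $ i) * (of_real (A $$ (i,j)) * v $ j)"
  have q: "?q = z * ?s"
    by (simp add: sum_distrib_left[symmetric] ev) (simp add: sum_distrib_left mult_ac)
  have "cnj ?q = (\<Sum>i<n. \<Sum>j<n. v $ i * (of_real (A $$ (i,j)) * cnj (v $ j)))"
    by simp
  also have "\<dots> = (\<Sum>j<n. \<Sum>i<n. v $ i * (of_real (A $$ (i,j)) * cnj (v $ j)))"
    by (rule sum.swap)
  also have "\<dots> = ?q"
    by (intro sum.cong refl) (use symA in \<open>auto simp: mult_ac\<close>)
  finally have "cnj (z * ?s) = z * ?s" unfolding q .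
  moreover have "cnj ?s = ?s" by (simp add: mult.commute)
  moreover have "?s \<noteq> 0"
  proof
    assume "?s = 0"
    moreover have "?s = of_real (\<Sum>i<n. (cmod (v $ i))\<^sup>2)"
      by (simp add: complex_norm_square mult.commute del: of_real_power)
    ultimately have "(\<Sum>i<n. (cmod (v $ i))\<^sup>2) = 0" by (metis of_real_eq_0_iff)
    then have "\<forall>i<n. v $ i = 0" by (subst (asm) sum_nonneg_eq_0_iff) auto
    then have "v = 0\<^sub>v n" using v(1) by (intro eq_vecI) auto
    then show False using v(2) by simp
  qed
  ultimately have "cnj z = z" by (metis complex_cnj_mult mult_right_cancel)
  then have "z = of_real (Re z)" by (simp add: complex_eq_iff)
  moreover have "char_poly ?C = map_poly complex_of_real (char_poly A)"
    by (rule of_real_hom.char_poly_hom[OF A])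
  ultimately have "complex_of_real (poly (char_poly A) (Re z)) = 0"
    using z of_real_hom.poly_map_poly by metis
  then show ?thesis using that by simp
qed

text \<open>\<open>W\<close> is the Householder reflection exchanging the first unit vector e_0 and
  \<open>v\<close>: with u = v - e_0 it is I - (2 / |u|^2) u u^T, and |u|^2 = 2 - 2 v_0 explains
  \<open>c\<close>. If v_0 = 1, then v = e_0 and u = 0, so the identity is taken. A reflection is
  its own inverse and its own transpose, which shortens the products in the diagonalisation.\<close>

lemma orthogonal_mat_with_first_col:
  fixes v :: "nat \<Rightarrow> real"
  assumes v: "(\<Sum>i<Suc m. (v i)\<^sup>2) = 1"
  obtains W where "W \<in> carrier_mat (Suc m) (Suc m)" "W\<^sup>T = W" "W * W = 1\<^sub>m (Suc m)"
    "\<And>i. i < Suc m \<Longrightarrow> W $$ (i, 0) = v i"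
proof (cases "v 0 = 1")
  case True
  have "(\<Sum>i<Suc m. (v i)\<^sup>2) = (v 0)\<^sup>2 + (\<Sum>i<m. (v (Suc i))\<^sup>2)"
    by (rule sum.lessThan_Suc_shift)
  then have "(\<Sum>i<m. (v (Suc i))\<^sup>2) = 0" using v True by simp
  then have "\<forall>i<m. v (Suc i) = 0" by (subst (asm) sum_nonneg_eq_0_iff) auto
  then have "\<And>i. i < Suc m \<Longrightarrow> (1\<^sub>m (Suc m) :: real mat) $$ (i, 0) = v i"
    using True by (auto simp: less_Suc_eq_0_disj)
  then show ?thesis by (intro that[of "1\<^sub>m (Suc m)"]) auto
next
  case False
  define u where "u i = v i - (if i = 0 then 1 else 0)" for i
  define c where "c = 1 / (1 - v 0)"
  let ?W = "mat (Suc m) (Suc m) (\<lambda>(i,j). (if i = j then 1 else 0) - c * u i * u j)"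
  have uu: "(\<Sum>k<Suc m. u k * u k) = 2 - 2 * v 0"
  proof -
    have "u k * u k = (v k)\<^sup>2 + (if k = 0 then 1 - 2 * v 0 else 0)" for k
      by (simp add: u_def power2_eq_square algebra_simps)
    then have "(\<Sum>k<Suc m. u k * u k) = 1 + (\<Sum>k<Suc m. if k = 0 then 1 - 2 * v 0 else 0)"
      by (simp only: sum.distrib v)
    then show ?thesis by simp
  qed
  have cuu: "c * (\<Sum>k<Suc m. u k * u k) = 2"
    unfolding uu c_def using False by (simp add: field_simps)
  have "(\<Sum>k<Suc m. ((if i = k then 1 else 0) - c * u i * u k) *
          ((if k = j then 1 else 0) - c * u k * u j)) = (if i = j then 1 else 0)"
    if ij: "i < Suc m" "j < Suc m" for i j
  proof -
    have "(\<Sum>k<Suc m. ((if i = k then 1 else 0) - c * u i * u k) *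
            ((if k = j then 1 else 0) - c * u k * u j)) =
          (\<Sum>k<Suc m. (if k = i then (if i = j then 1 else 0) - c * u i * u j else 0)
             - (if k = j then c * u i * u j else 0) + c * u i * u j * (c * (u k * u k)))"
      by (intro sum.cong refl) (auto simp: algebra_simps)
    also have "\<dots> = ((if i = j then 1 else 0) - c * u i * u j) - c * u i * u j
        + c * u i * u j * (c * (\<Sum>k<Suc m. u k * u k))"
      using ij unfolding sum.distrib sum_subtractf sum_distrib_left by simp
    finally show ?thesis unfolding cuu by simp
  qed
  then have "?W * ?W = 1\<^sub>m (Suc m)"
    by (intro eq_matI) (auto simp: scalar_prod_def atLeast0LessThan)
  moreover have "?W $$ (i, 0) = v i" if "i < Suc m" for i
    using that False by (auto simp: u_def c_def field_simps)
  ultimately show ?thesis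
    by (intro that[of ?W]) (auto intro!: eq_matI)
qed


lemma block_diag_mult:
  fixes a b :: "'a :: comm_ring_1 mat"
  assumes "a \<in> carrier_mat k k" "b \<in> carrier_mat k k" "A \<in> carrier_mat m m" "B \<in> carrier_mat m m"
  shows "four_block_mat a (0\<^sub>m k m) (0\<^sub>m m k) A * four_block_mat b (0\<^sub>m k m) (0\<^sub>m m k) B =
    four_block_mat (a * b) (0\<^sub>m k m) (0\<^sub>m m k) (A * B)"
proof -
  note zs = zero_carrier_mat[of k m] zero_carrier_mat[of m k]
  have "a * b \<in> carrier_mat k k" "A * B \<in> carrier_mat m m" using assms by auto
  then show ?thesis
    using assms by (simp add: mult_four_block_mat[OF assms(1) zs assms(3) assms(2) zs assms(4)])
qed

text \<open>Deflation: if the first column of the reflection \<open>W\<close> is a unit eigenvector,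
  then \<open>B\<close> = W A W is symmetric and its first column vanishes below \<open>e\<close>,
  so it is block diagonal and the induction hypothesis applies to the remaining block
  \<open>C\<close>. The roots of the characteristic polynomial and the diagonal arise as one list,
  so algebraic multiplicities need no separate comparison with eigenspaces.\<close>

lemma real_symmetric_diagonalization:
  fixes A :: "real mat"
  assumes "A \<in> carrier_mat n n" "A\<^sup>T = A"
  shows "\<exists>es P. length es = n \<and> char_poly A = (\<Prod>e\<leftarrow>es. [:- e, 1:]) \<and>
    P \<in> carrier_mat n n \<and> P\<^sup>T * P = 1\<^sub>m n \<and> P\<^sup>T * A * P = mat_diag n (\<lambda>i. es ! i)"
  using assms
proof (induction n arbitrary: A)
  case 0
  then have "char_poly A = 1" by (simp add: char_poly_defs)
  then show ?case using 0
    by (intro exI[of _ "[]"] exI[of _ A]) (auto intro!: eq_matI simp: mat_diag_def)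
next
  case (Suc m)
  let ?n = "Suc m"
  note A = Suc.prems(1) and sym = Suc.prems(2)
  obtain e where "poly (char_poly A) e = 0"
    using real_symmetric_char_poly_root[OF A sym] by auto
  then have "eigenvalue A e" using eigenvalue_root_char_poly[OF A] by simp
  then obtain y where y: "y \<in> carrier_vec ?n" "y \<noteq> 0\<^sub>v ?n" "A *\<^sub>v y = e \<cdot>\<^sub>v y"
    using A unfolding eigenvalue_def eigenvector_def by auto
  define s where "s = sqrt (\<Sum>i<?n. (y $ i)\<^sup>2)"
  have s2: "s\<^sup>2 = (\<Sum>i<?n. (y $ i)\<^sup>2)" unfolding s_def by (simp add: sum_nonneg)
  have "s \<noteq> 0"
  proof
    assume "s = 0"
    then have "(\<Sum>i<?n. (y $ i)\<^sup>2) = 0" using s2 by simp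
    then have "\<forall>i<?n. y $ i = 0" by (subst (asm) sum_nonneg_eq_0_iff) auto
    then have "y = 0\<^sub>v ?n" using y(1) by (intro eq_vecI) auto
    then show False using y(2) by simp
  qed
  then have "(\<Sum>i<?n. (y $ i)\<^sup>2) \<noteq> 0" using s2 by (metis power_not_zero)
  then have "(\<Sum>i<?n. (y $ i / s)\<^sup>2) = 1"
    using s2 by (simp add: power_divide sum_divide_distrib[symmetric] del: sum.lessThan_Suc)
  then obtain W where W: "W \<in> carrier_mat ?n ?n" "W\<^sup>T = W" "W * W = 1\<^sub>m ?n"
    and W0: "\<And>i. i < ?n \<Longrightarrow> W $$ (i, 0) = y $ i / s"
    using orthogonal_mat_with_first_col[of "\<lambda>i. y $ i / s"] by metis
  define B where "B = W * (A * W)"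
  have B: "B \<in> carrier_mat ?n ?n" unfolding B_def using A W by simp
  have "B\<^sup>T = (A * W)\<^sup>T * W\<^sup>T" unfolding B_def
    by (rule transpose_mult[of _ ?n ?n _ ?n]) (use A W in auto)
  also have "(A * W)\<^sup>T = W\<^sup>T * A\<^sup>T" by (rule transpose_mult[of _ ?n ?n _ ?n]) (use A W in auto)
  finally have "B\<^sup>T = W * A * W" unfolding W(2) Suc.prems(2) .
  then have symB: "B\<^sup>T = B" unfolding B_def using assoc_mult_mat[OF W(1) A W(1)] by simp
  have colW: "col W 0 = (1 / s) \<cdot>\<^sub>v y" using W(1) y(1) by (intro eq_vecI) (auto simp: W0)
  have AW: "A * W \<in> carrier_mat ?n ?n" using A W(1) by simp
  have "col B 0 = W *\<^sub>v col (A * W) 0" unfolding B_def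
    by (rule col_mult2[OF W(1) AW]) simp
  also have "col (A * W) 0 = A *\<^sub>v col W 0"
    by (rule col_mult2[OF A W(1)]) simp
  also have "A *\<^sub>v col W 0 = e \<cdot>\<^sub>v col W 0"
  proof -
    have "A *\<^sub>v ((1 / s) \<cdot>\<^sub>v y) = (1 / s) \<cdot>\<^sub>v (e \<cdot>\<^sub>v y)"
      using mult_mat_vec[OF A y(1)] y(3) by simp
    also have "\<dots> = e \<cdot>\<^sub>v ((1 / s) \<cdot>\<^sub>v y)"
      by (simp only: smult_smult_assoc mult.commute[of e])
    finally show ?thesis unfolding colW .
  qed
  finally have colB0: "col B 0 = W *\<^sub>v (e \<cdot>\<^sub>v col W 0)" .
  have cW: "col W 0 \<in> carrier_vec ?n" using W(1) by (metis carrier_matD(1) col_dim carrier_vecI)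
  have "W *\<^sub>v col W 0 = col (W * W) 0" using col_mult2[OF W(1) W(1), of 0] by simp
  then have "col B 0 = e \<cdot>\<^sub>v unit_vec ?n 0"
    unfolding colB0 mult_mat_vec[OF W(1) cW] W(3) by simp
  then have "col B 0 $ i = (e \<cdot>\<^sub>v unit_vec ?n 0) $ i" for i by (rule arg_cong)
  moreover have "B $$ (i, 0) = col B 0 $ i" if "i < ?n" for i using that B by simp
  ultimately have colB: "B $$ (i, 0) = (if i = 0 then e else 0)" if "i < ?n" for i
    using that by simp
  have rowB: "B $$ (0, i) = (if i = 0 then e else 0)" if "i < ?n" for i
    using colB[OF that] arg_cong[OF symB, of "\<lambda>C. C $$ (i, 0)"] B that by simp
  define C where "C = mat m m (\<lambda>(i,j). B $$ (Suc i, Suc j))"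
  have C: "C \<in> carrier_mat m m" unfolding C_def by simp
  have symC: "C\<^sup>T = C"
  proof (rule eq_matI)
    fix i j assume "i < dim_row C" "j < dim_col C"
    then show "C\<^sup>T $$ (i,j) = C $$ (i,j)"
      using arg_cong[OF symB, of "\<lambda>C. C $$ (Suc i, Suc j)"] B by (simp add: C_def)
  qed (simp_all add: C_def)
  let ?E = "mat 1 1 (\<lambda>_. e)"
  have B_block: "B = four_block_mat ?E (0\<^sub>m 1 m) (0\<^sub>m m 1) C"
  proof (rule eq_matI)
    fix i j
    assume "i < dim_row (four_block_mat ?E (0\<^sub>m 1 m) (0\<^sub>m m 1) C)"
      and "j < dim_col (four_block_mat ?E (0\<^sub>m 1 m) (0\<^sub>m m 1) C)"
    then show "B $$ (i,j) = four_block_mat ?E (0\<^sub>m 1 m) (0\<^sub>m m 1) C $$ (i,j)"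
      using C colB rowB by (cases i; cases j) (auto simp: C_def)
  qed (use B C in auto)
  obtain es Q where IH: "length es = m" "char_poly C = (\<Prod>e\<leftarrow>es. [:- e, 1:])"
    "Q \<in> carrier_mat m m" "Q\<^sup>T * Q = 1\<^sub>m m" "Q\<^sup>T * C * Q = mat_diag m (\<lambda>i. es ! i)"
    using Suc.IH[OF C symC] by auto
  have "W * B = W * W * (A * W)" unfolding B_def
    by (rule assoc_mult_mat[symmetric, OF W(1) W(1) AW])
  then have "W * B * W = A * W * W" unfolding W(3) left_mult_one_mat[OF AW] by simp
  also have "\<dots> = A * (W * W)" by (rule assoc_mult_mat[OF A W(1) W(1)])
  finally have "A = W * B * W" unfolding W(3) right_mult_one_mat[OF A] by (rule HOL.sym)
  then have "similar_mat_wit A B W W" by (rule similar_mat_witI[OF W(3) W(3) _ A B W(1) W(1)])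
  then have "char_poly A = char_poly B"
    by (intro char_poly_similar) (auto simp: similar_mat_def)
  also have "\<dots> = char_poly ?E * char_poly C" unfolding B_block
    by (rule char_poly_four_block_zeros_col[OF _ _ C]) auto
  also have "char_poly ?E = [:- e, 1:]"
    by (simp add: char_poly_defs det_single)
  finally have cp: "char_poly A = (\<Prod>e\<leftarrow>e # es. [:- e, 1:])" by (simp add: IH(2))
  define R where "R = four_block_mat (1\<^sub>m 1) (0\<^sub>m 1 m) (0\<^sub>m m 1) Q"
  have "R \<in> carrier_mat (1 + m) (1 + m)"
    unfolding R_def by (rule four_block_carrier_mat[OF one_carrier_mat IH(3)])
  then have R: "R \<in> carrier_mat ?n ?n" by simp
  have RT: "R\<^sup>T = four_block_mat (1\<^sub>m 1) (0\<^sub>m 1 m) (0\<^sub>m m 1) Q\<^sup>T"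
    unfolding R_def
      transpose_four_block_mat[OF one_carrier_mat zero_carrier_mat zero_carrier_mat IH(3)]
    by simp
  have QT: "Q\<^sup>T \<in> carrier_mat m m" using IH(3) by simp
  have "R\<^sup>T * R = four_block_mat (1\<^sub>m 1 * 1\<^sub>m 1) (0\<^sub>m 1 m) (0\<^sub>m m 1) (Q\<^sup>T * Q)"
    unfolding RT unfolding R_def by (rule block_diag_mult[OF _ _ QT IH(3)]) simp_all
  then have RR: "R\<^sup>T * R = 1\<^sub>m ?n"
    unfolding IH(4) left_mult_one_mat[OF one_carrier_mat] four_block_one_mat by simp
  have "R\<^sup>T * B = four_block_mat (1\<^sub>m 1 * ?E) (0\<^sub>m 1 m) (0\<^sub>m m 1) (Q\<^sup>T * C)"
    unfolding RT B_block by (rule block_diag_mult[OF _ _ QT C]) simp_all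
  moreover have "four_block_mat (1\<^sub>m 1 * ?E) (0\<^sub>m 1 m) (0\<^sub>m m 1) (Q\<^sup>T * C) * R =
      four_block_mat (1\<^sub>m 1 * ?E * 1\<^sub>m 1) (0\<^sub>m 1 m) (0\<^sub>m m 1) (Q\<^sup>T * C * Q)"
    unfolding R_def by (rule block_diag_mult[OF _ _ mult_carrier_mat[OF QT C] IH(3)]) simp_all
  ultimately have "R\<^sup>T * B * R =
      four_block_mat (1\<^sub>m 1 * ?E * 1\<^sub>m 1) (0\<^sub>m 1 m) (0\<^sub>m m 1) (mat_diag m (\<lambda>i. es ! i))"
    unfolding IH(5) by simp
  moreover have "1\<^sub>m 1 * ?E * 1\<^sub>m 1 = ?E" by simp
  moreover have "four_block_mat ?E (0\<^sub>m 1 m) (0\<^sub>m m 1) (mat_diag m (\<lambda>i. es ! i)) =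
      mat_diag ?n (\<lambda>i. (e # es) ! i)"
    by (rule eq_matI) (auto simp: mat_diag_def nth_Cons')
  ultimately have RBR: "R\<^sup>T * B * R = mat_diag ?n (\<lambda>i. (e # es) ! i)" by simp
  define P where "P = W * R"
  have P: "P \<in> carrier_mat ?n ?n" unfolding P_def using W R by simp
  have PT: "P\<^sup>T = R\<^sup>T * W" unfolding P_def by (subst transpose_mult[OF W(1) R]) (simp add: W(2))
  have RTc: "R\<^sup>T \<in> carrier_mat ?n ?n" using R by simp
  have WR: "W * R \<in> carrier_mat ?n ?n" using W(1) R by simp
  have "P\<^sup>T * P = R\<^sup>T * (W * (W * R))" unfolding PT unfolding P_def
    by (rule assoc_mult_mat[OF RTc W(1) WR])
  also have "W * (W * R) = W * W * R" by (rule assoc_mult_mat[symmetric, OF W(1) W(1) R])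
  finally have PP: "P\<^sup>T * P = 1\<^sub>m ?n" unfolding W(3) left_mult_one_mat[OF R] RR .
  have WA: "W * A \<in> carrier_mat ?n ?n" and RW: "R\<^sup>T * W \<in> carrier_mat ?n ?n"
    using W(1) A RTc by simp_all
  have "P\<^sup>T * A * P = R\<^sup>T * W * (A * (W * R))" unfolding PT unfolding P_def
    by (rule assoc_mult_mat[OF RW A WR])
  also have "A * (W * R) = A * W * R" by (rule assoc_mult_mat[symmetric, OF A W(1) R])
  also have "R\<^sup>T * W * (A * W * R) = R\<^sup>T * W * (A * W) * R"
    by (rule assoc_mult_mat[symmetric, OF RW AW R])
  also have "R\<^sup>T * W * (A * W) = R\<^sup>T * B" unfolding B_def
    by (rule assoc_mult_mat[OF RTc W(1) AW])
  finally have "P\<^sup>T * A * P = R\<^sup>T * B * R" .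
  then show ?case using cp P PP RBR IH(1)
    by (intro exI[of _ "e # es"] exI[of _ P]) simp
qed

text \<open>Row k of \<open>c\<close> is the k-th vector of an orthonormal eigenbasis. Functions
  replace matrices because the variational arguments only evaluate sums; the last clause provides
  their test vectors.\<close>

definition eigen_coordinates :: "real mat \<Rightarrow> real list \<Rightarrow> (nat \<Rightarrow> nat \<Rightarrow> real) \<Rightarrow> bool" where
  "eigen_coordinates A es c \<longleftrightarrow> (let n = dim_row A in
    (\<forall>i j. i \<le> j \<longrightarrow> j < n \<longrightarrow> es ! j \<le> es ! i) \<and>
    (\<forall>x. (\<Sum>i<n. \<Sum>j<n. x i * x j * A $$ (i, j)) = (\<Sum>k<n. es ! k * (\<Sum>i<n. c k i * x i)\<^sup>2)) \<and>
    (\<forall>x. (\<Sum>i<n. (x i)\<^sup>2) = (\<Sum>k<n. (\<Sum>i<n. c k i * x i)\<^sup>2)) \<and>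
    (\<forall>y. \<exists>x. \<forall>k<n. (\<Sum>i<n. c k i * x i) = y k))"

lemma real_symmetric_eigen_coordinates:
  fixes A :: "real mat"
  assumes A: "A \<in> carrier_mat n n" and symA: "A\<^sup>T = A"
  defines "es \<equiv> rev (sorted_list_of_multiset (proots (char_poly A)))"
  obtains c where "eigen_coordinates A es c"
proof -
  obtain ds P where D: "length ds = n" "char_poly A = (\<Prod>e\<leftarrow>ds. [:- e, 1:])"
    "P \<in> carrier_mat n n" "P\<^sup>T * P = 1\<^sub>m n" "P\<^sup>T * A * P = mat_diag n (\<lambda>i. ds ! i)"
    using real_symmetric_diagonalization[OF A symA] by auto
  let ?L = "mat_diag n (\<lambda>i. ds ! i)"
  have PT: "P\<^sup>T \<in> carrier_mat n n" using D(3) by simp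
  have PPT: "P * P\<^sup>T = 1\<^sub>m n" by (rule mat_mult_left_right_inverse[OF PT D(3,4)])
  have AP: "A * P \<in> carrier_mat n n" using A D(3) by simp
  have PAP: "P\<^sup>T * A * P = P\<^sup>T * (A * P)" by (rule assoc_mult_mat[OF PT A D(3)])
  have "P * ?L = P * P\<^sup>T * (A * P)"
    unfolding D(5)[symmetric] PAP by (rule assoc_mult_mat[symmetric, OF D(3) PT AP])
  then have "P * ?L = A * P" unfolding PPT left_mult_one_mat[OF AP] .
  then have "P * ?L * P\<^sup>T = A * (P * P\<^sup>T)" using assoc_mult_mat[OF A D(3) PT] by simp
  then have "A = P * ?L * P\<^sup>T" unfolding PPT right_mult_one_mat[OF A] by simp
  then have "A = mat n n (\<lambda>(i, j). P $$ (i, j) * ds ! j) * P\<^sup>T"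
    using mat_diag_mult_right[OF D(3)] by simp
  then have Aij: "A $$ (i, j) = (\<Sum>k<n. P $$ (i, k) * ds ! k * P $$ (j, k))" if "i < n" "j < n" for i j
    using that D(3) by (simp add: scalar_prod_def atLeast0LessThan)
  have row: "(\<Sum>k<n. P $$ (i, k) * P $$ (j, k)) = (if i = j then 1 else 0)" if "i < n" "j < n" for i j
    using arg_cong[OF PPT, of "\<lambda>M. M $$ (i, j)"] that D(3)
    by (simp add: scalar_prod_def atLeast0LessThan)
  have col: "(\<Sum>i<n. P $$ (i, k) * P $$ (i, l)) = (if k = l then 1 else 0)" if "k < n" "l < n" for k l
    using arg_cong[OF D(4), of "\<lambda>M. M $$ (k, l)"] that D(3)
    by (simp add: scalar_prod_def atLeast0LessThan)
  have "proots (\<Prod>e\<leftarrow>ds. [:- e, 1:]) = mset ds"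
  proof (induction ds)
    case (Cons e ds)
    have "(\<Prod>e\<leftarrow>ds. [:- e, 1:]) \<noteq> 0" by (auto simp: prod_list_zero_iff)
    then show ?case using proots_linear_factor[of e] Cons.IH
      by (simp add: proots_mult del: mult_pCons_left)
  qed simp
  then have es: "mset es = mset ds" unfolding es_def D(2) by simp
  have len: "length es = n" using es D(1) by (metis size_mset)
  \<comment> \<open>The induction yields \<open>ds\<close> in no particular order, whereas
    \<open>es\<close> is sorted. They agree as multisets, and \<open>p\<close> rearranges the
    columns of \<open>P\<close> accordingly.\<close>
  obtain p where p: "p permutes {..<n}" "permute_list p ds = es"
    using mset_eq_permutation[OF es] D(1) by auto
  have esp: "es ! k = ds ! p k" if "k < n" for k
    using p that D(1) permute_list_nth by metis
  have pn: "p k < n" if "k < n" for k using p(1) that permutes_in_image by fastforce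
  have rp: "(\<Sum>k<n. f (p k)) = (\<Sum>k<n. f k)" for f :: "nat \<Rightarrow> real"
    using sum.permute[OF p(1), of f] by (simp add: o_def)
  have sq: "(\<Sum>k<n. w k * (\<Sum>i<n. P $$ (i, k) * x i)\<^sup>2) =
      (\<Sum>i<n. \<Sum>j<n. x i * x j * (\<Sum>k<n. P $$ (i, k) * w k * P $$ (j, k)))" for x w
  proof -
    have "(\<Sum>k<n. w k * (\<Sum>i<n. P $$ (i, k) * x i)\<^sup>2) =
      (\<Sum>k<n. \<Sum>i<n. \<Sum>j<n. x i * x j * (P $$ (i, k) * w k * P $$ (j, k)))"
      by (simp add: power2_eq_square sum_product sum_distrib_left mult_ac)
    also have "\<dots> = (\<Sum>i<n. \<Sum>k<n. \<Sum>j<n. x i * x j * (P $$ (i, k) * w k * P $$ (j, k)))"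
      by (rule sum.swap)
    also have "\<dots> = (\<Sum>i<n. \<Sum>j<n. \<Sum>k<n. x i * x j * (P $$ (i, k) * w k * P $$ (j, k)))"
      by (intro sum.cong refl sum.swap)
    finally show ?thesis by (simp add: sum_distrib_left)
  qed
  define c where "c k i = P $$ (i, p k)" for k i
  have "(\<Sum>i<n. \<Sum>j<n. x i * x j * A $$ (i, j)) = (\<Sum>k<n. es ! k * (\<Sum>i<n. c k i * x i)\<^sup>2)" for x
  proof -
    have "(\<Sum>k<n. es ! k * (\<Sum>i<n. c k i * x i)\<^sup>2) =
        (\<Sum>k<n. ds ! p k * (\<Sum>i<n. P $$ (i, p k) * x i)\<^sup>2)"
      by (simp add: c_def esp)
    also have "\<dots> = (\<Sum>k<n. ds ! k * (\<Sum>i<n. P $$ (i, k) * x i)\<^sup>2)" by (rule rp)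
    finally show ?thesis unfolding sq by (simp add: Aij)
  qed
  moreover have "(\<Sum>i<n. (x i)\<^sup>2) = (\<Sum>k<n. (\<Sum>i<n. c k i * x i)\<^sup>2)" for x
  proof -
    have "(\<Sum>k<n. (\<Sum>i<n. c k i * x i)\<^sup>2) = (\<Sum>k<n. 1 * (\<Sum>i<n. P $$ (i, k) * x i)\<^sup>2)"
      using rp[of "\<lambda>k. (\<Sum>i<n. P $$ (i, k) * x i)\<^sup>2"] by (simp add: c_def)
    also have "\<dots> = (\<Sum>i<n. \<Sum>j<n. if i = j then x i * x j else 0)"
      unfolding sq by (intro sum.cong refl) (simp add: row)
    finally show ?thesis by (simp add: power2_eq_square)
  qed
  moreover have "\<exists>x. \<forall>k<n. (\<Sum>i<n. c k i * x i) = y k" for y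
  proof (intro exI allI impI)
    fix k assume k: "k < n"
    have "(\<Sum>i<n. c k i * (\<Sum>l<n. c l i * y l)) = (\<Sum>i<n. \<Sum>l<n. (P $$ (i, p k) * P $$ (i, p l)) * y l)"
      by (simp add: c_def sum_distrib_left mult_ac)
    also have "\<dots> = (\<Sum>l<n. (\<Sum>i<n. P $$ (i, p k) * P $$ (i, p l)) * y l)"
      by (subst sum.swap) (simp add: sum_distrib_right)
    also have "\<dots> = (\<Sum>l<n. if k = l then y l else 0)"
      using k pn permutes_inj[OF p(1)] by (intro sum.cong refl) (auto simp: col dest: injD)
    finally show "(\<Sum>i<n. c k i * (\<Sum>l<n. c l i * y l)) = y k" using k by simp
  qed
  moreover have "es ! j \<le> es ! i" if "i \<le> j" "j < n" for i j
  proof -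
    have "sorted (rev es)" unfolding es_def by simp
    then show ?thesis using sorted_rev_nth_mono[of es i j] that len by simp
  qed
  ultimately show thesis using A by (intro that[of c]) (simp add: eigen_coordinates_def)
qed

section \<open>Quadratic forms\<close>

definition bform :: "'a set \<Rightarrow> ('a \<Rightarrow> 'a \<Rightarrow> real) \<Rightarrow> ('a \<Rightarrow> real) \<Rightarrow> ('a \<Rightarrow> real) \<Rightarrow> real" where
  "bform V M x y = (\<Sum>u\<in>V. \<Sum>v\<in>V. x u * y v * M u v)"

lemma bform_commute:
  assumes "\<And>u v. M u v = M v u"
  shows "bform V M x y = bform V M y x"
  unfolding bform_def by (subst sum.swap) (simp add: assms mult_ac)

lemma bform_add_left: "bform V M (\<lambda>v. x v + y v) z = bform V M x z + bform V M y z"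
  by (simp add: bform_def algebra_simps sum.distrib)

lemma bform_scale_left: "bform V M (\<lambda>v. c * x v) z = c * bform V M x z"
  by (simp add: bform_def sum_distrib_left mult_ac)

lemma bform_add_right: "bform V M z (\<lambda>v. x v + y v) = bform V M z x + bform V M z y"
  by (simp add: bform_def algebra_simps sum.distrib)

lemma bform_scale_right: "bform V M z (\<lambda>v. c * x v) = c * bform V M z x"
  by (simp add: bform_def sum_distrib_left mult_ac)

lemmas bform_linear = bform_add_left bform_add_right bform_scale_left bform_scale_right

text \<open>The cross product of the two coefficient vectors is a solution. If it vanishes, the
  vectors are parallel, and anything orthogonal to a nonzero one of them will do.\<close>

lemma two_equations_three_unknowns:
  fixes f1 f2 f3 g1 g2 g3 :: real
  obtains a b c where "(a, b, c) \<noteq> (0, 0, 0)"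
    "f1 * a + f2 * b + f3 * c = 0" "g1 * a + g2 * b + g3 * c = 0"
proof (cases "f2 * g3 = f3 * g2 \<and> f3 * g1 = f1 * g3 \<and> f1 * g2 = f2 * g1")
  case False
  then show ?thesis
    by (intro that[of "f2 * g3 - f3 * g2" "f3 * g1 - f1 * g3" "f1 * g2 - f2 * g1"])
      (auto simp: algebra_simps)
next
  case True
  consider "f1 \<noteq> 0 \<or> f2 \<noteq> 0" | "f3 \<noteq> 0" | "g1 \<noteq> 0 \<or> g2 \<noteq> 0" | "g3 \<noteq> 0"
    | "f1 = 0" "f2 = 0" "f3 = 0" "g1 = 0" "g2 = 0" "g3 = 0" by blast
  then show ?thesis
  proof cases
    case 1 then show ?thesis using True by (intro that[of f2 "- f1" 0]) (auto simp: algebra_simps)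
  next
    case 2 then show ?thesis using True by (intro that[of 0 f3 "- f2"]) (auto simp: algebra_simps)
  next
    case 3 then show ?thesis using True by (intro that[of g2 "- g1" 0]) (auto simp: algebra_simps)
  next
    case 4 then show ?thesis using True by (intro that[of 0 g3 "- g2"]) (auto simp: algebra_simps)
  next
    case 5 then show ?thesis by (intro that[of 1 0 0]) auto
  qed
qed

text \<open>A dimension count: the span of x, y, z contains a nontrivial combination on which both
  linear forms vanish, but orthogonality makes the quadratic form a positive combination of the
  squared coefficients.\<close>

lemma no_three_orthogonal_positive:
  assumes sym: "\<And>u v. M u v = M v u"
    and two: "\<And>x. (\<Sum>v\<in>V. f v * x v) = 0 \<Longrightarrow> (\<Sum>v\<in>V. g v * x v) = 0 \<Longrightarrow> bform V M x x \<le> 0"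
    and pos: "bform V M x x > 0" "bform V M y y > 0" "bform V M z z > 0"
    and orth: "bform V M x y = 0" "bform V M x z = 0" "bform V M y z = 0"
  shows False
proof -
  let ?f = "\<lambda>x. \<Sum>v\<in>V. f v * x v" and ?g = "\<lambda>x. \<Sum>v\<in>V. g v * x v"
  obtain a b c where abc: "(a, b, c) \<noteq> (0, 0, 0)"
    "?f x * a + ?f y * b + ?f z * c = 0" "?g x * a + ?g y * b + ?g z * c = 0"
    by (rule two_equations_three_unknowns)
  let ?w = "\<lambda>v. a * x v + b * y v + c * z v"
  have "?f ?w = ?f x * a + ?f y * b + ?f z * c" "?g ?w = ?g x * a + ?g y * b + ?g z * c"
    by (simp_all add: sum_distrib_left sum_distrib_right algebra_simps sum.distrib)
  then have "bform V M ?w ?w \<le> 0" using two abc by simp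
  moreover have "bform V M ?w ?w = a\<^sup>2 * bform V M x x + b\<^sup>2 * bform V M y y + c\<^sup>2 * bform V M z z"
    using orth bform_commute[of M V, OF sym] by (simp add: bform_linear power2_eq_square algebra_simps)
  moreover have "a\<^sup>2 * bform V M x x \<ge> 0" "b\<^sup>2 * bform V M y y \<ge> 0" "c\<^sup>2 * bform V M z z \<ge> 0"
    using pos by simp_all
  ultimately have "a\<^sup>2 * bform V M x x = 0" "b\<^sup>2 * bform V M y y = 0" "c\<^sup>2 * bform V M z z = 0"
    by linarith+
  then show False using pos abc(1) by auto
qed

text \<open>Coefficients of a repeated vertex add up, so evaluating a form on such vectors requires
  no \<open>distinct\<close>.\<close>

definition lincomb :: "real list \<Rightarrow> 'a list \<Rightarrow> 'a \<Rightarrow> real" where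
  "lincomb cs vs v = (\<Sum>(c, u) \<leftarrow> zip cs vs. if v = u then c else 0)"

lemma sum_lincomb:
  fixes cs :: "real list"
  assumes "finite V" "set vs \<subseteq> V"
  shows "(\<Sum>v\<in>V. lincomb cs vs v * h v) = (\<Sum>(c, u) \<leftarrow> zip cs vs. c * h u)"
  using assms(2)
proof (induction cs vs rule: list_induct2')
  case (4 c cs u vs)
  then have "(\<Sum>v\<in>V. lincomb (c # cs) (u # vs) v * h v) =
      (\<Sum>v\<in>V. (if v = u then c * h v else 0) + lincomb cs vs v * h v)"
    by (intro sum.cong refl) (auto simp: lincomb_def algebra_simps)
  then show ?case using 4 assms(1) by (simp add: sum.distrib)
qed (simp_all add: lincomb_def)

lemma bform_lincomb:
  fixes cs ds :: "real list"
  assumes "finite V" "set us \<subseteq> V" "set vs \<subseteq> V"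
  shows "bform V M (lincomb cs us) (lincomb ds vs) =
    (\<Sum>(c, u) \<leftarrow> zip cs us. c * (\<Sum>(d, v) \<leftarrow> zip ds vs. d * M u v))"
proof -
  have "bform V M (lincomb cs us) (lincomb ds vs) =
      (\<Sum>u\<in>V. lincomb cs us u * (\<Sum>v\<in>V. lincomb ds vs v * M u v))"
    by (simp add: bform_def sum_distrib_left mult_ac)
  then show ?thesis using assms by (simp add: sum_lincomb)
qed

text \<open>The forward direction is termwise. For the converse, the vector whose only nonzero
  coordinate is the last one has N = 1 and Q equal to the last eigenvalue.\<close>

lemma eigenvalue_ge_iff:
  fixes e :: "nat \<Rightarrow> real"
  assumes n: "0 < n" and dec: "\<And>i j. i \<le> j \<Longrightarrow> j < n \<Longrightarrow> e j \<le> e i"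
    and Q: "\<And>x. Q x = (\<Sum>k<n. e k * (\<Sum>i<n. c k i * x i)\<^sup>2)"
    and N: "\<And>x. N x = (\<Sum>k<n. (\<Sum>i<n. c k i * x i)\<^sup>2)"
    and surj: "\<And>y. \<exists>x. \<forall>k<n. (\<Sum>i<n. c k i * x i) = y k"
  shows "t \<le> e (n - 1) \<longleftrightarrow> (\<forall>x. t * N x \<le> Q x)"
proof
  assume t: "t \<le> e (n - 1)"
  have "t \<le> e k" if "k < n" for k using t dec[of k "n - 1"] that n by force
  then show "\<forall>x. t * N x \<le> Q x"
    unfolding Q N sum_distrib_left by (auto intro!: sum_mono mult_right_mono)
next
  assume le: "\<forall>x. t * N x \<le> Q x"
  obtain x where x: "\<And>k. k < n \<Longrightarrow> (\<Sum>i<n. c k i * x i) = (if k = n - 1 then 1 else 0)"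
    using surj[of "\<lambda>k. if k = n - 1 then 1 else 0"] by blast
  have "N x = (\<Sum>k<n. if k = n - 1 then 1 else 0)" unfolding N by (intro sum.cong refl) (auto simp: x)
  moreover have "Q x = (\<Sum>k<n. if k = n - 1 then e k else 0)"
    unfolding Q by (intro sum.cong refl) (auto simp: x)
  ultimately show "t \<le> e (n - 1)" using le[rule_format, of x] n by simp
qed

text \<open>Courant-Fischer for the third eigenvalue. Forwards, the first two eigencoordinates serve
  as the linear forms. Backwards, Q >= e_2 N on the span of the first three eigenvectors, and that
  span contains a nonzero vector \<open>w\<close> on which both forms vanish. Since the forms are
  arbitrary, convenient ones can be chosen later without knowing any eigenvector.\<close>

lemma third_eigenvalue_le_iff:
  fixes e :: "nat \<Rightarrow> real"
  assumes n: "3 \<le> n" and dec: "\<And>i j. i \<le> j \<Longrightarrow> j < n \<Longrightarrow> e j \<le> e i"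
    and Q: "\<And>x. Q x = (\<Sum>k<n. e k * (\<Sum>i<n. c k i * x i)\<^sup>2)"
    and N: "\<And>x. N x = (\<Sum>k<n. (\<Sum>i<n. c k i * x i)\<^sup>2)"
    and surj: "\<And>y. \<exists>x. \<forall>k<n. (\<Sum>i<n. c k i * x i) = y k"
  shows "e 2 \<le> t \<longleftrightarrow> (\<exists>f g. \<forall>x. (\<Sum>i<n. f i * x i) = 0 \<longrightarrow> (\<Sum>i<n. g i * x i) = 0 \<longrightarrow> Q x \<le> t * N x)"
proof
  assume t: "e 2 \<le> t"
  have "Q x \<le> t * N x" if "(\<Sum>i<n. c 0 i * x i) = 0" "(\<Sum>i<n. c 1 i * x i) = 0" for x
  proof -
    have "e k * (\<Sum>i<n. c k i * x i)\<^sup>2 \<le> t * (\<Sum>i<n. c k i * x i)\<^sup>2" if "k < n" for k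
    proof (cases "k \<le> 1")
      case True
      then have "k = 0 \<or> k = 1" by auto
      then show ?thesis using \<open>(\<Sum>i<n. c 0 i * x i) = 0\<close> \<open>(\<Sum>i<n. c 1 i * x i) = 0\<close> by auto
    next
      case False
      then have "e k \<le> t" using dec[of 2 k] t that by simp
      then show ?thesis by (rule mult_right_mono) simp
    qed
    then show ?thesis unfolding Q N sum_distrib_left by (intro sum_mono) simp
  qed
  then show "\<exists>f g. \<forall>x. (\<Sum>i<n. f i * x i) = 0 \<longrightarrow> (\<Sum>i<n. g i * x i) = 0 \<longrightarrow> Q x \<le> t * N x"
    by blast
next
  assume "\<exists>f g. \<forall>x. (\<Sum>i<n. f i * x i) = 0 \<longrightarrow> (\<Sum>i<n. g i * x i) = 0 \<longrightarrow> Q x \<le> t * N x"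
  then obtain f g where fg: "\<And>x. (\<Sum>i<n. f i * x i) = 0 \<Longrightarrow> (\<Sum>i<n. g i * x i) = 0 \<Longrightarrow> Q x \<le> t * N x"
    by blast
  have "\<exists>x. \<forall>k<n. (\<Sum>i<n. c k i * x i) = (if k = l then 1 else 0)" for l
    using surj[of "\<lambda>k. if k = l then 1 else 0"] by simp
  then obtain v where v: "\<And>l k. k < n \<Longrightarrow> (\<Sum>i<n. c k i * v l i) = (if k = l then 1 else 0)"
    by metis
  let ?f = "\<lambda>l. \<Sum>i<n. f i * v l i" and ?g = "\<lambda>l. \<Sum>i<n. g i * v l i"
  obtain a b d where abd: "(a, b, d) \<noteq> (0, 0, 0)"
    "?f 0 * a + ?f 1 * b + ?f 2 * d = 0" "?g 0 * a + ?g 1 * b + ?g 2 * d = 0"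
    by (rule two_equations_three_unknowns)
  define w where "w i = a * v 0 i + b * v 1 i + d * v 2 i" for i
  have lin: "(\<Sum>i<n. h i * w i) =
      (\<Sum>i<n. h i * v 0 i) * a + (\<Sum>i<n. h i * v 1 i) * b + (\<Sum>i<n. h i * v 2 i) * d" for h
    unfolding w_def sum_distrib_right sum.distrib[symmetric]
    by (intro sum.cong refl) (simp add: algebra_simps)
  have "Q w \<le> t * N w" using fg[of w] abd by (simp add: lin)
  have cw: "(\<Sum>i<n. c k i * w i) = (if k = 0 then a else if k = 1 then b else if k = 2 then d else 0)"
    if "k < n" for k
    unfolding lin using that by (simp add: v)
  have sum3: "(\<Sum>k<n. h k) = h 0 + h 1 + h 2" if "\<And>k. k \<ge> 3 \<Longrightarrow> k < n \<Longrightarrow> h k = 0" for h :: "nat \<Rightarrow> real"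
  proof -
    have "(\<Sum>k<n. h k) = (\<Sum>k<3. h k)" using n that by (intro sum.mono_neutral_right) auto
    then show ?thesis by (simp add: numeral_3_eq_3 numeral_2_eq_2)
  qed
  have "N w = a\<^sup>2 + b\<^sup>2 + d\<^sup>2" unfolding N by (subst sum3) (use n in \<open>auto simp: cw\<close>)
  moreover have "Q w = e 0 * a\<^sup>2 + e 1 * b\<^sup>2 + e 2 * d\<^sup>2"
    unfolding Q by (subst sum3) (use n in \<open>auto simp: cw\<close>)
  moreover have "e 2 * a\<^sup>2 \<le> e 0 * a\<^sup>2" "e 2 * b\<^sup>2 \<le> e 1 * b\<^sup>2"
    using dec[of 0 2] dec[of 1 2] n by (auto intro!: mult_right_mono)
  ultimately have "e 2 * (a\<^sup>2 + b\<^sup>2 + d\<^sup>2) \<le> t * (a\<^sup>2 + b\<^sup>2 + d\<^sup>2)"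
    using \<open>Q w \<le> t * N w\<close> by (simp add: algebra_simps)
  moreover have "a\<^sup>2 + b\<^sup>2 + d\<^sup>2 > 0"
    using abd(1) by (auto simp: add_nonneg_pos add_pos_nonneg)
  ultimately show "e 2 \<le> t" by simp
qed

section \<open>Forbidden configurations in the complement\<close>

text \<open>\<open>E\<close> is adjacency in the complement. If the diameter is at most 2, then \<open>1 + E\<close> is the entry of
  \<open>D + I\<close>, so the last two assumptions say \<open>\<partial>\<^sub>n \<ge> -3\<close> and \<open>\<partial>\<^sub>3 \<le> -1\<close>.\<close>

locale co_graph =
  fixes V :: "'a set" and E :: "'a \<Rightarrow> 'a \<Rightarrow> bool"
  assumes fin: "finite V"
    and E_sym: "E u v \<Longrightarrow> E v u"
    and E_irrefl: "\<not> E v v"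
    and diam2: "\<lbrakk>u \<in> V; v \<in> V; E u v\<rbrakk> \<Longrightarrow> \<exists>w\<in>V. w \<noteq> u \<and> w \<noteq> v \<and> \<not> E u w \<and> \<not> E v w"
    and nonneg: "0 \<le> bform V (\<lambda>u v. 1 + of_bool (E u v) + 2 * of_bool (u = v)) x x"
    and two_pos: "\<exists>f g. \<forall>x. (\<Sum>v\<in>V. f v * x v) = 0 \<longrightarrow> (\<Sum>v\<in>V. g v * x v) = 0 \<longrightarrow>
      bform V (\<lambda>u v. 1 + of_bool (E u v)) x x \<le> 0"
begin

lemma E_commute: "E u v \<longleftrightarrow> E v u"
  using E_sym by blast

lemma nonneg_lincomb:
  fixes cs :: "real list"
  assumes "set vs \<subseteq> V"
  shows "0 \<le> (\<Sum>(c, u) \<leftarrow> zip cs vs. c * (\<Sum>(d, v) \<leftarrow> zip cs vs.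
    d * (1 + of_bool (E u v) + 2 * of_bool (u = v))))"
  using nonneg[of "lincomb cs vs"] bform_lincomb[OF fin assms assms] by simp

text \<open>The form J + E does not mention equality of vertices, so the configurations excluded by
  it need no distinctness assumption, unlike those excluded by
  \<open>nonneg_lincomb\<close>.\<close>

lemma three_lincombs:
  fixes cs ds es :: "real list"
  assumes vs: "set vs \<subseteq> V"
  defines "b \<equiv> \<lambda>cs ds. \<Sum>(c, u) \<leftarrow> zip cs vs. c * (\<Sum>(d, v) \<leftarrow> zip ds vs. d * (1 + of_bool (E u v)))"
  shows "\<not> (b cs cs > 0 \<and> b ds ds > 0 \<and> b es es > 0 \<and> b cs ds = 0 \<and> b cs es = 0 \<and> b ds es = 0)"
proof
  let ?M = "\<lambda>u v. 1 + of_bool (E u v)"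
  have b: "b cs ds = bform V ?M (lincomb cs vs) (lincomb ds vs)" for cs ds
    unfolding b_def by (rule bform_lincomb[OF fin vs vs, symmetric])
  obtain f g where fg: "\<And>x. (\<Sum>v\<in>V. f v * x v) = 0 \<Longrightarrow> (\<Sum>v\<in>V. g v * x v) = 0 \<Longrightarrow>
      bform V ?M x x \<le> 0" using two_pos by blast
  assume "b cs cs > 0 \<and> b ds ds > 0 \<and> b es es > 0 \<and> b cs ds = 0 \<and> b cs es = 0 \<and> b ds es = 0"
  then show False unfolding b
    by (intro no_three_orthogonal_positive[of ?M f V g "lincomb cs vs" "lincomb ds vs" "lincomb es vs"] fg)
      (simp_all add: E_commute)
qed

text \<open>The three coefficient lists are orthogonal with respect to \<open>J + E\<close>, with positive values: they come
  from a diagonalisation of that form on the configuration by completing squares.\<close>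

lemma no_C5:
  assumes "{a, b, c, d, e} \<subseteq> V" "E a b" "E b c" "E c d" "E d e" "E e a"
    "\<not> E a c" "\<not> E a d" "\<not> E b d" "\<not> E b e" "\<not> E c e"
  shows False
  using three_lincombs[of "[a, b, c, d, e]" "[0, 0, 0, 0, 1]" "[-1, 0, 3, 0, -1]" "[-4, -4, 3, 3, 3]"]
    assms by (simp add: E_irrefl E_commute)

lemma no_P5:
  assumes "{a, b, c, d, e} \<subseteq> V" "E a b" "E b c" "E c d" "E d e"
    "\<not> E a c" "\<not> E a d" "\<not> E a e" "\<not> E b d" "\<not> E b e" "\<not> E c e"
  shows False
  using three_lincombs[of "[a, b, c, d, e]" "[0, 0, 1, 0, 0]" "[0, -1, -1, 0, 3]" "[3, 0, -4, -1, 3]"]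
    assms by (simp add: E_irrefl E_commute)

lemma no_P4_K1:
  assumes "{a, b, c, d, e} \<subseteq> V" "E a b" "E b c" "E c d"
    "\<not> E a c" "\<not> E a d" "\<not> E b d" "\<not> E a e" "\<not> E b e" "\<not> E c e" "\<not> E d e"
  shows False
  using three_lincombs[of "[a, b, c, d, e]" "[0, 0, 0, 0, 1]" "[0, 0, 1, 1, -2]" "[1, 1, 0, -1, -1]"]
    assms by (simp add: E_irrefl E_commute)

lemma no_2K2_K1:
  assumes "{a, b, c, d, e} \<subseteq> V" "E a b" "E c d"
    "\<not> E a c" "\<not> E a d" "\<not> E b c" "\<not> E b d" "\<not> E a e" "\<not> E b e" "\<not> E c e" "\<not> E d e"
  shows False
  using three_lincombs[of "[a, b, c, d, e]" "[0, 0, 0, 0, 1]" "[1, 1, 0, 0, -2]" "[0, 0, 1, 1, -2]"]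
    assms by (simp add: E_irrefl E_commute)

lemma no_paw_K1:
  assumes "{a, w, b, c, u} \<subseteq> V" "E a w" "E w b" "E w c" "E b c"
    "\<not> E a b" "\<not> E a c" "\<not> E a u" "\<not> E w u" "\<not> E b u" "\<not> E c u"
  shows False
  using three_lincombs[of "[a, w, b, c, u]" "[0, 0, 0, 0, 1]" "[1, 1, 0, 0, -2]" "[-2, 0, 1, 1, 0]"]
    assms by (simp add: E_irrefl E_commute)

text \<open>The test vector has sum 0, so J drops out; E contributes -30 and 2I only 28.\<close>

lemma no_join_2K1_K1_K2:
  assumes "{a, w, b, c, u} \<subseteq> V" "distinct [a, w, b, c, u]" "E a w" "E w b" "E w c" "E b c"
    "E a u" "E b u" "E c u" "\<not> E a b" "\<not> E a c" "\<not> E w u"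
  shows False
proof -
  \<comment> \<open>The reversed list provides each inequation in its other orientation, so that
    every \<open>u = v\<close> in the form is evaluated.\<close>
  have "distinct [u, c, b, w, a]" using assms(2) by auto
  then show ?thesis using nonneg_lincomb[of "[a, w, b, c, u]" "[-2, 2, -1, -1, 2]"]
    assms by (simp add: E_irrefl E_commute)
qed

text \<open>The fifth vertex \<open>w\<close> is not E-adjacent to the middle vertices b and c. Its
  relation to the ends a and d produces C5, one of two P5, or P4 u K1.\<close>

lemma P4_free:
  assumes V: "{a, b, c, d} \<subseteq> V" and "E a b" "E b c" "E c d" "\<not> E a c" "\<not> E a d" "\<not> E b d"
  shows False
proof -
  obtain w where w: "w \<in> V" "\<not> E b w" "\<not> E c w"
    using diam2[of b c] V \<open>E b c\<close> by auto
  consider "E a w" "E d w" | "E a w" "\<not> E d w" | "\<not> E a w" "E d w" | "\<not> E a w" "\<not> E d w" by blast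
  then show False
  proof cases
    case 1 then show ?thesis using no_C5[of a b c d w] assms w by (auto simp: E_commute)
  next
    case 2 then show ?thesis using no_P5[of w a b c d] assms w by (auto simp: E_commute)
  next
    case 3 then show ?thesis using no_P5[of w d c b a] assms w by (auto simp: E_commute)
  next
    case 4 then show ?thesis using no_P4_K1[of a b c d w] assms w by (auto simp: E_commute)
  qed
qed

text \<open>Here a hangs at w on the triangle w b c, and u is not E-adjacent to w. As there is no
  induced P4, the vertices a, b, c all behave alike towards u, and both outcomes are excluded
  configurations on five vertices.\<close>

lemma paw_free:
  assumes V: "{a, w, b, c} \<subseteq> V" and E: "E a w" "E w b" "E w c" "E b c" "\<not> E a b" "\<not> E a c"
  shows False
proof -
  obtain u where u: "u \<in> V" "u \<noteq> w" "\<not> E w u"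
    using diam2[of a w] V E(1) by auto
  have "E a u \<longleftrightarrow> E b u"
    using P4_free[of a w b u] P4_free[of u a w b] V E u by (auto simp: E_commute)
  moreover have "E a u \<longleftrightarrow> E c u"
    using P4_free[of a w c u] P4_free[of u a w c] V E u by (auto simp: E_commute)
  ultimately consider "E a u" "E b u" "E c u" | "\<not> E a u" "\<not> E b u" "\<not> E c u" by blast
  then show False
  proof cases
    case 1
    have "distinct [a, w, b, c, u]" using E u 1 E_irrefl by (auto simp: E_commute)
    then show ?thesis using no_join_2K1_K1_K2[of a w b c u] V E u 1 by simp
  next
    case 2
    then show ?thesis using no_paw_K1[of a w b c u] V E u by simp
  qed
qed

text \<open>Being in the same component of the complement. Walks with at most two edges suffice,
  because a walk x p y z that cannot be shortened would be an induced P4.\<close>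

definition sim :: "'a \<Rightarrow> 'a \<Rightarrow> bool" where
  "sim x y \<longleftrightarrow> x = y \<or> E x y \<or> (\<exists>z\<in>V. E x z \<and> E z y)"

lemma sim_step:
  assumes "sim x y" "E y z" "x \<in> V" "y \<in> V" "z \<in> V"
  shows "sim x z"
proof -
  have "sim x z" if p: "p \<in> V" "E x p" "E p y" for p
    using P4_free[of x p y z] assms p unfolding sim_def by blast
  then show ?thesis using assms unfolding sim_def by blast
qed

lemma sim_trans:
  assumes "sim x y" "sim y z" "x \<in> V" "y \<in> V" "z \<in> V"
  shows "sim x z"
proof -
  consider "y = z" | "E y z" | p where "p \<in> V" "E y p" "E p z"
    using assms(2) unfolding sim_def by auto
  then show ?thesis
  proof cases
    case 3
    then show ?thesis using sim_step[of x p z] sim_step[of x y p] assms by simp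
  qed (use assms sim_step[of x y z] in auto)
qed

lemma sim_sym: "sim x y \<Longrightarrow> sim y x"
  unfolding sim_def using E_sym by blast

text \<open>This makes every component of the complement complete multipartite. Non-adjacent a and b
  in one component have a common E-neighbour w; if c were adjacent to b but not to a, then a, w, b,
  c would induce a paw or a P4, according to whether w and c are adjacent.\<close>

lemma nonadj_trans_component:
  assumes "sim b a" "{a, b, c} \<subseteq> V" "\<not> E b a" "\<not> E a c"
  shows "\<not> E b c"
proof
  assume bc: "E b c"
  then have "a \<noteq> b" using assms by auto
  then obtain w where w: "w \<in> V" "E b w" "E w a" using assms unfolding sim_def by auto
  show False
    using paw_free[of a w b c] P4_free[of a w b c] assms w bc by (cases "E w c") (auto simp: E_commute)
qed

text \<open>A non-complete graph of this kind is the join of two disjoint unions of cliques: one part is a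
  nontrivial component of the complement, the other one is the rest.\<close>

lemma two_parts:
  assumes "x0 \<in> V" "y0 \<in> V" "E x0 y0"
  obtains X Y where "V = X \<union> Y" "X \<inter> Y = {}" "X \<noteq> {}" "Y \<noteq> {}" "\<forall>x\<in>X. \<forall>y\<in>Y. \<not> E x y"
    "\<forall>a\<in>X. \<forall>b\<in>X. \<forall>c\<in>X. \<not> E a b \<longrightarrow> \<not> E b c \<longrightarrow> \<not> E a c"
    "\<forall>a\<in>Y. \<forall>b\<in>Y. \<forall>c\<in>Y. \<not> E a b \<longrightarrow> \<not> E b c \<longrightarrow> \<not> E a c"
proof -
  define X where "X = {v \<in> V. sim x0 v}"
  have X: "X \<subseteq> V" "x0 \<in> X" "y0 \<in> X" using assms by (auto simp: X_def sim_def)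
  have cross: "\<not> E x y" if "x \<in> X" "y \<in> V - X" for x y
    using sim_step[of x0 x y] that assms by (auto simp: X_def)
  have simX: "sim a b" if "a \<in> X" "b \<in> X" for a b
    using that sim_trans[of a x0 b] sim_sym assms by (auto simp: X_def)
  have tX: "\<not> E a c" if "{a, b, c} \<subseteq> X" "\<not> E a b" "\<not> E b c" for a b c
    using nonadj_trans_component[of a b c] that simX X by auto
  have tY: "\<not> E a c" if abc: "{a, b, c} \<subseteq> V - X" "\<not> E a b" "\<not> E b c" for a b c
  proof (cases "sim a b")
    case True
    then show ?thesis using nonadj_trans_component[of a b c] abc by auto
  next
    case False
    \<comment> \<open>An edge a c, the edge x0 y0 in the other component and the vertex b would
      induce 2K_2 u K_1.\<close>
    show ?thesis
    proof
      assume "E a c"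
      moreover have "\<not> E x v" if "x \<in> {x0, y0}" "v \<in> {a, b, c}" for x v
        using that cross X abc(1) by auto
      moreover have "\<not> E c b" using abc E_sym by blast
      ultimately show False using no_2K2_K1[of x0 y0 a c b] abc assms by auto
    qed
  qed
  \<comment> \<open>If the complement were connected, the vertex \<open>w\<close> of
    \<open>diam2\<close> would be E-adjacent to neither x0 nor y0 within one complete multipartite
    graph, and transitivity would contradict \<open>E x0 y0\<close>.\<close>
  have "V - X \<noteq> {}"
  proof
    assume "V - X = {}"
    then have "V = X" using X by auto
    obtain w where w: "w \<in> V" "\<not> E x0 w" "\<not> E w y0"
      using diam2[OF assms] E_sym by blast
    then show False using tX[of x0 w y0] X(2,3) assms(3) \<open>V = X\<close> by simp
  qed
  moreover have "V = X \<union> (V - X)" "X \<inter> (V - X) = {}" "X \<noteq> {}" using X by auto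
  moreover have "\<forall>x\<in>X. \<forall>y\<in>V - X. \<not> E x y" using cross by (intro ballI)
  moreover have "\<forall>a\<in>X. \<forall>b\<in>X. \<forall>c\<in>X. \<not> E a b \<longrightarrow> \<not> E b c \<longrightarrow> \<not> E a c"
    by (intro ballI impI, rule tX) auto
  moreover have "\<forall>a\<in>V - X. \<forall>b\<in>V - X. \<forall>c\<in>V - X. \<not> E a b \<longrightarrow> \<not> E b c \<longrightarrow> \<not> E a c"
    by (intro ballI impI, rule tY) auto
  ultimately show ?thesis by (intro that[of X "V - X"])
qed

text \<open>The value is 1 - 12 + 10 = -1, the three terms coming from J, E and 2I. Consequently,
  next to a clique with three vertices, the other cliques of a part are single vertices.\<close>

lemma no_K23:
  assumes "{a1, a2, b1, b2, b3} \<subseteq> V" "distinct [a1, a2, b1, b2, b3]"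
    "\<And>a b. a \<in> {a1, a2} \<Longrightarrow> b \<in> {b1, b2, b3} \<Longrightarrow> E a b"
    "\<not> E a1 a2" "\<not> E b1 b2" "\<not> E b1 b3" "\<not> E b2 b3"
  shows False
proof -
  have "E a1 b1" "E a1 b2" "E a1 b3" "E a2 b1" "E a2 b2" "E a2 b3" using assms(3) by auto
  moreover have "distinct [b3, b2, b1, a2, a1]" using assms(2) by auto
  ultimately show ?thesis
    using nonneg_lincomb[of "[a1, a2, b1, b2, b3]" "[-1, -1, 1, 1, 1]"] assms(1,2,4-)
    by (simp add: E_irrefl E_commute)
qed

text \<open>\<open>D + 3I\<close> evaluated at the vector with the constant values \<open>a\<close>, \<open>b\<close>, \<open>c\<close> on \<open>A\<close>, \<open>C\<close>, \<open>Y\<close>.\<close>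

lemma clique_independent_bound:
  fixes a b c :: real
  assumes V: "A \<subseteq> V" "C \<subseteq> V" "Y \<subseteq> V" and disj: "A \<inter> C = {}" "A \<inter> Y = {}" "C \<inter> Y = {}"
    and AA: "\<And>u v. u \<in> A \<Longrightarrow> v \<in> A \<Longrightarrow> u \<noteq> v \<Longrightarrow> E u v"
    and AC: "\<And>u v. u \<in> A \<Longrightarrow> v \<in> C \<Longrightarrow> E u v"
    and CC: "\<And>u v. u \<in> C \<Longrightarrow> v \<in> C \<Longrightarrow> \<not> E u v"
    and Y: "\<And>u v. u \<in> Y \<Longrightarrow> v \<in> A \<union> C \<union> Y \<Longrightarrow> \<not> E u v"
  defines "j \<equiv> real (card A)" and "k \<equiv> real (card C)" and "l \<equiv> real (card Y)"
  shows "0 \<le> j * a * ((2 * j + 1) * a + 2 * k * b + l * c) + k * b * (2 * j * a + (k + 2) * b + l * c)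
    + l * c * (j * a + k * b + (l + 2) * c)"
proof -
  define x where "x v = (if v \<in> A then a else if v \<in> C then b else if v \<in> Y then c else 0)" for v
  have finp: "finite A" "finite C" "finite Y" using V fin finite_subset by blast+
  have wsum: "(\<Sum>v\<in>V. x v * h v) = a * (\<Sum>v\<in>A. h v) + b * (\<Sum>v\<in>C. h v) + c * (\<Sum>v\<in>Y. h v)" for h
  proof -
    have "(\<Sum>v\<in>V. x v * h v) = (\<Sum>v\<in>A \<union> C \<union> Y. x v * h v)"
      using V fin by (intro sum.mono_neutral_right) (auto simp: x_def)
    also have "\<dots> = (\<Sum>v\<in>A. x v * h v) + (\<Sum>v\<in>C. x v * h v) + (\<Sum>v\<in>Y. x v * h v)"
      using finp disj by (simp add: sum.union_disjoint Int_Un_distrib2)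
    also have "(\<Sum>v\<in>A. x v * h v) = a * (\<Sum>v\<in>A. h v)"
      unfolding sum_distrib_left by (intro sum.cong refl) (simp add: x_def)
    also have "(\<Sum>v\<in>C. x v * h v) = b * (\<Sum>v\<in>C. h v)"
      unfolding sum_distrib_left using disj by (intro sum.cong refl) (auto simp: x_def)
    also have "(\<Sum>v\<in>Y. x v * h v) = c * (\<Sum>v\<in>Y. h v)"
      unfolding sum_distrib_left using disj by (intro sum.cong refl) (auto simp: x_def)
    finally show ?thesis .
  qed
  let ?M = "\<lambda>u v. 1 + of_bool (E u v) + 2 * of_bool (u = v) :: real"
  have E': "E v u" if "u \<in> A" "v \<in> C" for u v using AC that E_sym by blast
  have Y': "\<not> E v u" if "u \<in> Y" "v \<in> A \<union> C" for u v using Y[of u v] that E_sym by blast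
  \<comment> \<open>The three sets are equitable: the sum over \<open>v\<close> depends only on the
    set containing \<open>u\<close>. \<open>gA\<close>, \<open>gC\<close> and \<open>gY\<close>
    compute the rows of the quotient matrix of D + 3I, applied to (a, b, c).\<close>
  have gA: "a * (\<Sum>v\<in>A. ?M u v) + b * (\<Sum>v\<in>C. ?M u v) + c * (\<Sum>v\<in>Y. ?M u v) =
      (2 * j + 1) * a + 2 * k * b + l * c" if u: "u \<in> A" for u
  proof -
    have "(\<Sum>v\<in>A. ?M u v) = (\<Sum>v\<in>A. 2 + of_bool (v = u))"
      using u AA E_irrefl by (intro sum.cong refl) (auto simp: of_bool_def)
    also have "\<dots> = 2 * j + 1"
      using finp u by (simp add: sum.distrib of_bool_def j_def)
    finally have "(\<Sum>v\<in>A. ?M u v) = 2 * j + 1" .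
    moreover have "(\<Sum>v\<in>C. ?M u v) = (\<Sum>v\<in>C. 2)"
      using u AC disj by (intro sum.cong refl) auto
    moreover have "(\<Sum>v\<in>Y. ?M u v) = (\<Sum>v\<in>Y. 1)"
      using u Y' disj by (intro sum.cong refl) auto
    ultimately show ?thesis by (simp add: k_def l_def algebra_simps)
  qed
  have gC: "a * (\<Sum>v\<in>A. ?M u v) + b * (\<Sum>v\<in>C. ?M u v) + c * (\<Sum>v\<in>Y. ?M u v) =
      2 * j * a + (k + 2) * b + l * c" if u: "u \<in> C" for u
  proof -
    have "(\<Sum>v\<in>C. ?M u v) = (\<Sum>v\<in>C. 1 + 2 * of_bool (v = u))"
      using u CC by (intro sum.cong refl) (auto simp: of_bool_def)
    also have "\<dots> = k + 2"
      using finp u by (simp add: sum.distrib sum_distrib_left[symmetric] of_bool_def k_def)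
    finally have "(\<Sum>v\<in>C. ?M u v) = k + 2" .
    moreover have "(\<Sum>v\<in>A. ?M u v) = (\<Sum>v\<in>A. 2)"
      using u E' disj by (intro sum.cong refl) auto
    moreover have "(\<Sum>v\<in>Y. ?M u v) = (\<Sum>v\<in>Y. 1)"
      using u Y' disj by (intro sum.cong refl) auto
    ultimately show ?thesis by (simp add: j_def l_def algebra_simps)
  qed
  have gY: "a * (\<Sum>v\<in>A. ?M u v) + b * (\<Sum>v\<in>C. ?M u v) + c * (\<Sum>v\<in>Y. ?M u v) =
      j * a + k * b + (l + 2) * c" if u: "u \<in> Y" for u
  proof -
    have "(\<Sum>v\<in>Y. ?M u v) = (\<Sum>v\<in>Y. 1 + 2 * of_bool (v = u))"
      using u Y by (intro sum.cong refl) (auto simp: of_bool_def)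
    also have "\<dots> = l + 2"
      using finp u by (simp add: sum.distrib sum_distrib_left[symmetric] of_bool_def l_def)
    finally have "(\<Sum>v\<in>Y. ?M u v) = l + 2" .
    moreover have "(\<Sum>v\<in>A. ?M u v) = (\<Sum>v\<in>A. 1)"
      using u Y disj by (intro sum.cong refl) auto
    moreover have "(\<Sum>v\<in>C. ?M u v) = (\<Sum>v\<in>C. 1)"
      using u Y disj by (intro sum.cong refl) auto
    ultimately show ?thesis by (simp add: j_def k_def algebra_simps)
  qed
  have "bform V ?M x x = (\<Sum>u\<in>V. x u * (\<Sum>v\<in>V. x v * ?M u v))"
    unfolding bform_def sum_distrib_left by (simp add: mult.assoc)
  also have "\<dots> = j * a * ((2 * j + 1) * a + 2 * k * b + l * c) + k * b * (2 * j * a + (k + 2) * b + l * c)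
      + l * c * (j * a + k * b + (l + 2) * c)"
    unfolding wsum by (simp add: gA gC gY j_def[symmetric] k_def[symmetric] l_def[symmetric])
  finally show ?thesis using nonneg[of x] by simp
qed

text \<open>The weights make the row of \<open>A\<close> vanish, 7 * (-6) + 6 * 7 = 0, and the row
  of \<open>C\<close> leaves 21 * (-1).\<close>

lemma no_K1113:
  assumes "A \<subseteq> V" "C \<subseteq> V" "A \<inter> C = {}" "card A = 3" "card C = 3"
    "\<And>u v. u \<in> A \<Longrightarrow> v \<in> A \<Longrightarrow> u \<noteq> v \<Longrightarrow> E u v" "\<And>u v. u \<in> A \<Longrightarrow> v \<in> C \<Longrightarrow> E u v"
    "\<And>u v. u \<in> C \<Longrightarrow> v \<in> C \<Longrightarrow> \<not> E u v"
  shows False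
  using clique_independent_bound[of A C "{}" "- 6" 7 0] assms by simp

text \<open>Here the row of \<open>C\<close> vanishes, 4 * (-3) + 6 * 2 = 0, and the row of
  \<open>A\<close> leaves -6.\<close>

lemma no_K114:
  assumes "A \<subseteq> V" "C \<subseteq> V" "A \<inter> C = {}" "card A = 2" "card C = 4"
    "\<And>u v. u \<in> A \<Longrightarrow> v \<in> A \<Longrightarrow> u \<noteq> v \<Longrightarrow> E u v" "\<And>u v. u \<in> A \<Longrightarrow> v \<in> C \<Longrightarrow> E u v"
    "\<And>u v. u \<in> C \<Longrightarrow> v \<in> C \<Longrightarrow> \<not> E u v"
  shows False
  using clique_independent_bound[of A C "{}" "- 3" 2 0] assms by simp

text \<open>K_{1,6} alone gives 3 (a + 4 b)^2, which is not negative but vanishes for a = -4 b. The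
  opposite vertex \<open>y\<close> adds 2 c (a + 6 b) + 3 c^2; for a = -12 and b = 3 this is
  smallest at c = -2, with value -12.\<close>

lemma no_K16_K1:
  assumes "z \<in> V" "C \<subseteq> V" "y \<in> V" "z \<notin> C" "y \<notin> C" "y \<noteq> z" "card C = 6"
    "\<And>v. v \<in> C \<Longrightarrow> E z v" "\<And>u v. u \<in> C \<Longrightarrow> v \<in> C \<Longrightarrow> \<not> E u v"
    "\<not> E y z" "\<And>v. v \<in> C \<Longrightarrow> \<not> E y v"
  shows False
proof -
  have "\<not> E u v" if "u \<in> {y}" "v \<in> {z} \<union> C \<union> {y}" for u v using that assms E_irrefl by auto
  moreover have "E u v" if "u \<in> {z}" "v \<in> C" for u v using that assms by auto
  ultimately show ?thesis
    using clique_independent_bound[of "{z}" C "{y}" "- 12" 3 "- 2"] assms(1-7,9) by simp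
qed

text \<open>The rows contribute -12 + 20 - 9 = -1. Three opposite vertices are the threshold: with l
  of them, the minimum over c is 3 a^2 + 20 a b + 35 b^2 - l / (l + 2) (a + 5 b)^2, which is still a
  nonnegative square for l = 2.\<close>

lemma no_K15_3K1:
  assumes "z \<in> V" "C \<subseteq> V" "Y \<subseteq> V" "z \<notin> C" "Y \<inter> C = {}" "z \<notin> Y" "card C = 5" "card Y = 3"
    "\<And>v. v \<in> C \<Longrightarrow> E z v" "\<And>u v. u \<in> C \<Longrightarrow> v \<in> C \<Longrightarrow> \<not> E u v"
    "\<And>u v. u \<in> Y \<Longrightarrow> v \<in> insert z (C \<union> Y) \<Longrightarrow> \<not> E u v"
  shows False
proof -
  have "\<not> E u v" if "u \<in> Y" "v \<in> {z} \<union> C \<union> Y" for u v using that assms by auto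
  moreover have "E u v" if "u \<in> {z}" "v \<in> C" for u v using that assms by auto
  moreover have "C \<inter> Y = {}" using assms by auto
  ultimately show ?thesis
    using clique_independent_bound[of "{z}" C Y "- 12" 4 "- 1"] assms(1-8,10) by simp
qed

text \<open>The classes of \<open>\<not> E\<close> on a part are the cliques of the graph induced on that part.\<close>

definition split_part :: "'a set \<Rightarrow> 'a set \<Rightarrow> bool" where
  "split_part A C \<longleftrightarrow> A \<inter> C = {} \<and> (\<forall>u\<in>A. \<forall>v\<in>A. u \<noteq> v \<longrightarrow> E u v) \<and> (\<forall>u\<in>C. \<forall>v\<in>C. \<not> E u v)
    \<and> (\<forall>u\<in>A. \<forall>v\<in>C. E u v)"

text \<open>If some clique of the part has three vertices a, b, c, let \<open>C\<close> be the
  clique containing a. Two adjacent vertices outside \<open>C\<close> would form a K_{2,3} of the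
  complement with a, b, c, so \<open>A\<close> = X - C is independent. The sizes are then limited by
  K_{1,1,1,3}, K_{1,1,4} and K_{1,6} u K_1, where \<open>y\<close> from the opposite part is the
  isolated vertex of the last one.\<close>

lemma part_cases:
  assumes X: "X \<subseteq> V" and trans: "\<forall>a\<in>X. \<forall>b\<in>X. \<forall>c\<in>X. \<not> E a b \<longrightarrow> \<not> E b c \<longrightarrow> \<not> E a c"
    and y: "y \<in> V" "y \<notin> X" "\<forall>x\<in>X. \<not> E y x"
  obtains (clique) "\<forall>u\<in>X. \<forall>v\<in>X. \<not> E u v"
  | (small) "\<forall>a\<in>X. \<forall>b\<in>X. \<forall>c\<in>X. \<not> E a b \<longrightarrow> \<not> E b c \<longrightarrow> a = b \<or> b = c \<or> a = c"
  | (split) A C where "X = A \<union> C" "split_part A C"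
      "(card A, card C) \<in> {(2, 3), (1, 3), (1, 4), (1, 5)}"
proof (cases "\<forall>a\<in>X. \<forall>b\<in>X. \<forall>c\<in>X. \<not> E a b \<longrightarrow> \<not> E b c \<longrightarrow> a = b \<or> b = c \<or> a = c")
  case True
  then show thesis by (rule small)
next
  case False
  then obtain a b c where abc: "{a, b, c} \<subseteq> X" "\<not> E a b" "\<not> E b c" "a \<noteq> b" "b \<noteq> c" "a \<noteq> c"
    by blast
  have t: "\<not> E a c" if "{a, b, c} \<subseteq> X" "\<not> E a b" "\<not> E b c" for a b c
  proof -
    have "a \<in> X" "b \<in> X" "c \<in> X" using that by auto
    then show ?thesis using trans that(2,3) by blast
  qed
  define C where "C = {v \<in> X. \<not> E a v}"
  define A where "A = X - C"
  have XAC: "X = A \<union> C" "A \<inter> C = {}" by (auto simp: A_def C_def)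
  have finX: "finite X" using X fin finite_subset by blast
  then have finA: "finite A" and finC: "finite C" using XAC by auto
  have AV: "A \<subseteq> V" and CV: "C \<subseteq> V" using XAC X by auto
  have CC: "\<not> E u v" if "u \<in> C" "v \<in> C" for u v
    using t[of u a v] E_commute[of u a] that abc(1) by (simp add: C_def)
  have AC: "E u v" if "u \<in> A" "v \<in> C" for u v
  proof (rule ccontr)
    assume "\<not> E u v"
    then show False using t[of a v u] E_commute[of v u] that abc(1) by (simp add: A_def C_def)
  qed
  have abcC: "{a, b, c} \<subseteq> C" using abc t[of a b c] E_irrefl[of a] by (simp add: C_def)
  have AA: "E u v" if uv: "u \<in> A" "v \<in> A" "u \<noteq> v" for u v
  proof (rule ccontr)
    assume n: "\<not> E u v"
    have "distinct [u, v, a, b, c]" using uv abc abcC XAC by auto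
    moreover have "{u, v, a, b, c} \<subseteq> V" using uv AV abcC CV by auto
    moreover have "\<not> E a b" "\<not> E a c" "\<not> E b c" using abcC CC by auto
    moreover have "E p q" if "p \<in> {u, v}" "q \<in> {a, b, c}" for p q using that uv abcC AC by auto
    ultimately show False using n by (intro no_K23[of u v a b c])
  qed
  have cardC: "card C \<ge> 3" using card_mono[OF finC abcC] abc by simp
  have split_AC: "split_part A C" unfolding split_part_def using XAC(2) AA CC AC by blast
  show thesis
  proof (cases "A = {}")
    case True
    then have "X = C" using XAC(1) by simp
    then show thesis using CC by (intro clique) simp
  next
    case False
    then have "card A \<ge> 1" using finA by (simp add: Suc_leI card_gt_0_iff)
    moreover have "\<not> card A \<ge> 3"
    proof
      assume "card A \<ge> 3"
      then obtain A' where A': "A' \<subseteq> A" "card A' = 3" by (rule obtain_subset_with_card_n)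
      obtain C' where C': "C' \<subseteq> C" "card C' = 3" using cardC by (rule obtain_subset_with_card_n)
      have "A' \<subseteq> V" "C' \<subseteq> V" "A' \<inter> C' = {}" using A' C' AV CV XAC(2) by auto
      moreover have "E u v" if "u \<in> A'" "v \<in> A'" "u \<noteq> v" for u v using that AA A'(1) by auto
      moreover have "E u v" if "u \<in> A'" "v \<in> C'" for u v using that AC A'(1) C'(1) by auto
      moreover have "\<not> E u v" if "u \<in> C'" "v \<in> C'" for u v using that CC C'(1) by auto
      ultimately show False using A'(2) C'(2) by (intro no_K1113[of A' C'])
    qed
    ultimately consider "card A = 1" | "card A = 2" by linarith
    then have "(card A, card C) \<in> {(2, 3), (1, 3), (1, 4), (1, 5)}"
    proof cases
      case 1
      then obtain z where z: "A = {z}" by (rule card_1_singletonE)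
      have "\<not> card C \<ge> 6"
      proof
        assume "card C \<ge> 6"
        then obtain C' where C': "C' \<subseteq> C" "card C' = 6" by (rule obtain_subset_with_card_n)
        have "C' \<subseteq> V" "z \<in> V" "z \<notin> C'" "y \<notin> C'" "y \<noteq> z" "\<not> E y z"
          using C' AV CV XAC y z by auto
        moreover have "E z v" "\<not> E y v" if "v \<in> C'" for v using that C' AC z y(3) XAC(1) by auto
        moreover have "\<not> E u v" if "u \<in> C'" "v \<in> C'" for u v using that C' CC by auto
        ultimately show False using y(1) C'(2) by (intro no_K16_K1[of z C' y])
      qed
      then have "card C = 3 \<or> card C = 4 \<or> card C = 5" using cardC by linarith
      then show ?thesis using 1 by auto
    next
      case 2
      have "\<not> card C \<ge> 4"
      proof
        assume "card C \<ge> 4"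
        then obtain C' where C': "C' \<subseteq> C" "card C' = 4" by (rule obtain_subset_with_card_n)
        have "C' \<subseteq> V" "A \<inter> C' = {}" using C' CV XAC(2) by auto
        moreover have "E u v" if "u \<in> A" "v \<in> C'" for u v using that AC C'(1) by auto
        moreover have "\<not> E u v" if "u \<in> C'" "v \<in> C'" for u v using that CC C'(1) by auto
        ultimately show False by (intro no_K114[OF AV _ _ 2 C'(2) AA])
      qed
      then have "card C = 3" using cardC by linarith
      then show ?thesis using 2 by auto
    qed
    then show thesis by (rule split[OF XAC(1) split_AC])
  qed
qed

end

section \<open>Distances and distance eigenvalues\<close>

context pair_graph begin

lemma pair_apath_rev: "apath u p v \<Longrightarrow> apath v (rev_path p) u"
  by (simp add: apath_rev_path)

lemma length_rev_path: "length (rev_path p) = length p"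
  by (induction p) auto

lemma gdist_commute: "gdist G u v = gdist G v u"
proof -
  have "(\<exists>p. apath u p v \<and> length p = k) \<longleftrightarrow> (\<exists>p. apath v p u \<and> length p = k)" for k
    using pair_apath_rev length_rev_path by metis
  then show ?thesis unfolding gdist_def by simp
qed

lemma vertex_enum: "distinct (vertex_enum G)" "set (vertex_enum G) = pverts G"
    "length (vertex_enum G) = card (pverts G)"
proof -
  have "distinct (vertex_enum G) \<and> set (vertex_enum G) = pverts G"
    unfolding vertex_enum_def using finite_distinct_list[OF pair_finite_verts] by (metis (mono_tags, lifting) someI_ex)
  then show "distinct (vertex_enum G)" "set (vertex_enum G) = pverts G"
    "length (vertex_enum G) = card (pverts G)" by (auto simp: distinct_card[symmetric])
qed

abbreviation shifted_dist :: "real \<Rightarrow> 'a \<Rightarrow> 'a \<Rightarrow> real" where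
  "shifted_dist t u v \<equiv> real (gdist G u v) - t * of_bool (u = v)"

text \<open>Both characterisations share the passage from the arbitrary enumeration to functions on
  the vertices: \<open>form\<close> rewrites D - tI in terms of indices, and \<open>ix\<close>
  inverts the enumeration so that index vectors can be pulled back.\<close>

lemma distance_eigenvalue_conditions:
  shows least_distance_eigenvalue_ge_iff:
    "pverts G \<noteq> {} \<Longrightarrow> t \<le> distance_eigenvalue G (card (pverts G)) \<longleftrightarrow>
      (\<forall>x. 0 \<le> bform (pverts G) (shifted_dist t) x x)"
  and third_distance_eigenvalue_le_iff:
    "3 \<le> card (pverts G) \<Longrightarrow> distance_eigenvalue G 3 \<le> t \<longleftrightarrow>
      (\<exists>f g. \<forall>x. (\<Sum>v\<in>pverts G. f v * x v) = 0 \<longrightarrow> (\<Sum>v\<in>pverts G. g v * x v) = 0 \<longrightarrow>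
        bform (pverts G) (shifted_dist t) x x \<le> 0)"
proof -
  let ?V = "pverts G" and ?n = "card (pverts G)" and ?vs = "vertex_enum G"
  let ?A = "distance_matrix G ?vs"
  have A: "?A \<in> carrier_mat ?n ?n" by (simp add: distance_matrix_def vertex_enum)
  have symA: "?A\<^sup>T = ?A"
    by (rule eq_matI) (auto simp: distance_matrix_def gdist_commute)
  let ?es = "distance_spectrum G"
  obtain c where ec: "eigen_coordinates ?A ?es c"
    by (rule real_symmetric_eigen_coordinates[OF A symA, folded distance_spectrum_def])
  have dimA: "dim_row ?A = ?n" using A by simp
  note ec' = ec[unfolded eigen_coordinates_def Let_def dimA]
  have c: "\<And>i j. i \<le> j \<Longrightarrow> j < ?n \<Longrightarrow> ?es ! j \<le> ?es ! i"
    "\<And>x. (\<Sum>i<?n. \<Sum>j<?n. x i * x j * ?A $$ (i, j)) = (\<Sum>k<?n. ?es ! k * (\<Sum>i<?n. c k i * x i)\<^sup>2)"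
    "\<And>x. (\<Sum>i<?n. (x i)\<^sup>2) = (\<Sum>k<?n. (\<Sum>i<?n. c k i * x i)\<^sup>2)"
    "\<And>y. \<exists>x. \<forall>k<?n. (\<Sum>i<?n. c k i * x i) = y k"
    using ec' by blast+
  have bij: "bij_betw (\<lambda>i. ?vs ! i) {..<?n} ?V"
    using bij_betw_nth[OF vertex_enum(1)] vertex_enum by simp
  define ix where "ix = inv_into {..<?n} (\<lambda>i. ?vs ! i)"
  have ix: "ix (?vs ! i) = i" if "i < ?n" for i
    unfolding ix_def using bij that by (simp add: bij_betw_inv_into_left)
  have reindex: "(\<Sum>v\<in>?V. h v) = (\<Sum>i<?n. h (?vs ! i))" for h :: "'a \<Rightarrow> real"
    by (rule sum.reindex_bij_betw[OF bij, symmetric])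
  define Q where "Q x = (\<Sum>i<?n. \<Sum>j<?n. x i * x j * ?A $$ (i, j))" for x
  define N :: "(nat \<Rightarrow> real) \<Rightarrow> real" where "N x = (\<Sum>i<?n. (x i)\<^sup>2)" for x
  have QN: "Q x = (\<Sum>k<?n. ?es ! k * (\<Sum>i<?n. c k i * x i)\<^sup>2)"
    "N x = (\<Sum>k<?n. (\<Sum>i<?n. c k i * x i)\<^sup>2)" for x
    unfolding Q_def N_def by (rule c(2), rule c(3))
  have form: "bform ?V (shifted_dist t) x x = Q (\<lambda>i. x (?vs ! i)) - t * N (\<lambda>i. x (?vs ! i))" for x
  proof -
    have "bform ?V (shifted_dist t) x x = (\<Sum>u\<in>?V. \<Sum>v\<in>?V. x u * x v * real (gdist G u v)) -
        (\<Sum>u\<in>?V. \<Sum>v\<in>?V. if u = v then t * (x u)\<^sup>2 else 0)"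
      unfolding bform_def sum_subtractf[symmetric]
      by (intro sum.cong refl) (auto simp: algebra_simps power2_eq_square)
    also have "(\<Sum>u\<in>?V. \<Sum>v\<in>?V. if u = v then t * (x u)\<^sup>2 else 0) = t * (\<Sum>v\<in>?V. (x v)\<^sup>2)"
      using pair_finite_verts by (simp add: sum_distrib_left)
    also have "(\<Sum>u\<in>?V. \<Sum>v\<in>?V. x u * x v * real (gdist G u v)) = Q (\<lambda>i. x (?vs ! i))"
      unfolding reindex Q_def
      by (intro sum.cong refl) (simp add: distance_matrix_def vertex_enum)
    finally show ?thesis unfolding N_def reindex .
  qed
  have shift_back: "Q y - t * N y = bform ?V (shifted_dist t) (\<lambda>v. y (ix v)) (\<lambda>v. y (ix v))" for y
    unfolding form Q_def N_def by (simp add: ix)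
  show "t \<le> distance_eigenvalue G ?n \<longleftrightarrow> (\<forall>x. 0 \<le> bform ?V (shifted_dist t) x x)" if "?V \<noteq> {}"
  proof -
    have n: "0 < ?n" using that pair_finite_verts by (simp add: card_gt_0_iff)
    have "t \<le> ?es ! (?n - 1) \<longleftrightarrow> (\<forall>x. t * N x \<le> Q x)"
      by (rule eigenvalue_ge_iff[OF n c(1) QN c(4)])
    also have "\<dots> \<longleftrightarrow> (\<forall>x. 0 \<le> bform ?V (shifted_dist t) x x)"
    proof (intro iffI allI)
      fix x assume "\<forall>x. t * N x \<le> Q x"
      then show "0 \<le> bform ?V (shifted_dist t) x x" unfolding form by simp
    next
      fix y assume "\<forall>x. 0 \<le> bform ?V (shifted_dist t) x x"
      then have "0 \<le> Q y - t * N y" unfolding shift_back by blast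
      then show "t * N y \<le> Q y" by simp
    qed
    finally show ?thesis by (simp add: distance_eigenvalue_def)
  qed
  show "distance_eigenvalue G 3 \<le> t \<longleftrightarrow>
      (\<exists>f g. \<forall>x. (\<Sum>v\<in>?V. f v * x v) = 0 \<longrightarrow> (\<Sum>v\<in>?V. g v * x v) = 0 \<longrightarrow>
        bform ?V (shifted_dist t) x x \<le> 0)" if n: "3 \<le> ?n"
  proof -
    have "?es ! 2 \<le> t \<longleftrightarrow> (\<exists>f g. \<forall>x. (\<Sum>i<?n. f i * x i) = 0 \<longrightarrow> (\<Sum>i<?n. g i * x i) = 0 \<longrightarrow>
        Q x \<le> t * N x)"
      by (rule third_eigenvalue_le_iff[OF n c(1) QN c(4)])
    also have "\<dots> \<longleftrightarrow> (\<exists>f g. \<forall>x. (\<Sum>v\<in>?V. f v * x v) = 0 \<longrightarrow> (\<Sum>v\<in>?V. g v * x v) = 0 \<longrightarrow>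
        bform ?V (shifted_dist t) x x \<le> 0)"
    proof (intro iffI; elim exE)
      fix f g assume *: "\<forall>x. (\<Sum>i<?n. f i * x i) = 0 \<longrightarrow> (\<Sum>i<?n. g i * x i) = 0 \<longrightarrow> Q x \<le> t * N x"
      show "\<exists>f g. \<forall>x. (\<Sum>v\<in>?V. f v * x v) = 0 \<longrightarrow> (\<Sum>v\<in>?V. g v * x v) = 0 \<longrightarrow>
          bform ?V (shifted_dist t) x x \<le> 0"
      proof (rule exI[of _ "\<lambda>v. f (ix v)"], rule exI[of _ "\<lambda>v. g (ix v)"], intro allI impI)
        fix x assume "(\<Sum>v\<in>?V. f (ix v) * x v) = 0" "(\<Sum>v\<in>?V. g (ix v) * x v) = 0"
        then show "bform ?V (shifted_dist t) x x \<le> 0"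
          using *[rule_format, of "\<lambda>i. x (?vs ! i)"] unfolding reindex form by (simp add: ix)
      qed
    next
      fix f g assume *: "\<forall>x. (\<Sum>v\<in>?V. f v * x v) = 0 \<longrightarrow> (\<Sum>v\<in>?V. g v * x v) = 0 \<longrightarrow>
          bform ?V (shifted_dist t) x x \<le> 0"
      show "\<exists>f g. \<forall>x. (\<Sum>i<?n. f i * x i) = 0 \<longrightarrow> (\<Sum>i<?n. g i * x i) = 0 \<longrightarrow> Q x \<le> t * N x"
      proof (rule exI[of _ "\<lambda>i. f (?vs ! i)"], rule exI[of _ "\<lambda>i. g (?vs ! i)"], intro allI impI)
        fix y assume "(\<Sum>i<?n. f (?vs ! i) * y i) = 0" "(\<Sum>i<?n. g (?vs ! i) * y i) = 0"
        then have "bform ?V (shifted_dist t) (\<lambda>v. y (ix v)) (\<lambda>v. y (ix v)) \<le> 0"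
          by (intro *[rule_format]) (simp_all add: reindex ix)
        then show "Q y \<le> t * N y" unfolding shift_back[symmetric] by simp
      qed
    qed
    finally show ?thesis by (simp add: distance_eigenvalue_def)
  qed
qed

section \<open>Distances up to three in terms of adjacency\<close>

abbreviation adj :: "'a \<Rightarrow> 'a \<Rightarrow> bool" where "adj u v \<equiv> (u, v) \<in> parcs G"

definition coadj :: "'a \<Rightarrow> 'a \<Rightarrow> bool" where "coadj u v \<longleftrightarrow> u \<noteq> v \<and> \<not> adj u v"

lemma adj_sym: "adj u v \<Longrightarrow> adj v u"
  by (rule arcs_symmetric)

lemma adj_irrefl: "\<not> adj v v"
  using pair_no_loops by force

lemma adj_in_verts: "adj u v \<Longrightarrow> u \<in> pverts G \<and> v \<in> pverts G"
  using in_arcsD1 in_arcsD2 by blast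

lemma gdist_eqI:
  assumes "apath u p v" "length p = k" "\<And>q. apath u q v \<Longrightarrow> k \<le> length q"
  shows "gdist G u v = k"
  unfolding gdist_def using assms by (intro Least_equality) auto

lemma apath_length_ge1: "apath u q v \<Longrightarrow> u \<noteq> v \<Longrightarrow> 1 \<le> length q"
  by (cases q) (auto simp: apath_Nil_iff)

lemma apath_length_ge2: "apath u q v \<Longrightarrow> u \<noteq> v \<Longrightarrow> \<not> adj u v \<Longrightarrow> 2 \<le> length q"
  by (cases q; cases "tl q") (auto simp: apath_Nil_iff apath_Cons_iff)

lemma apath_length_ge3:
  assumes "apath u q v" "u \<noteq> v" "\<not> adj u v" "\<And>w. \<not> (adj u w \<and> adj w v)"
  shows "3 \<le> length q"
  using assms by (cases q; cases "tl q"; cases "tl (tl q)") (auto simp: apath_Nil_iff apath_Cons_iff)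

lemma gdist_self: "u \<in> pverts G \<Longrightarrow> gdist G u u = 0"
  by (rule gdist_eqI[of _ "[]"]) (auto simp: apath_Nil_iff)

lemma gdist_adj: "adj u v \<Longrightarrow> gdist G u v = 1"
  using adj_irrefl[of u] adj_in_verts[of u v] apath_length_ge1[of u _ v]
  by (intro gdist_eqI[of _ "[(u, v)]"]) (auto simp: apath_Nil_iff apath_Cons_iff)

lemma gdist_two: "\<lbrakk>u \<noteq> v; \<not> adj u v; adj u w; adj w v\<rbrakk> \<Longrightarrow> gdist G u v = 2"
  using adj_irrefl[of u] adj_irrefl[of w] adj_irrefl[of v] adj_in_verts[of w v] apath_length_ge2[of u _ v]
  by (intro gdist_eqI[of _ "[(u, w), (w, v)]"]) (auto simp: apath_Nil_iff apath_Cons_iff)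

lemma gdist_three:
  assumes "u \<noteq> v" "\<not> adj u v" "\<And>w. \<not> (adj u w \<and> adj w v)" "adj u x" "adj x y" "adj y v"
  shows "gdist G u v = 3"
proof (rule gdist_eqI[of _ "[(u, x), (x, y), (y, v)]"])
  show "apath u [(u, x), (x, y), (y, v)] v"
    using assms adj_irrefl adj_in_verts[of y v] by (auto simp: apath_Nil_iff apath_Cons_iff)
qed (use assms apath_length_ge3 in auto)

text \<open>An isometric path with four vertices violates \<open>D + 3I \<ge> 0\<close>, as \<open>(2, 1, -1, -2)\<close> shows.\<close>

lemma common_neighbour_if_nonneg:
  assumes conn: "connected (with_proj G)"
    and nonneg: "\<And>x. 0 \<le> bform (pverts G) (shifted_dist (- 3)) x x"
    and uv: "u \<in> pverts G" "v \<in> pverts G" "coadj u v"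
  obtains w where "adj u w" "adj w v"
proof -
  have "(u, v) \<in> rtrancl_on (pverts G) (parcs G)"
  proof -
    \<comment> \<open>Connectedness is defined through the symmetric closure, which leaves a
      symmetric arc set unchanged.\<close>
    have "parcs (mk_symmetric (with_proj G)) = parcs G"
      using adj_mk_symmetric_eq[OF sym_arcs] by simp
    then show ?thesis
      using conn uv unfolding connected_def strongly_connected_def reachable_def by simp
  qed
  \<comment> \<open>Induction along a walk from \<open>u\<close>: the first vertex z violating this
    disjunction would complete an isometric path u w y z.\<close>
  then have "v = u \<or> adj u v \<or> (\<exists>w. adj u w \<and> adj w v)"
  proof (induction rule: rtrancl_on_induct)
    case (step y z)
    show ?case
    proof (rule ccontr)
      assume far: "\<not> ?thesis"
      then have "y \<noteq> u" "\<not> adj u y" using step.hyps adj_irrefl by auto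
      then obtain w where w: "adj u w" "adj w y" using step.IH by auto
      have yz: "adj y z" using step.hyps by simp
      have nwz: "\<not> adj w z" using far w by auto
      have zw: "z \<noteq> w" "z \<noteq> u" "\<not> adj u z" using far w by auto
      have g: "gdist G u w = 1" "gdist G w y = 1" "gdist G y z = 1" "gdist G u y = 2"
        "gdist G w z = 2" "gdist G u z = 3"
        using gdist_adj w yz gdist_two[of u y w] gdist_two[of w z y] gdist_three[of u z w y]
          far zw nwz \<open>y \<noteq> u\<close> \<open>\<not> adj u y\<close> by auto
      have g': "gdist G w u = 1" "gdist G y w = 1" "gdist G z y = 1" "gdist G y u = 2"
        "gdist G z w = 2" "gdist G z u = 3"
        using g gdist_commute by metis+
      have V: "set [u, w, y, z] \<subseteq> pverts G" using w yz adj_in_verts by auto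
      then have g0: "gdist G u u = 0" "gdist G w w = 0" "gdist G y y = 0" "gdist G z z = 0"
        by (simp_all add: gdist_self)
      have d: "distinct [u, w, y, z]" "distinct [z, y, w, u]"
        using w yz zw \<open>y \<noteq> u\<close> adj_irrefl by auto
      have "0 \<le> bform (pverts G) (shifted_dist (- 3)) (lincomb [2, 1, - 1, - 2] [u, w, y, z])
          (lincomb [2, 1, - 1, - 2] [u, w, y, z])" by (rule nonneg)
      then show False
        unfolding bform_lincomb[OF pair_finite_verts V V] using d by (simp add: g g' g0)
    qed
  qed simp
  then show thesis using uv that by (auto simp: coadj_def)
qed

lemma shifted_dist_diam2:
  assumes diam2: "\<And>u v. u \<in> pverts G \<Longrightarrow> v \<in> pverts G \<Longrightarrow> coadj u v \<Longrightarrow> \<exists>w. adj u w \<and> adj w v"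
    and uv: "u \<in> pverts G" "v \<in> pverts G"
  shows "real (gdist G u v) = 1 + of_bool (coadj u v) - of_bool (u = v)"
proof -
  consider "u = v" | "adj u v" "u \<noteq> v" | "coadj u v" unfolding coadj_def by blast
  then show ?thesis
  proof cases
    case 1 then show ?thesis using uv by (simp add: gdist_self coadj_def)
  next
    case 2 then show ?thesis by (simp add: gdist_adj coadj_def)
  next
    case 3
    then obtain w where "adj u w" "adj w v" using diam2 uv by blast
    then have "gdist G u v = 2" using 3 gdist_two[of u v w] by (simp add: coadj_def)
    then show ?thesis using 3 by (simp add: coadj_def)
  qed
qed

text \<open>The coefficient -1 - t is 2 for t = -3 and 0 for t = -1, which turns the two eigenvalue
  conditions into the last two assumptions of \<open>co_graph\<close>.\<close>

lemma bform_shifted_dist_diam2: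
  assumes diam2: "\<And>u v. u \<in> pverts G \<Longrightarrow> v \<in> pverts G \<Longrightarrow> coadj u v \<Longrightarrow> \<exists>w. adj u w \<and> adj w v"
  shows "bform (pverts G) (shifted_dist t) x y =
    bform (pverts G) (\<lambda>u v. 1 + of_bool (coadj u v) + (- 1 - t) * of_bool (u = v)) x y"
  unfolding bform_def
  by (intro sum.cong refl) (simp add: shifted_dist_diam2[OF diam2] algebra_simps)

lemma co_graph_coadj:
  assumes conn: "connected (with_proj G)" and card: "card (pverts G) \<ge> 3"
    and least: "- 3 \<le> distance_eigenvalue G (card (pverts G))"
    and third: "distance_eigenvalue G 3 \<le> - 1"
  shows "co_graph (pverts G) coadj"
proof -
  have ne: "pverts G \<noteq> {}" using card by auto
  have nonneg: "0 \<le> bform (pverts G) (shifted_dist (- 3)) x x" for x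
    using least least_distance_eigenvalue_ge_iff[OF ne] by blast
  have diam2: "\<exists>w. adj u w \<and> adj w v" if "u \<in> pverts G" "v \<in> pverts G" "coadj u v" for u v
    using common_neighbour_if_nonneg[OF conn nonneg that] by blast
  show ?thesis
  proof
    show "finite (pverts G)" by (rule pair_finite_verts)
    show "coadj u v \<Longrightarrow> coadj v u" for u v unfolding coadj_def using adj_sym by blast
    show "\<not> coadj v v" for v unfolding coadj_def by simp
    show "\<exists>w\<in>pverts G. w \<noteq> u \<and> w \<noteq> v \<and> \<not> coadj u w \<and> \<not> coadj v w"
      if uv: "u \<in> pverts G" "v \<in> pverts G" "coadj u v" for u v
    proof -
      obtain w where w: "adj u w" "adj w v" using diam2[OF uv] by blast
      have "w \<in> pverts G" "w \<noteq> u" "w \<noteq> v" "adj v w"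
        using w adj_in_verts adj_irrefl adj_sym by blast+
      then show ?thesis using w unfolding coadj_def by blast
    qed
    show "0 \<le> bform (pverts G) (\<lambda>u v. 1 + of_bool (coadj u v) + 2 * of_bool (u = v)) x x" for x
      using nonneg[of x] bform_shifted_dist_diam2[OF diam2, of "- 3"] by simp
    show "\<exists>f g. \<forall>x. (\<Sum>v\<in>pverts G. f v * x v) = 0 \<longrightarrow> (\<Sum>v\<in>pverts G. g v * x v) = 0 \<longrightarrow>
        bform (pverts G) (\<lambda>u v. 1 + of_bool (coadj u v)) x x \<le> 0"
      using third third_distance_eigenvalue_le_iff[OF card] bform_shifted_dist_diam2[OF diam2, of "- 1"]
      by simp
  qed
qed

end

section \<open>Isomorphisms onto joins and disjoint unions\<close>

text \<open>Isomorphism from the subgraph induced on \<open>X\<close>. A bare relation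
  \<open>R\<close>, whose arcs may leave \<open>X\<close>, is used so that a part of a graph need
  not be made a graph of its own.\<close>

definition induces :: "('a \<times> 'a) set \<Rightarrow> 'a set \<Rightarrow> 'b pair_pre_digraph \<Rightarrow> bool" where
  "induces R X H \<longleftrightarrow> (\<exists>f. bij_betw f X (pverts H) \<and>
     (\<forall>u\<in>X. \<forall>v\<in>X. (u, v) \<in> R \<longleftrightarrow> (f u, f v) \<in> parcs H))"

text \<open>A \<open>digraph_isomorphism\<close> carries an arc map and new head and tail functions.
  For \<open>with_proj H\<close> the latter must be \<open>snd\<close> and \<open>fst\<close>, so
  the vertex map determines the arc map. Well-formedness of \<open>G\<close> occurs on the right
  because a \<open>digraph_isomorphism\<close> includes it.\<close>

lemma digraph_iso_iff_induces:
  assumes H: "parcs H \<subseteq> pverts H \<times> pverts H"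
  shows "digraph_iso (with_proj G) (with_proj H) \<longleftrightarrow>
    parcs G \<subseteq> pverts G \<times> pverts G \<and> induces (parcs G) (pverts G) H"
proof
  assume "digraph_iso (with_proj G) (with_proj H)"
  then obtain h where h: "pre_digraph.digraph_isomorphism (with_proj G) h"
    and eq: "with_proj H = app_iso h (with_proj G)" unfolding digraph_iso_def by blast
  have wf: "wf_digraph (with_proj G)" and inj: "inj_on (iso_verts h) (pverts G)"
    and tails: "\<And>e. e \<in> parcs G \<Longrightarrow> iso_verts h (fst e) = iso_tail h (iso_arcs h e)"
    and heads: "\<And>e. e \<in> parcs G \<Longrightarrow> iso_verts h (snd e) = iso_head h (iso_arcs h e)"
    using h by (auto simp: pre_digraph.digraph_isomorphism_def)
  have arcsG: "parcs G \<subseteq> pverts G \<times> pverts G"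
    using wf_digraph.tail_in_verts[OF wf] wf_digraph.head_in_verts[OF wf] by force
  have vH: "pverts H = iso_verts h ` pverts G" and aH: "parcs H = iso_arcs h ` parcs G"
    and th: "iso_tail h = fst" "iso_head h = snd"
    using arg_cong[OF eq, of verts] arg_cong[OF eq, of arcs] arg_cong[OF eq, of tail]
      arg_cong[OF eq, of head] by simp_all
  have arc: "iso_arcs h e = (iso_verts h (fst e), iso_verts h (snd e))" if "e \<in> parcs G" for e
    using tails[OF that] heads[OF that] by (simp add: th)
  have "(u, v) \<in> parcs G \<longleftrightarrow> (iso_verts h u, iso_verts h v) \<in> parcs H"
    if uv: "u \<in> pverts G" "v \<in> pverts G" for u v
  proof
    assume "(u, v) \<in> parcs G"
    then show "(iso_verts h u, iso_verts h v) \<in> parcs H" unfolding aH using arc by force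
  next
    assume "(iso_verts h u, iso_verts h v) \<in> parcs H"
    then obtain e where e: "e \<in> parcs G" "iso_arcs h e = (iso_verts h u, iso_verts h v)"
      unfolding aH by auto
    then have "iso_verts h (fst e) = iso_verts h u" "iso_verts h (snd e) = iso_verts h v"
      using arc by auto
    moreover have "fst e \<in> pverts G" "snd e \<in> pverts G" using e arcsG by auto
    ultimately have "e = (u, v)" using inj uv by (simp add: inj_on_eq_iff prod_eq_iff)
    then show "(u, v) \<in> parcs G" using e by simp
  qed
  then have "induces (parcs G) (pverts G) H"
    unfolding induces_def using inj vH by (intro exI[of _ "iso_verts h"]) (auto simp: bij_betw_def)
  then show "parcs G \<subseteq> pverts G \<times> pverts G \<and> induces (parcs G) (pverts G) H" using arcsG by simp
next
  assume "parcs G \<subseteq> pverts G \<times> pverts G \<and> induces (parcs G) (pverts G) H"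
  then obtain f where arcsG: "parcs G \<subseteq> pverts G \<times> pverts G" and bij: "bij_betw f (pverts G) (pverts H)"
    and iff: "\<And>u v. u \<in> pverts G \<Longrightarrow> v \<in> pverts G \<Longrightarrow> (u, v) \<in> parcs G \<longleftrightarrow> (f u, f v) \<in> parcs H"
    unfolding induces_def by blast
  define h where "h = \<lparr>iso_verts = f, iso_arcs = map_prod f f, iso_head = snd, iso_tail = fst\<rparr>"
  have inj: "inj_on f (pverts G)" and img: "f ` pverts G = pverts H"
    using bij by (auto simp: bij_betw_def)
  have "wf_digraph (with_proj G)" by unfold_locales (use arcsG in auto)
  moreover have "inj_on (map_prod f f) (parcs G)"
    by (rule inj_on_subset[OF map_prod_inj_on[OF inj inj] arcsG])
  ultimately have "pre_digraph.digraph_isomorphism (with_proj G) h"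
    using inj by (auto simp: pre_digraph.digraph_isomorphism_def h_def)
  moreover have "map_prod f f ` parcs G = parcs H"
  proof (intro equalityI subsetI)
    fix e assume "e \<in> map_prod f f ` parcs G"
    then show "e \<in> parcs H" using arcsG iff by auto
  next
    fix e assume e: "e \<in> parcs H"
    then obtain u v where uv: "u \<in> pverts G" "v \<in> pverts G" "e = (f u, f v)"
      using H img by (cases e) blast
    then have "(u, v) \<in> parcs G" using e iff by simp
    then show "e \<in> map_prod f f ` parcs G" using uv by force
  qed
  then have "with_proj H = app_iso h (with_proj G)"
    using img by (simp add: app_iso_def h_def with_proj_def)
  ultimately show "digraph_iso (with_proj G) (with_proj H)" unfolding digraph_iso_def by blast
qed

text \<open>The Boolean \<open>c\<close> says whether the two sides are completely joined or not
  joined at all, so one proof serves both joins and disjoint unions.\<close>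

lemma induces_sum_iff:
  assumes pv: "pverts H = pverts A <+> pverts B"
    and ll: "\<And>a a'. (Inl a, Inl a') \<in> parcs H \<longleftrightarrow> (a, a') \<in> parcs A"
    and rr: "\<And>b b'. (Inr b, Inr b') \<in> parcs H \<longleftrightarrow> (b, b') \<in> parcs B"
    and lr: "\<And>a b. a \<in> pverts A \<Longrightarrow> b \<in> pverts B \<Longrightarrow> (Inl a, Inr b) \<in> parcs H \<longleftrightarrow> c"
    and rl: "\<And>a b. a \<in> pverts A \<Longrightarrow> b \<in> pverts B \<Longrightarrow> (Inr b, Inl a) \<in> parcs H \<longleftrightarrow> c"
  shows "induces R X H \<longleftrightarrow> (\<exists>Y Z. X = Y \<union> Z \<and> Y \<inter> Z = {} \<and> induces R Y A \<and> induces R Z B \<and>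
    (\<forall>y\<in>Y. \<forall>z\<in>Z. ((y, z) \<in> R \<longleftrightarrow> c) \<and> ((z, y) \<in> R \<longleftrightarrow> c)))"
proof
  assume "induces R X H"
  then obtain f where bij: "bij_betw f X (pverts H)"
    and iff': "\<forall>u\<in>X. \<forall>v\<in>X. (u, v) \<in> R \<longleftrightarrow> (f u, f v) \<in> parcs H"
    unfolding induces_def by (elim exE conjE)
  note iff = iff'[rule_format]
  have inj: "inj_on f X" and img: "f ` X = pverts A <+> pverts B"
    using bij pv by (auto simp: bij_betw_def)
  define Y where "Y = {x \<in> X. isl (f x)}"
  define Z where "Z = {x \<in> X. \<not> isl (f x)}"
  have Y: "f y = Inl (projl (f y))" "projl (f y) \<in> pverts A" if "y \<in> Y" for y
    using that img unfolding Y_def by (cases "f y"; force)+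
  have Z: "f z = Inr (projr (f z))" "projr (f z) \<in> pverts B" if "z \<in> Z" for z
    using that img unfolding Z_def by (cases "f z"; force)+
  have YX: "Y \<subseteq> X" and ZX: "Z \<subseteq> X" by (auto simp: Y_def Z_def)
  have bijY: "bij_betw (\<lambda>y. projl (f y)) Y (pverts A)"
  proof (rule bij_betw_imageI)
    show "inj_on (\<lambda>y. projl (f y)) Y"
    proof (rule inj_onI)
      fix x y assume "x \<in> Y" "y \<in> Y" "projl (f x) = projl (f y)"
      then have "f x = f y" using Y(1) by metis
      then show "x = y" using inj YX \<open>x \<in> Y\<close> \<open>y \<in> Y\<close> by (meson inj_onD subsetD)
    qed
    show "(\<lambda>y. projl (f y)) ` Y = pverts A"
    proof (intro equalityI subsetI)
      fix a assume "a \<in> pverts A"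
      then have "Inl a \<in> f ` X" unfolding img by auto
      then obtain x where "x \<in> X" "f x = Inl a" by force
      then show "a \<in> (\<lambda>y. projl (f y)) ` Y" by (intro rev_image_eqI[of x]) (auto simp: Y_def)
    qed (use Y in auto)
  qed
  have bijZ: "bij_betw (\<lambda>z. projr (f z)) Z (pverts B)"
  proof (rule bij_betw_imageI)
    show "inj_on (\<lambda>z. projr (f z)) Z"
    proof (rule inj_onI)
      fix x y assume "x \<in> Z" "y \<in> Z" "projr (f x) = projr (f y)"
      then have "f x = f y" using Z(1) by metis
      then show "x = y" using inj ZX \<open>x \<in> Z\<close> \<open>y \<in> Z\<close> by (meson inj_onD subsetD)
    qed
    show "(\<lambda>z. projr (f z)) ` Z = pverts B"
    proof (intro equalityI subsetI)
      fix b assume "b \<in> pverts B"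
      then have "Inr b \<in> f ` X" unfolding img by auto
      then obtain x where "x \<in> X" "f x = Inr b" by force
      then show "b \<in> (\<lambda>z. projr (f z)) ` Z" by (intro rev_image_eqI[of x]) (auto simp: Z_def)
    qed (use Z in auto)
  qed
  have "induces R Y A" unfolding induces_def
  proof (intro exI conjI ballI)
    fix u v assume uv: "u \<in> Y" "v \<in> Y"
    then obtain a a' where "f u = Inl a" "f v = Inl a'" using Y(1) by blast
    then show "(u, v) \<in> R \<longleftrightarrow> (projl (f u), projl (f v)) \<in> parcs A"
      using iff[of u v] uv YX ll by auto
  qed (rule bijY)
  moreover have "induces R Z B" unfolding induces_def
  proof (intro exI conjI ballI)
    fix u v assume uv: "u \<in> Z" "v \<in> Z"
    then obtain b b' where "f u = Inr b" "f v = Inr b'" using Z(1) by blast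
    then show "(u, v) \<in> R \<longleftrightarrow> (projr (f u), projr (f v)) \<in> parcs B"
      using iff[of u v] uv ZX rr by auto
  qed (rule bijZ)
  moreover have "\<forall>y\<in>Y. \<forall>z\<in>Z. ((y, z) \<in> R \<longleftrightarrow> c) \<and> ((z, y) \<in> R \<longleftrightarrow> c)"
  proof (intro ballI)
    fix y z assume yz: "y \<in> Y" "z \<in> Z"
    obtain a b where "f y = Inl a" "f z = Inr b" "a \<in> pverts A" "b \<in> pverts B"
      using Y[OF yz(1)] Z[OF yz(2)] by blast
    moreover have "y \<in> X" "z \<in> X" using yz YX ZX by auto
    ultimately show "((y, z) \<in> R \<longleftrightarrow> c) \<and> ((z, y) \<in> R \<longleftrightarrow> c)"
      using iff[of y z] iff[of z y] lr rl by simp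
  qed
  moreover have "X = Y \<union> Z" "Y \<inter> Z = {}" by (auto simp: Y_def Z_def)
  ultimately show "\<exists>Y Z. X = Y \<union> Z \<and> Y \<inter> Z = {} \<and> induces R Y A \<and> induces R Z B \<and>
    (\<forall>y\<in>Y. \<forall>z\<in>Z. ((y, z) \<in> R \<longleftrightarrow> c) \<and> ((z, y) \<in> R \<longleftrightarrow> c))"
    by (intro exI[of _ Y] exI[of _ Z] conjI)
next
  assume "\<exists>Y Z. X = Y \<union> Z \<and> Y \<inter> Z = {} \<and> induces R Y A \<and> induces R Z B \<and>
    (\<forall>y\<in>Y. \<forall>z\<in>Z. ((y, z) \<in> R \<longleftrightarrow> c) \<and> ((z, y) \<in> R \<longleftrightarrow> c))"
  then obtain Y Z where YZ: "X = Y \<union> Z \<and> Y \<inter> Z = {} \<and> induces R Y A \<and> induces R Z B \<and>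
    (\<forall>y\<in>Y. \<forall>z\<in>Z. ((y, z) \<in> R \<longleftrightarrow> c) \<and> ((z, y) \<in> R \<longleftrightarrow> c))"
    by (elim exE)
  then have XYZ: "X = Y \<union> Z" "Y \<inter> Z = {}" and cross: "\<And>y z. y \<in> Y \<Longrightarrow> z \<in> Z \<Longrightarrow> (y, z) \<in> R \<longleftrightarrow> c"
    "\<And>y z. y \<in> Y \<Longrightarrow> z \<in> Z \<Longrightarrow> (z, y) \<in> R \<longleftrightarrow> c" by simp_all
  obtain f where f: "bij_betw f Y (pverts A)" "\<forall>u\<in>Y. \<forall>v\<in>Y. (u, v) \<in> R \<longleftrightarrow> (f u, f v) \<in> parcs A"
    using YZ unfolding induces_def by (elim conjE exE)
  obtain g where g: "bij_betw g Z (pverts B)" "\<forall>u\<in>Z. \<forall>v\<in>Z. (u, v) \<in> R \<longleftrightarrow> (g u, g v) \<in> parcs B"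
    using YZ unfolding induces_def by (elim conjE exE)
  define h where "h x = (if x \<in> Y then Inl (f x) else Inr (g x))" for x
  have hY: "h x = Inl (f x)" "f x \<in> pverts A" if "x \<in> Y" for x
    using that f(1) by (auto simp: h_def bij_betw_def)
  have hZ: "h x = Inr (g x)" "g x \<in> pverts B" if "x \<in> Z" for x
    using that g(1) XYZ by (auto simp: h_def bij_betw_def)
  have "bij_betw (\<lambda>x. Inl (f x)) Y (Inl ` pverts A)" "bij_betw (\<lambda>x. Inr (g x)) Z (Inr ` pverts B)"
    using f(1) g(1) by (auto simp: bij_betw_def inj_on_def image_image[symmetric])
  then have "bij_betw h Y (Inl ` pverts A)" "bij_betw h Z (Inr ` pverts B)"
    using hY(1) hZ(1) bij_betw_cong[of Y h "\<lambda>x. Inl (f x)" "Inl ` pverts A"]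
      bij_betw_cong[of Z h "\<lambda>x. Inr (g x)" "Inr ` pverts B"] by simp_all
  then have "bij_betw h X (pverts H)"
    unfolding XYZ pv Plus_def by (rule bij_betw_combine) auto
  moreover have "(u, v) \<in> R \<longleftrightarrow> (h u, h v) \<in> parcs H" if "u \<in> X" "v \<in> X" for u v
  proof -
    consider "u \<in> Y" "v \<in> Y" | "u \<in> Y" "v \<in> Z" | "u \<in> Z" "v \<in> Y" | "u \<in> Z" "v \<in> Z"
      using \<open>u \<in> X\<close> \<open>v \<in> X\<close> XYZ by auto
    then show ?thesis
    proof cases
      case 1 then show ?thesis using f(2) hY ll by simp
    next
      case 2 then show ?thesis using cross(1)[of u v] hY[of u] hZ[of v] lr[of "f u" "g v"] by simp
    next
      case 3 then show ?thesis using cross(2)[of v u] hY[of v] hZ[of u] rl[of "f v" "g u"] by simp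
    next
      case 4 then show ?thesis using g(2) hZ rr by simp
    qed
  qed
  ultimately show "induces R X H" unfolding induces_def by blast
qed

section \<open>Recognising the parametrised graphs inside an arc relation\<close>

lemma disjoint_union_simps [simp]:
  "pverts (A \<union>\<^sub>G B) = pverts A <+> pverts B"
  "(Inl a, Inl a') \<in> parcs (A \<union>\<^sub>G B) \<longleftrightarrow> (a, a') \<in> parcs A"
  "(Inr b, Inr b') \<in> parcs (A \<union>\<^sub>G B) \<longleftrightarrow> (b, b') \<in> parcs B"
  "(Inl a, Inr b) \<notin> parcs (A \<union>\<^sub>G B)" "(Inr b, Inl a) \<notin> parcs (A \<union>\<^sub>G B)"
  by (auto simp: disjoint_union_def)

lemma join_simps [simp]:
  "pverts (A \<or>\<^sub>G B) = pverts A <+> pverts B"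
  "(Inl a, Inl a') \<in> parcs (A \<or>\<^sub>G B) \<longleftrightarrow> (a, a') \<in> parcs A"
  "(Inr b, Inr b') \<in> parcs (A \<or>\<^sub>G B) \<longleftrightarrow> (b, b') \<in> parcs B"
  "(Inl a, Inr b) \<in> parcs (A \<or>\<^sub>G B) \<longleftrightarrow> a \<in> pverts A \<and> b \<in> pverts B"
  "(Inr b, Inl a) \<in> parcs (A \<or>\<^sub>G B) \<longleftrightarrow> a \<in> pverts A \<and> b \<in> pverts B"
  by (auto simp: join_def)

lemma K_simps [simp]:
  "pverts (K s) = {..<s}" "(u, v) \<in> parcs (K s) \<longleftrightarrow> u < s \<and> v < s \<and> u \<noteq> v"
  by (auto simp: K_def)

lemma copies_K_simps [simp]:
  "pverts (copies_K m s) = {..<m * s}"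
  "(u, v) \<in> parcs (copies_K m s) \<longleftrightarrow> u < m * s \<and> v < m * s \<and> u \<noteq> v \<and> u div s = v div s"
  by (auto simp: copies_K_def)

lemma induces_disjoint_union_iff:
  "induces R X (A \<union>\<^sub>G B) \<longleftrightarrow> (\<exists>Y Z. X = Y \<union> Z \<and> Y \<inter> Z = {} \<and> induces R Y A \<and> induces R Z B \<and>
    (\<forall>y\<in>Y. \<forall>z\<in>Z. (y, z) \<notin> R \<and> (z, y) \<notin> R))"
  by (subst induces_sum_iff[where c = False and A = A and B = B]) simp_all

lemma induces_join_iff:
  "induces R X (A \<or>\<^sub>G B) \<longleftrightarrow> (\<exists>Y Z. X = Y \<union> Z \<and> Y \<inter> Z = {} \<and> induces R Y A \<and> induces R Z B \<and>
    (\<forall>y\<in>Y. \<forall>z\<in>Z. (y, z) \<in> R \<and> (z, y) \<in> R))"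
  by (subst induces_sum_iff[where c = True and A = A and B = B]) simp_all

lemma induces_K_iff:
  "induces R X (K s) \<longleftrightarrow> finite X \<and> card X = s \<and> (\<forall>u\<in>X. \<forall>v\<in>X. (u, v) \<in> R \<longleftrightarrow> u \<noteq> v)"
proof
  assume "induces R X (K s)"
  then obtain f where bij: "bij_betw f X {..<s}"
    and iff: "\<And>u v. u \<in> X \<Longrightarrow> v \<in> X \<Longrightarrow> (u, v) \<in> R \<longleftrightarrow> (f u, f v) \<in> parcs (K s)"
    unfolding induces_def by auto
  have "f u < s" if "u \<in> X" for u using bij that by (auto simp: bij_betw_def)
  then have "(u, v) \<in> R \<longleftrightarrow> u \<noteq> v" if "u \<in> X" "v \<in> X" for u v
    using iff[OF that] that inj_on_eq_iff[OF bij_betw_imp_inj_on[OF bij] that] by simp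
  then show "finite X \<and> card X = s \<and> (\<forall>u\<in>X. \<forall>v\<in>X. (u, v) \<in> R \<longleftrightarrow> u \<noteq> v)"
    using bij_betw_finite[OF bij] bij_betw_same_card[OF bij] by simp
next
  assume X: "finite X \<and> card X = s \<and> (\<forall>u\<in>X. \<forall>v\<in>X. (u, v) \<in> R \<longleftrightarrow> u \<noteq> v)"
  then obtain f where f: "bij_betw f X {..<s}"
    using ex_bij_betw_finite_nat[of X] by (auto simp: atLeast0LessThan)
  have "f u < s" if "u \<in> X" for u using f that by (auto simp: bij_betw_def)
  then have "(u, v) \<in> R \<longleftrightarrow> (f u, f v) \<in> parcs (K s)" if "u \<in> X" "v \<in> X" for u v
    using that X inj_on_eq_iff[OF bij_betw_imp_inj_on[OF f] that] by simp
  then show "induces R X (K s)" unfolding induces_def using f by (intro exI[of _ f]) simp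
qed

lemma induces_copies_K_1_iff:
  "induces R X (copies_K n 1) \<longleftrightarrow> finite X \<and> card X = n \<and> (\<forall>u\<in>X. \<forall>v\<in>X. (u, v) \<notin> R)"
proof
  assume "induces R X (copies_K n 1)"
  then obtain f where bij: "bij_betw f X {..<n}"
    and iff: "\<And>u v. u \<in> X \<Longrightarrow> v \<in> X \<Longrightarrow> (u, v) \<in> R \<longleftrightarrow> (f u, f v) \<in> parcs (copies_K n 1)"
    unfolding induces_def by auto
  then show "finite X \<and> card X = n \<and> (\<forall>u\<in>X. \<forall>v\<in>X. (u, v) \<notin> R)"
    using bij_betw_finite[OF bij] bij_betw_same_card[OF bij] by simp
next
  assume X: "finite X \<and> card X = n \<and> (\<forall>u\<in>X. \<forall>v\<in>X. (u, v) \<notin> R)"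
  then obtain f where f: "bij_betw f X {..<n}"
    using ex_bij_betw_finite_nat[of X] by (auto simp: atLeast0LessThan)
  then show "induces R X (copies_K n 1)" unfolding induces_def
    using X by (intro exI[of _ f]) auto
qed

text \<open>Maximum degree one on \<open>X\<close>: the description of m K_2 u n K_1 without
  parameters.\<close>

definition matching :: "('a \<times> 'a) set \<Rightarrow> 'a set \<Rightarrow> bool" where
  "matching R X \<longleftrightarrow> (\<forall>u\<in>X. (u, u) \<notin> R) \<and> (\<forall>u\<in>X. \<forall>v\<in>X. (u, v) \<in> R \<longrightarrow> (v, u) \<in> R) \<and>
    (\<forall>u\<in>X. \<forall>v\<in>X. \<forall>w\<in>X. (u, v) \<in> R \<longrightarrow> (u, w) \<in> R \<longrightarrow> v = w)"

lemma matching_subset: "matching R X \<Longrightarrow> Y \<subseteq> X \<Longrightarrow> matching R Y"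
  unfolding matching_def by blast

lemma eq_if_same_block_2:
  fixes a b c :: nat
  assumes "a \<noteq> b" "a \<noteq> c" "a div 2 = b div 2" "a div 2 = c div 2"
  shows "b = c"
proof -
  have "x = 2 * (x div 2) + x mod 2" "x mod 2 = 0 \<or> x mod 2 = 1" for x :: nat by auto
  then show ?thesis using assms by metis
qed

lemma induces_copies_K_2_matching:
  assumes "induces R X (copies_K m 2)"
  shows "finite X \<and> matching R X"
proof -
  obtain f where bij: "bij_betw f X {..<m * 2}"
    and iff: "\<And>u v. u \<in> X \<Longrightarrow> v \<in> X \<Longrightarrow> (u, v) \<in> R \<longleftrightarrow> (f u, f v) \<in> parcs (copies_K m 2)"
    using assms unfolding induces_def by auto
  have iff': "(u, v) \<in> R \<longleftrightarrow> f u \<noteq> f v \<and> f u div 2 = f v div 2" if "u \<in> X" "v \<in> X" for u v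
    using iff[OF that] that bij by (auto simp: bij_betw_def)
  have "v = w" if "u \<in> X" "v \<in> X" "w \<in> X" "(u, v) \<in> R" "(u, w) \<in> R" for u v w
  proof -
    have "f u \<noteq> f v \<and> f u div 2 = f v div 2" "f u \<noteq> f w \<and> f u div 2 = f w div 2"
      using that iff' by simp_all
    then have "f v = f w" using eq_if_same_block_2 by blast
    then show ?thesis using that inj_onD[OF bij_betw_imp_inj_on[OF bij]] by blast
  qed
  moreover have "(u, u) \<notin> R" if "u \<in> X" for u using iff' that by simp
  moreover have "(v, u) \<in> R" if "u \<in> X" "v \<in> X" "(u, v) \<in> R" for u v using iff' that by auto
  ultimately show ?thesis using bij_betw_finite[OF bij] unfolding matching_def by simp
qed

lemma matching_T4_if_induces:
  assumes "induces R X (T4 m n)"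
  shows "finite X \<and> matching R X"
proof -
  obtain Y Z where YZ: "X = Y \<union> Z" "Y \<inter> Z = {}" "induces R Y (copies_K m 2)"
    "induces R Z (copies_K n 1)" "\<forall>y\<in>Y. \<forall>z\<in>Z. (y, z) \<notin> R \<and> (z, y) \<notin> R"
    using assms unfolding T4_def induces_disjoint_union_iff by blast
  have Y: "finite Y" "matching R Y" using induces_copies_K_2_matching[OF YZ(3)] by auto
  have Z: "finite Z" "\<forall>u\<in>Z. \<forall>v\<in>Z. (u, v) \<notin> R" using YZ(4) unfolding induces_copies_K_1_iff by auto
  have edge: "u \<in> Y" "v \<in> Y" if "u \<in> X" "v \<in> X" "(u, v) \<in> R" for u v
    using that YZ(1,5) Z(2) by auto
  have "matching R X"
    unfolding matching_def
  proof (intro conjI ballI impI)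
    fix u assume "u \<in> X"
    then show "(u, u) \<notin> R" using edge[of u u] Y(2) unfolding matching_def by blast
  next
    fix u v assume "u \<in> X" "v \<in> X" "(u, v) \<in> R"
    then show "(v, u) \<in> R" using edge[of u v] Y(2) unfolding matching_def by blast
  next
    fix u v w assume "u \<in> X" "v \<in> X" "w \<in> X" "(u, v) \<in> R" "(u, w) \<in> R"
    then show "v = w" using edge[of u v] edge[of u w] Y(2) unfolding matching_def by blast
  qed
  then show ?thesis using Y Z YZ by simp
qed

text \<open>Removing a matched pair u, v leaves a perfect matching on fewer vertices; the pair is
  then placed on the new last block 2 m, 2 m + 1.\<close>

lemma induces_copies_K_2_if_perfect_matching:
  assumes "finite X" "matching R X" "\<forall>u\<in>X. \<exists>v\<in>X. (u, v) \<in> R"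
  shows "\<exists>m. induces R X (copies_K m 2)"
  using assms
proof (induction "card X" arbitrary: X rule: less_induct)
  case less
  show ?case
  proof (cases "X = {}")
    case True
    then show ?thesis by (intro exI[of _ 0]) (auto simp: induces_def bij_betw_def)
  next
    case False
    then obtain u where u: "u \<in> X" by blast
    then obtain v where v: "v \<in> X" "(u, v) \<in> R" using less.prems(3) by blast
    have vu: "(v, u) \<in> R" "u \<noteq> v" using u v less.prems(2) unfolding matching_def by blast+
    define Y where "Y = X - {u, v}"
    have YX: "Y \<subseteq> X" "X = insert u (insert v Y)" "u \<notin> Y" "v \<notin> Y" using u v by (auto simp: Y_def)
    have Yu: "(y, u) \<notin> R \<and> (u, y) \<notin> R \<and> (y, v) \<notin> R \<and> (v, y) \<notin> R" if "y \<in> Y" for y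
      using less.prems(2) u v vu that unfolding matching_def Y_def by blast
    have "\<forall>y\<in>Y. \<exists>z\<in>Y. (y, z) \<in> R"
    proof
      fix y assume y: "y \<in> Y"
      then obtain z where z: "z \<in> X" "(y, z) \<in> R" using less.prems(3) YX by blast
      then have "z \<in> Y" using Yu[OF y] unfolding Y_def by blast
      then show "\<exists>z\<in>Y. (y, z) \<in> R" using z by blast
    qed
    moreover have "card Y < card X" using u less.prems(1) YX by (metis psubsetI psubset_card_mono)
    ultimately obtain m where "induces R Y (copies_K m 2)"
      using less.hyps[of Y] less.prems(1) matching_subset[OF less.prems(2) YX(1)] finite_subset[OF YX(1)]
      by blast
    then obtain f where f: "bij_betw f Y {..<m * 2}"
      "\<And>x y. x \<in> Y \<Longrightarrow> y \<in> Y \<Longrightarrow> (x, y) \<in> R \<longleftrightarrow> (f x, f y) \<in> parcs (copies_K m 2)"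
      unfolding induces_def by auto
    define h where "h = f(u := 2 * m, v := 2 * m + 1)"
    have hY: "h y = f y" "h y < m * 2" "h y div 2 < m" if "y \<in> Y" for y
    proof -
      show hf: "h y = f y" using that YX by (auto simp: h_def)
      have "f y < m * 2" using that f(1) by (auto simp: bij_betw_def)
      then show "h y < m * 2" "h y div 2 < m" unfolding hf by (simp_all add: less_mult_imp_div_less)
    qed
    have huv: "h u = 2 * m" "h v = 2 * m + 1" using vu by (auto simp: h_def)
    have "bij_betw h Y {..<m * 2}" using f(1) hY(1) bij_betw_cong[of Y h f] by simp
    moreover have "bij_betw h {u, v} {2 * m, 2 * m + 1}" using huv vu by (auto simp: bij_betw_def)
    ultimately have "bij_betw h (Y \<union> {u, v}) ({..<m * 2} \<union> {2 * m, 2 * m + 1})"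
      by (rule bij_betw_combine) auto
    moreover have "Y \<union> {u, v} = X" "{..<m * 2} \<union> {2 * m, 2 * m + 1} = {..<Suc m * 2}"
      using YX by auto
    ultimately have "bij_betw h X {..<Suc m * 2}" by simp
    moreover have "(x, y) \<in> R \<longleftrightarrow> (h x, h y) \<in> parcs (copies_K (Suc m) 2)" if xy: "x \<in> X" "y \<in> X" for x y
    proof -
      have irr: "(u, u) \<notin> R" "(v, v) \<notin> R" using less.prems(2) u v unfolding matching_def by auto
      consider "x \<in> Y" "y \<in> Y" | "x \<in> Y" "y \<in> {u, v}" | "x \<in> {u, v}" "y \<in> Y" | "x \<in> {u, v}" "y \<in> {u, v}"
        using xy YX by auto
      then show ?thesis
      proof cases
        case 1 then show ?thesis using f(2)[of x y] hY[of x] hY[of y] by simp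
      next
        case 2 then show ?thesis using hY(3)[of x] Yu[of x] huv by auto
      next
        case 3 then show ?thesis using hY(3)[of y] Yu[of y] huv by auto
      next
        case 4 then show ?thesis using irr v vu huv by auto
      qed
    qed
    ultimately show ?thesis unfolding induces_def by (intro exI[of _ "Suc m"] exI[of _ h]) simp
  qed
qed

lemma induces_T4_if_matching:
  assumes "finite X" "matching R X"
  obtains m n where "induces R X (T4 m n)"
proof -
  define Y where "Y = {u \<in> X. \<exists>v\<in>X. (u, v) \<in> R}"
  have sym: "(v, u) \<in> R" if "u \<in> X" "v \<in> X" "(u, v) \<in> R" for u v
    using assms(2) that unfolding matching_def by blast
  have Y: "Y \<subseteq> X" "finite Y" using assms(1) by (auto simp: Y_def)
  have "\<forall>u\<in>Y. \<exists>v\<in>Y. (u, v) \<in> R" using sym unfolding Y_def by blast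
  then obtain m where m: "induces R Y (copies_K m 2)"
    using induces_copies_K_2_if_perfect_matching[OF Y(2) matching_subset[OF assms(2) Y(1)]] by blast
  have n: "induces R (X - Y) (copies_K (card (X - Y)) 1)"
    unfolding induces_copies_K_1_iff using assms(1) by (auto simp: Y_def)
  have "X = Y \<union> (X - Y)" "Y \<inter> (X - Y) = {}" using Y by auto
  moreover have "\<forall>y\<in>Y. \<forall>z\<in>X - Y. (y, z) \<notin> R \<and> (z, y) \<notin> R" using sym unfolding Y_def by blast
  ultimately have "induces R X (T4 m (card (X - Y)))"
    unfolding T4_def induces_disjoint_union_iff using m n by blast
  then show thesis by (rule that)
qed

text \<open>m + n counts the cliques, and non-adjacent vertices lie in different ones. Together with
  \<open>nonadjacent_pair_T4\<close>, the bound m + n >= 2 means exactly that the part is not a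
  clique.\<close>

lemma T4_parameters_ge_2:
  assumes "induces R X (T4 m n)" "u \<in> X" "v \<in> X" "u \<noteq> v" "(u, v) \<notin> R"
  shows "m + n \<ge> 2"
proof (rule ccontr)
  assume "\<not> m + n \<ge> 2"
  then have "m = 0 \<and> n = 0 \<or> m = 1 \<and> n = 0 \<or> m = 0 \<and> n = 1" by auto
  moreover obtain f where f: "bij_betw f X (pverts (T4 m n))"
    "(u, v) \<in> R \<longleftrightarrow> (f u, f v) \<in> parcs (T4 m n)"
    using assms unfolding induces_def by blast
  moreover have "f u \<in> pverts (T4 m n)" "f v \<in> pverts (T4 m n)" "f u \<noteq> f v"
    using f(1) assms(2-4) bij_betwE[OF f(1)] inj_on_eq_iff[OF bij_betw_imp_inj_on[OF f(1)], of u v]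
    by simp_all
  ultimately show False
    using assms(5) by (auto simp: T4_def less_2_cases_iff)
qed

lemma nonadjacent_pair_T4:
  assumes "induces R X (T4 m n)" "m + n \<ge> 2"
  obtains u v where "u \<in> X" "v \<in> X" "u \<noteq> v" "(u, v) \<notin> R"
proof -
  obtain f where f: "bij_betw f X (pverts (T4 m n))"
    "\<And>u v. u \<in> X \<Longrightarrow> v \<in> X \<Longrightarrow> (u, v) \<in> R \<longleftrightarrow> (f u, f v) \<in> parcs (T4 m n)"
    using assms unfolding induces_def by blast
  have "\<exists>a\<in>pverts (T4 m n). \<exists>b\<in>pverts (T4 m n). a \<noteq> b \<and> (a, b) \<notin> parcs (T4 m n)"
  proof -
    consider "m \<ge> 2" | "n \<ge> 2" | "m = 1" "n = 1" using assms(2) by linarith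
    then show ?thesis
    proof cases
      case 1
      then show ?thesis
        by (intro bexI[of _ "Inl 0"] bexI[of _ "Inl 2"]) (auto simp: T4_def)
    next
      case 2
      then show ?thesis
        by (intro bexI[of _ "Inr 0"] bexI[of _ "Inr 1"]) (auto simp: T4_def)
    next
      case 3
      then show ?thesis
        by (intro bexI[of _ "Inl 0"] bexI[of _ "Inr 0"]) (auto simp: T4_def)
    qed
  qed
  then obtain a b where ab: "a \<in> f ` X" "b \<in> f ` X" "a \<noteq> b" "(a, b) \<notin> parcs (T4 m n)"
    using f(1) by (auto simp: bij_betw_def)
  then show thesis using f(2) that by (metis imageE)
qed

section \<open>Forms of disjoint unions of cliques\<close>

text \<open>x^T E x on \<open>X\<close>, where E is the complement of \<open>R\<close>. At diameter
  2 the form of D + I is the square of the total sum plus this.\<close>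

definition nform :: "('a \<times> 'a) set \<Rightarrow> 'a set \<Rightarrow> ('a \<Rightarrow> real) \<Rightarrow> real" where
  "nform R X x = bform X (\<lambda>u v. of_bool (u \<noteq> v \<and> (u, v) \<notin> R)) x x"

text \<open>A complete join has no mixed term, so the form of a join is the sum over its sides; the
  mixed term occurs when cliques inside one part are put together.\<close>

lemma nform_Un:
  assumes "finite Y" "finite Z" "Y \<inter> Z = {}"
    and cross: "\<And>y z. y \<in> Y \<Longrightarrow> z \<in> Z \<Longrightarrow> (y, z) \<in> R \<longleftrightarrow> c" "\<And>y z. y \<in> Y \<Longrightarrow> z \<in> Z \<Longrightarrow> (z, y) \<in> R \<longleftrightarrow> c"
  shows "nform R (Y \<union> Z) x =
    nform R Y x + nform R Z x + (if c then 0 else 2 * (\<Sum>v\<in>Y. x v) * (\<Sum>v\<in>Z. x v))"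
proof -
  have four: "(\<Sum>u\<in>Y \<union> Z. \<Sum>v\<in>Y \<union> Z. b u v) = (\<Sum>u\<in>Y. \<Sum>v\<in>Y. b u v) + (\<Sum>u\<in>Z. \<Sum>v\<in>Z. b u v)
      + ((\<Sum>u\<in>Y. \<Sum>v\<in>Z. b u v) + (\<Sum>u\<in>Z. \<Sum>v\<in>Y. b u v))" for b :: "'a \<Rightarrow> 'a \<Rightarrow> real"
    using assms(1-3) by (simp add: sum.union_disjoint sum.distrib)
  have const: "(\<Sum>u\<in>U. \<Sum>v\<in>W. x u * x v * k) = (\<Sum>v\<in>U. x v) * (\<Sum>v\<in>W. x v) * k" for U W k
    unfolding sum_product by (simp only: sum_distrib_right)
  let ?b = "\<lambda>u v. x u * x v * of_bool (u \<noteq> v \<and> (u, v) \<notin> R)"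
  have "(\<Sum>u\<in>Y. \<Sum>v\<in>Z. ?b u v) = (\<Sum>u\<in>Y. \<Sum>v\<in>Z. x u * x v * of_bool (\<not> c))"
    using assms(3) cross by (intro sum.cong refl) auto
  moreover have "(\<Sum>u\<in>Z. \<Sum>v\<in>Y. ?b u v) = (\<Sum>u\<in>Z. \<Sum>v\<in>Y. x u * x v * of_bool (\<not> c))"
    using assms(3) cross by (intro sum.cong refl) auto
  ultimately show ?thesis
    unfolding nform_def bform_def four const by (cases c) (auto simp del: sum_mult_of_bool_eq)
qed

lemma nform_clique:
  assumes "\<forall>u\<in>X. \<forall>v\<in>X. (u, v) \<in> R \<longleftrightarrow> u \<noteq> v"
  shows "nform R X x = 0"
  unfolding nform_def bform_def using assms by (intro sum.neutral ballI) auto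

lemma nform_eq:
  assumes "finite X" "\<forall>u\<in>X. (u, u) \<notin> R"
  shows "nform R X x =
    (\<Sum>v\<in>X. x v)\<^sup>2 - (\<Sum>v\<in>X. (x v)\<^sup>2) - (\<Sum>u\<in>X. \<Sum>v\<in>X. x u * x v * of_bool ((u, v) \<in> R))"
proof -
  have "nform R X x = (\<Sum>u\<in>X. \<Sum>v\<in>X. x u * x v - (if u = v then (x u)\<^sup>2 else 0)
      - x u * x v * of_bool ((u, v) \<in> R))"
    unfolding nform_def bform_def
    using assms(2) by (intro sum.cong refl) (auto simp: power2_eq_square)
  also have "\<dots> = (\<Sum>u\<in>X. \<Sum>v\<in>X. x u * x v) - (\<Sum>u\<in>X. \<Sum>v\<in>X. if u = v then (x u)\<^sup>2 else 0)
      - (\<Sum>u\<in>X. \<Sum>v\<in>X. x u * x v * of_bool ((u, v) \<in> R))"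
    by (simp only: sum_subtractf)
  also have "(\<Sum>u\<in>X. \<Sum>v\<in>X. x u * x v) = (\<Sum>v\<in>X. x v)\<^sup>2"
    unfolding power2_eq_square sum_product ..
  also have "(\<Sum>u\<in>X. \<Sum>v\<in>X. if u = v then (x u)\<^sup>2 else 0) = (\<Sum>v\<in>X. (x v)\<^sup>2)"
    using assms(1) by simp
  finally show ?thesis .
qed

lemma nform_independent:
  assumes "finite X" "\<forall>u\<in>X. \<forall>v\<in>X. (u, v) \<notin> R"
  shows "nform R X x = (\<Sum>v\<in>X. x v)\<^sup>2 - (\<Sum>v\<in>X. (x v)\<^sup>2)"
  using nform_eq[of X R x] assms by simp

text \<open>With s the sum, q the sum of squares and t the sum of x_u x_v over all arcs, the form is
  s^2 - q - t, and both claims amount to |t| <= q. This follows by summing (x_u + x_v)^2 and (x_u -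
  x_v)^2 over the arcs, since every vertex has at most one partner.\<close>

lemma nform_matching:
  assumes fin: "finite X" and M: "matching R X"
  shows "nform R X x \<le> (\<Sum>v\<in>X. x v)\<^sup>2"
    and "(\<Sum>v\<in>X. x v)\<^sup>2 \<le> nform R X x + 2 * (\<Sum>v\<in>X. (x v)\<^sup>2)"
proof -
  let ?r = "\<lambda>u v. of_bool ((u, v) \<in> R) :: real"
  let ?t = "\<Sum>u\<in>X. \<Sum>v\<in>X. x u * x v * ?r u v" and ?q = "\<Sum>v\<in>X. (x v)\<^sup>2"
  have deg: "(\<Sum>v\<in>X. ?r u v) \<le> 1" if u: "u \<in> X" for u
  proof -
    have "(\<Sum>v\<in>X. ?r u v) = real (card (X \<inter> {v. (u, v) \<in> R}))"
      using fin by (simp add: of_bool_def sum.If_cases)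
    moreover have "card (X \<inter> {v. (u, v) \<in> R}) \<le> 1"
    proof (rule card_le_Suc0_iff_eq[THEN iffD2, folded One_nat_def])
      show "\<forall>a\<in>X \<inter> {v. (u, v) \<in> R}. \<forall>b\<in>X \<inter> {v. (u, v) \<in> R}. a = b"
        using M u unfolding matching_def by simp
    qed (use fin in simp)
    ultimately show ?thesis by simp
  qed
  have rs: "?r u v = ?r v u" if "u \<in> X" "v \<in> X" for u v
    using M that unfolding matching_def by auto
  have half: "(\<Sum>u\<in>X. \<Sum>v\<in>X. (x u)\<^sup>2 * ?r u v) \<le> ?q"
    unfolding sum_distrib_left[symmetric]
  proof (rule sum_mono)
    fix u assume "u \<in> X"
    then show "(x u)\<^sup>2 * (\<Sum>v\<in>X. ?r u v) \<le> (x u)\<^sup>2"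
      using mult_left_mono[OF deg zero_le_power2] by simp
  qed
  have "(\<Sum>u\<in>X. \<Sum>v\<in>X. (x v)\<^sup>2 * ?r u v) = (\<Sum>v\<in>X. \<Sum>u\<in>X. (x v)\<^sup>2 * ?r u v)" by (rule sum.swap)
  also have "\<dots> = (\<Sum>v\<in>X. \<Sum>u\<in>X. (x v)\<^sup>2 * ?r v u)"
  proof (intro sum.cong refl)
    fix u v assume "u \<in> X" "v \<in> X"
    then show "(x v)\<^sup>2 * ?r u v = (x v)\<^sup>2 * ?r v u" using rs[of u v] by simp
  qed
  finally have half': "(\<Sum>u\<in>X. \<Sum>v\<in>X. (x v)\<^sup>2 * ?r u v) \<le> ?q" using half by (rule ord_eq_le_trans)
  have ge: "0 \<le> (\<Sum>u\<in>X. \<Sum>v\<in>X. (x u)\<^sup>2 * ?r u v)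
      + 2 * s * ?t + s\<^sup>2 * (\<Sum>u\<in>X. \<Sum>v\<in>X. (x v)\<^sup>2 * ?r u v)" for s
  proof -
    have "0 \<le> (\<Sum>u\<in>X. \<Sum>v\<in>X. (x u + s * x v)\<^sup>2 * ?r u v)" by (intro sum_nonneg) simp
    also have "\<dots> = (\<Sum>u\<in>X. \<Sum>v\<in>X. (x u)\<^sup>2 * ?r u v)
        + 2 * s * ?t + s\<^sup>2 * (\<Sum>u\<in>X. \<Sum>v\<in>X. (x v)\<^sup>2 * ?r u v)"
      unfolding sum_distrib_left sum.distrib[symmetric]
      by (intro sum.cong refl) (simp add: power2_eq_square algebra_simps)
    finally show ?thesis .
  qed
  have "0 \<le> ?q + 2 * ?t + ?q" "0 \<le> ?q - 2 * ?t + ?q"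
    using ge[of 1] ge[of "- 1"] half half' unfolding power_one power2_minus by linarith+
  then have "- ?q \<le> ?t" "?t \<le> ?q" by linarith+
  moreover have "nform R X x = (\<Sum>v\<in>X. x v)\<^sup>2 - ?q - ?t"
    using nform_eq[OF fin] M unfolding matching_def by blast
  ultimately show "nform R X x \<le> (\<Sum>v\<in>X. x v)\<^sup>2" "(\<Sum>v\<in>X. x v)\<^sup>2 \<le> nform R X x + 2 * ?q"
    by simp_all
qed

lemma square_sum_le:
  fixes x :: "'a \<Rightarrow> real"
  shows "(\<Sum>v\<in>X. x v)\<^sup>2 \<le> real (card X) * (\<Sum>v\<in>X. (x v)\<^sup>2)"
proof -
  have "0 \<le> (\<Sum>u\<in>X. \<Sum>v\<in>X. (x u - x v)\<^sup>2)" by (intro sum_nonneg) simp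
  also have "\<dots> = (\<Sum>u\<in>X. \<Sum>v\<in>X. (x u)\<^sup>2 + (x v)\<^sup>2 - 2 * (x u * x v))"
    by (simp add: power2_diff mult.assoc)
  also have "\<dots> = 2 * (real (card X) * (\<Sum>v\<in>X. (x v)\<^sup>2)) - 2 * (\<Sum>u\<in>X. \<Sum>v\<in>X. x u * x v)"
    by (simp only: sum.distrib sum_subtractf sum_distrib_left[symmetric] sum_constant)
  also have "(\<Sum>u\<in>X. \<Sum>v\<in>X. x u * x v) = (\<Sum>v\<in>X. x v)\<^sup>2"
    unfolding power2_eq_square sum_product ..
  finally show ?thesis by simp
qed

definition simple_on :: "('a \<times> 'a) set \<Rightarrow> 'a set \<Rightarrow> bool" where
  "simple_on R X \<longleftrightarrow> finite X \<and> (\<forall>u\<in>X. (u, u) \<notin> R) \<and> (\<forall>u\<in>X. \<forall>v\<in>X. (u, v) \<in> R \<longrightarrow> (v, u) \<in> R)"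

text \<open>The counterpart of \<open>split_part\<close> for the arc relation itself.\<close>

definition split_on :: "('a \<times> 'a) set \<Rightarrow> 'a set \<Rightarrow> 'a set \<Rightarrow> bool" where
  "split_on R A C \<longleftrightarrow> finite A \<and> finite C \<and> A \<inter> C = {} \<and> (\<forall>u\<in>A. \<forall>v\<in>A. (u, v) \<notin> R) \<and>
     (\<forall>u\<in>C. \<forall>v\<in>C. (u, v) \<in> R \<longleftrightarrow> u \<noteq> v) \<and> (\<forall>c\<in>C. \<forall>a\<in>A. (c, a) \<notin> R \<and> (a, c) \<notin> R)"

lemma simple_on_split: "split_on R A C \<Longrightarrow> simple_on R (A \<union> C)"
  unfolding split_on_def simple_on_def by auto

lemma nform_split:
  assumes "split_on R A C"
  shows "nform R (A \<union> C) x =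
    (\<Sum>v\<in>A. x v)\<^sup>2 - (\<Sum>v\<in>A. (x v)\<^sup>2) + 2 * (\<Sum>v\<in>A. x v) * (\<Sum>v\<in>C. x v)"
proof -
  have "nform R (A \<union> C) x = nform R A x + nform R C x + 2 * (\<Sum>v\<in>A. x v) * (\<Sum>v\<in>C. x v)"
    using assms nform_Un[of A C R False x] by (simp add: split_on_def)
  then show ?thesis
    using assms nform_independent[of A R x] nform_clique[of C R x] by (simp add: split_on_def)
qed

lemma induces_split_iff:
  "induces R X (K c \<union>\<^sub>G copies_K a 1) \<longleftrightarrow>
    (\<exists>A C. X = A \<union> C \<and> split_on R A C \<and> card A = a \<and> card C = c)"
proof
  assume "induces R X (K c \<union>\<^sub>G copies_K a 1)"
  then obtain C A where "X = C \<union> A \<and> C \<inter> A = {} \<and> induces R C (K c) \<and> induces R A (copies_K a 1) \<and>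
    (\<forall>y\<in>C. \<forall>z\<in>A. (y, z) \<notin> R \<and> (z, y) \<notin> R)"
    unfolding induces_disjoint_union_iff by (elim exE)
  then show "\<exists>A C. X = A \<union> C \<and> split_on R A C \<and> card A = a \<and> card C = c"
    unfolding induces_K_iff induces_copies_K_1_iff
    by (intro exI[of _ A] exI[of _ C]) (auto simp: split_on_def)
next
  assume "\<exists>A C. X = A \<union> C \<and> split_on R A C \<and> card A = a \<and> card C = c"
  then obtain A C where "X = A \<union> C \<and> split_on R A C \<and> card A = a \<and> card C = c" by (elim exE)
  then show "induces R X (K c \<union>\<^sub>G copies_K a 1)"
    unfolding induces_disjoint_union_iff induces_K_iff induces_copies_K_1_iff
    by (intro exI[of _ C] exI[of _ A]) (auto simp: split_on_def)
qed

text \<open>Reading K_1 as 1K_1 brings \<open>T1\<close>, \<open>T3\<close> and K_5 u K_1 under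
  \<open>induces_split_iff\<close>.\<close>

lemma induces_K_1_iff: "induces R X (K 1) \<longleftrightarrow> induces R X (copies_K 1 1)"
  unfolding induces_K_iff induces_copies_K_1_iff by (auto simp: card_1_singleton_iff)

lemma induces_union_K_1_iff: "induces R X (A \<union>\<^sub>G K 1) \<longleftrightarrow> induces R X (A \<union>\<^sub>G copies_K 1 1)"
  unfolding induces_disjoint_union_iff induces_K_1_iff ..

lemma induces_T123_iff:
  "(\<exists>T\<in>{T1, T2, T3}. induces R X T) \<longleftrightarrow>
    (\<exists>A C. X = A \<union> C \<and> split_on R A C \<and> (card A, card C) \<in> {(1, 4), (2, 3), (1, 3)})"
proof -
  have "(\<exists>T\<in>{T1, T2, T3}. induces R X T) \<longleftrightarrow> (induces R X (K 4 \<union>\<^sub>G copies_K 1 1) \<or>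
      induces R X (K 3 \<union>\<^sub>G copies_K 2 1) \<or> induces R X (K 3 \<union>\<^sub>G copies_K 1 1))"
    unfolding T1_def T2_def T3_def by (simp add: induces_union_K_1_iff del: One_nat_def)
  then show ?thesis unfolding induces_split_iff by auto
qed

text \<open>The two inequalities are what a part has to contribute to \<open>\<partial>\<^sub>3 \<le> -1\<close> and \<open>\<partial>\<^sub>n \<ge> -3\<close>.\<close>

definition good_part :: "('a \<times> 'a) set \<Rightarrow> 'a set \<Rightarrow> bool" where
  "good_part R X \<longleftrightarrow> simple_on R X \<and> (\<forall>x. nform R X x \<le> (\<Sum>v\<in>X. x v)\<^sup>2) \<and>
     (\<forall>x. 0 \<le> nform R X x + 2 * (\<Sum>v\<in>X. (x v)\<^sup>2))"

lemma good_part_clique: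
  assumes "induces R X (K r)"
  shows "good_part R X"
proof -
  have X: "finite X" "\<forall>u\<in>X. \<forall>v\<in>X. (u, v) \<in> R \<longleftrightarrow> u \<noteq> v"
    using assms unfolding induces_K_iff by auto
  then show ?thesis
    unfolding good_part_def simple_on_def by (simp add: nform_clique sum_nonneg)
qed

lemma good_part_matching:
  assumes "finite X" "matching R X"
  shows "good_part R X"
proof -
  have "0 \<le> nform R X x + 2 * (\<Sum>v\<in>X. (x v)\<^sup>2)" for x
    using nform_matching(2)[OF assms, of x] zero_le_power2[of "\<Sum>v\<in>X. x v"] by linarith
  then show ?thesis
    using assms nform_matching(1)[OF assms] unfolding good_part_def simple_on_def matching_def by simp
qed

text \<open>The right side exceeds the left by the squared sum over \<open>C\<close> plus the sum of
  squares over \<open>A\<close>.\<close>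

lemma split_upper:
  assumes "split_on R A C"
  shows "nform R (A \<union> C) x \<le> (\<Sum>v\<in>A \<union> C. x v)\<^sup>2"
proof -
  have "(\<Sum>v\<in>A \<union> C. x v) = (\<Sum>v\<in>A. x v) + (\<Sum>v\<in>C. x v)"
    using assms by (simp add: split_on_def sum.union_disjoint)
  moreover have "0 \<le> (\<Sum>v\<in>A. (x v)\<^sup>2)" by (simp add: sum_nonneg)
  moreover have "0 \<le> (\<Sum>v\<in>C. x v)\<^sup>2" by simp
  ultimately show ?thesis
    unfolding nform_split[OF assms] by (simp add: power2_eq_square algebra_simps)
qed

text \<open>Cauchy-Schwarz on \<open>A\<close> and \<open>C\<close> eliminates p and q. For (1, 4)
  and (2, 3) what remains is a multiple of a single square, (2 a + b)^2 / 2 and (3 a + 2 b)^2 / 6,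
  so these sizes are extremal; (1, 3) leaves a surplus a^2 / 2.\<close>

lemma good_part_split:
  assumes S: "split_on R A C" and c: "(card A, card C) \<in> {(1, 4), (2, 3), (1, 3)}"
  shows "good_part R (A \<union> C)"
proof -
  have "0 \<le> nform R (A \<union> C) x + 2 * (\<Sum>v\<in>A \<union> C. (x v)\<^sup>2)" for x
  proof -
    define a where "a = (\<Sum>v\<in>A. x v)"
    define b where "b = (\<Sum>v\<in>C. x v)"
    define p where "p = (\<Sum>v\<in>A. (x v)\<^sup>2)"
    define q where "q = (\<Sum>v\<in>C. (x v)\<^sup>2)"
    have le: "a\<^sup>2 \<le> real (card A) * p" "b\<^sup>2 \<le> real (card C) * q"
      unfolding a_def b_def p_def q_def by (rule square_sum_le)+
    have eq: "nform R (A \<union> C) x + 2 * (\<Sum>v\<in>A \<union> C. (x v)\<^sup>2) = a\<^sup>2 + 2 * a * b + p + 2 * q"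
      unfolding nform_split[OF S] a_def b_def p_def q_def
      using S by (simp add: split_on_def sum.union_disjoint)
    consider "card A = 1" "card C = 4" | "card A = 2" "card C = 3" | "card A = 1" "card C = 3"
      using c by auto
    then show ?thesis unfolding eq
    proof cases
      case 1
      have "0 \<le> (2 * a + b)\<^sup>2" by simp
      then show "0 \<le> a\<^sup>2 + 2 * a * b + p + 2 * q" using le 1 by (simp add: power2_eq_square algebra_simps)
    next
      case 2
      have "0 \<le> (3 * a + 2 * b)\<^sup>2" by simp
      then show "0 \<le> a\<^sup>2 + 2 * a * b + p + 2 * q" using le 2 by (simp add: power2_eq_square algebra_simps)
    next
      case 3
      have "0 \<le> (3 * a + 2 * b)\<^sup>2 + 3 * a\<^sup>2" by simp
      then show "0 \<le> a\<^sup>2 + 2 * a * b + p + 2 * q" using le 3 by (simp add: power2_eq_square algebra_simps)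
    qed
  qed
  then show ?thesis using simple_on_split[OF S] split_upper[OF S] unfolding good_part_def by blast
qed

text \<open>Next to a clique with five vertices the form of the part alone can be negative; the opposite part
  compensates for it.\<close>

lemma split_1_5_matching:
  assumes S: "split_on R A C" "card A = 1" "card C = 5" and Y: "finite Y" "matching R Y"
  shows "0 \<le> ((\<Sum>v\<in>Y. x v) + (\<Sum>v\<in>A \<union> C. x v))\<^sup>2 + (nform R Y x + 2 * (\<Sum>v\<in>Y. (x v)\<^sup>2))
    + (nform R (A \<union> C) x + 2 * (\<Sum>v\<in>A \<union> C. (x v)\<^sup>2))"
proof -
  define a where "a = (\<Sum>v\<in>A. x v)"
  define b where "b = (\<Sum>v\<in>C. x v)"
  define p where "p = (\<Sum>v\<in>A. (x v)\<^sup>2)"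
  define q where "q = (\<Sum>v\<in>C. (x v)\<^sup>2)"
  define t where "t = (\<Sum>v\<in>Y. x v)"
  have le: "a\<^sup>2 \<le> p" "b\<^sup>2 \<le> 5 * q"
    using square_sum_le[of x A] square_sum_le[of x C] S(2,3) by (simp_all add: a_def b_def p_def q_def)
  have Yle: "t\<^sup>2 \<le> nform R Y x + 2 * (\<Sum>v\<in>Y. (x v)\<^sup>2)"
    unfolding t_def by (rule nform_matching(2)[OF Y])
  have eq: "nform R (A \<union> C) x + 2 * (\<Sum>v\<in>A \<union> C. (x v)\<^sup>2) = a\<^sup>2 + 2 * a * b + p + 2 * q"
    unfolding nform_split[OF S(1)] a_def b_def p_def q_def
    using S by (simp add: split_on_def sum.union_disjoint)
  have sAC: "(\<Sum>v\<in>A \<union> C. x v) = a + b"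
    using S by (simp add: split_on_def sum.union_disjoint a_def b_def)
  \<comment> \<open>Inserting \<open>le\<close> and multiplying by 10 leads to 10 (t + a + b)^2 + 10
    t^2 + 20 a^2 + 20 a b + 4 b^2. Completing the square in t leaves 25 a^2 + 30 a b + 9 b^2, which
    happens to be a perfect square: the compensation is just sufficient.\<close>
  have "0 \<le> 5 * (2 * t + a + b)\<^sup>2 + (5 * a + 3 * b)\<^sup>2" by simp
  also have "\<dots> = 10 * (t + (a + b))\<^sup>2 + 10 * t\<^sup>2 + 20 * (a * b) + 20 * a\<^sup>2 + 4 * b\<^sup>2"
    by (simp add: power2_eq_square algebra_simps)
  finally have "0 \<le> (t + (a + b))\<^sup>2 + t\<^sup>2 + (a\<^sup>2 + 2 * (a * b) + p + 2 * q)" using le by linarith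
  then show ?thesis using Yle unfolding eq sAC t_def[symmetric] mult.assoc[of 2 a b] by linarith
qed

section \<open>The classification\<close>

definition wf_parcs :: "'a pair_pre_digraph \<Rightarrow> bool" where
  "wf_parcs H \<longleftrightarrow> parcs H \<subseteq> pverts H \<times> pverts H"

lemma wf_parcs_constructions [simp]:
  "wf_parcs (K s)" "wf_parcs (copies_K m s)"
  "wf_parcs A \<Longrightarrow> wf_parcs B \<Longrightarrow> wf_parcs (A \<union>\<^sub>G B)"
  "wf_parcs A \<Longrightarrow> wf_parcs B \<Longrightarrow> wf_parcs (A \<or>\<^sub>G B)"
  by (auto simp: wf_parcs_def K_def copies_K_def disjoint_union_def join_def)

lemma wf_parcs_T [simp]: "wf_parcs T1" "wf_parcs T2" "wf_parcs T3" "wf_parcs (T4 m n)"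
  by (simp_all add: T1_def T2_def T3_def T4_def)

definition join_parts :: "'a pair_pre_digraph \<Rightarrow> 'a set \<Rightarrow> 'a set \<Rightarrow> bool" where
  "join_parts G X Y \<longleftrightarrow> parcs G \<subseteq> pverts G \<times> pverts G \<and> pverts G = X \<union> Y \<and> X \<inter> Y = {} \<and>
     (\<forall>x\<in>X. \<forall>y\<in>Y. (x, y) \<in> parcs G \<and> (y, x) \<in> parcs G)"

lemma join_parts_commute: "join_parts G X Y \<Longrightarrow> join_parts G Y X"
  unfolding join_parts_def by auto

lemma digraph_iso_join_iff:
  assumes "wf_parcs A" "wf_parcs B"
  shows "digraph_iso (with_proj G) (with_proj (A \<or>\<^sub>G B)) \<longleftrightarrow>
    (\<exists>X Y. join_parts G X Y \<and> induces (parcs G) X A \<and> induces (parcs G) Y B)"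
proof -
  have "parcs (A \<or>\<^sub>G B) \<subseteq> pverts (A \<or>\<^sub>G B) \<times> pverts (A \<or>\<^sub>G B)"
    using wf_parcs_constructions(4)[OF assms] unfolding wf_parcs_def .
  from digraph_iso_iff_induces[OF this, of G] show ?thesis
    unfolding induces_join_iff join_parts_def by auto
qed

lemma up_to_iso_join_iff:
  assumes "\<forall>A\<in>\<A>. wf_parcs A" "\<forall>B\<in>\<B>. wf_parcs B"
  shows "G \<in> up_to_iso {A \<or>\<^sub>G B | A B. A \<in> \<A> \<and> B \<in> \<B>} \<longleftrightarrow>
    (\<exists>X Y. join_parts G X Y \<and> (\<exists>A\<in>\<A>. induces (parcs G) X A) \<and> (\<exists>B\<in>\<B>. induces (parcs G) Y B))"
proof -
  have "G \<in> up_to_iso {A \<or>\<^sub>G B | A B. A \<in> \<A> \<and> B \<in> \<B>} \<longleftrightarrow>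
      (\<exists>A\<in>\<A>. \<exists>B\<in>\<B>. digraph_iso (with_proj G) (with_proj (A \<or>\<^sub>G B)))"
    unfolding up_to_iso_def by auto
  also have "\<dots> \<longleftrightarrow> (\<exists>A\<in>\<A>. \<exists>B\<in>\<B>. \<exists>X Y. join_parts G X Y \<and> induces (parcs G) X A \<and> induces (parcs G) Y B)"
    using assms by (simp add: digraph_iso_join_iff)
  finally show ?thesis by (simp only:) blast
qed

lemma up_to_iso_Un: "up_to_iso (\<A> \<union> \<B>) = up_to_iso \<A> \<union> up_to_iso \<B>"
  unfolding up_to_iso_def by blast

definition T123 :: "(nat + nat) pair_pre_digraph set" where "T123 = {T1, T2, T3}"

definition T4s :: "nat \<Rightarrow> (nat + nat) pair_pre_digraph set" where "T4s k = {T4 m n | m n. m + n \<ge> k}"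

lemma wf_parcs_families: "\<forall>A\<in>T123. wf_parcs A" "\<forall>A\<in>T4s k. wf_parcs A" "\<forall>A\<in>{K r | r. r \<ge> 1}. wf_parcs A"
  "\<forall>A\<in>{K 5 \<union>\<^sub>G K 1}. wf_parcs A"
  by (auto simp: T123_def T4s_def)

definition T123_part :: "('a \<times> 'a) set \<Rightarrow> 'a set \<Rightarrow> bool" where
  "T123_part R X \<longleftrightarrow> (\<exists>T\<in>T123. induces R X T)"

definition T4_part :: "('a \<times> 'a) set \<Rightarrow> 'a set \<Rightarrow> bool" where
  "T4_part R X \<longleftrightarrow> (\<exists>T\<in>T4s 2. induces R X T)"

lemma class_S_iff:
  "G \<in> class_S \<longleftrightarrow> (\<exists>X Y. join_parts G X Y \<and> (\<exists>T\<in>T4s 1. induces (parcs G) X T) \<and>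
    induces (parcs G) Y (K 5 \<union>\<^sub>G K 1))"
proof -
  have "{S m n | m n. m + n \<ge> 1} = {A \<or>\<^sub>G B | A B. A \<in> T4s 1 \<and> B \<in> {K 5 \<union>\<^sub>G K 1}}"
    unfolding S_def T4s_def T4_def by blast
  then show ?thesis unfolding class_S_def by (simp only: up_to_iso_join_iff[OF wf_parcs_families(2,4)]) simp
qed

lemma class_T1_iff:
  "G \<in> class_T1 \<longleftrightarrow> (\<exists>X Y. join_parts G X Y \<and> (\<exists>r\<ge>1. induces (parcs G) X (K r)) \<and>
    (T123_part (parcs G) Y \<or> T4_part (parcs G) Y))"
proof -
  have "{K r \<or>\<^sub>G T | r T. r \<ge> 1 \<and> T \<in> {T1, T2, T3}} = {A \<or>\<^sub>G B | A B. A \<in> {K r | r. r \<ge> 1} \<and> B \<in> T123}"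
    unfolding T123_def by blast
  moreover have "{K r \<or>\<^sub>G T4 m n | r m n. r \<ge> 1 \<and> m + n \<ge> 2} =
      {A \<or>\<^sub>G B | A B. A \<in> {K r | r. r \<ge> 1} \<and> B \<in> T4s 2}"
    unfolding T4s_def by blast
  ultimately have "G \<in> class_T1 \<longleftrightarrow>
      (\<exists>X Y. join_parts G X Y \<and> (\<exists>A\<in>{K r | r. r \<ge> 1}. induces (parcs G) X A) \<and> T123_part (parcs G) Y) \<or>
      (\<exists>X Y. join_parts G X Y \<and> (\<exists>A\<in>{K r | r. r \<ge> 1}. induces (parcs G) X A) \<and> T4_part (parcs G) Y)"
    unfolding class_T1_def T123_part_def T4_part_def
    by (simp only: up_to_iso_Un Un_iff up_to_iso_join_iff[OF wf_parcs_families(3,1)]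
        up_to_iso_join_iff[OF wf_parcs_families(3,2)])
  then show ?thesis by blast
qed

lemma class_T2_iff:
  "G \<in> class_T2 \<longleftrightarrow> (\<exists>X Y. join_parts G X Y \<and>
    (T123_part (parcs G) X \<and> T123_part (parcs G) Y \<or> T123_part (parcs G) X \<and> T4_part (parcs G) Y \<or>
     T4_part (parcs G) X \<and> T4_part (parcs G) Y))"
proof -
  have "{T \<or>\<^sub>G T' | T T'. T \<in> {T1, T2, T3} \<and> T' \<in> {T1, T2, T3}} =
      {A \<or>\<^sub>G B | A B. A \<in> T123 \<and> B \<in> T123}"
    unfolding T123_def by blast
  moreover have "{T \<or>\<^sub>G T4 m n | T m n. T \<in> {T1, T2, T3} \<and> m + n \<ge> 2} =
      {A \<or>\<^sub>G B | A B. A \<in> T123 \<and> B \<in> T4s 2}"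
    unfolding T123_def T4s_def by blast
  moreover have "{T4 m1 n1 \<or>\<^sub>G T4 m2 n2 | m1 n1 m2 n2. m1 + n1 \<ge> 2 \<and> m2 + n2 \<ge> 2} =
      {A \<or>\<^sub>G B | A B. A \<in> T4s 2 \<and> B \<in> T4s 2}"
    unfolding T4s_def by blast
  ultimately have "G \<in> class_T2 \<longleftrightarrow>
      ((\<exists>X Y. join_parts G X Y \<and> T123_part (parcs G) X \<and> T123_part (parcs G) Y) \<or>
      (\<exists>X Y. join_parts G X Y \<and> T123_part (parcs G) X \<and> T4_part (parcs G) Y)) \<or>
      (\<exists>X Y. join_parts G X Y \<and> T4_part (parcs G) X \<and> T4_part (parcs G) Y)"
    unfolding class_T2_def T123_part_def T4_part_def
    by (simp only: up_to_iso_Un Un_iff up_to_iso_join_iff[OF wf_parcs_families(1,1)]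
        up_to_iso_join_iff[OF wf_parcs_families(1,2)] up_to_iso_join_iff[OF wf_parcs_families(2,2)])
  then show ?thesis by blast
qed

section \<open>The listed graphs satisfy the eigenvalue conditions\<close>

lemma split_if_T123_part:
  assumes "T123_part R X"
  obtains A C where "X = A \<union> C" "split_on R A C" "(card A, card C) \<in> {(1, 4), (2, 3), (1, 3)}"
  using assms unfolding T123_part_def T123_def induces_T123_iff by (elim exE conjE)

lemma good_part_if_T:
  assumes "T123_part R X \<or> T4_part R X"
  shows "good_part R X"
  using assms
proof
  assume "T123_part R X"
  then obtain A C where "X = A \<union> C" "split_on R A C" "(card A, card C) \<in> {(1, 4), (2, 3), (1, 3)}"
    by (rule split_if_T123_part)
  then show ?thesis using good_part_split by simp
next
  assume "T4_part R X"
  then obtain m n where "induces R X (T4 m n)" unfolding T4_part_def T4s_def by blast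
  then show ?thesis using matching_T4_if_induces good_part_matching by blast
qed

lemma split_nonadjacent:
  assumes "split_on R A C" "card A > 0" "card C > 0"
  obtains u v where "u \<in> A \<union> C" "v \<in> A \<union> C" "u \<noteq> v" "(u, v) \<notin> R"
proof -
  obtain u v where "u \<in> A" "v \<in> C" using assms(2,3) by (metis card_gt_0_iff ex_in_conv)
  then show thesis using assms(1) that[of u v] unfolding split_on_def by blast
qed

lemma nonadjacent_pair_if_T:
  assumes "T123_part R X \<or> T4_part R X"
  obtains u v where "u \<in> X" "v \<in> X" "u \<noteq> v" "(u, v) \<notin> R"
  using assms
proof
  assume "T123_part R X"
  then obtain A C where "X = A \<union> C" "split_on R A C" "(card A, card C) \<in> {(1, 4), (2, 3), (1, 3)}"
    by (rule split_if_T123_part)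
  moreover have "card A > 0" "card C > 0" using \<open>(card A, card C) \<in> _\<close> by auto
  ultimately obtain u v where "u \<in> X" "v \<in> X" "u \<noteq> v" "(u, v) \<notin> R"
    using split_nonadjacent[of R A C] by metis
  then show thesis by (rule that)
next
  assume "T4_part R X"
  then obtain m n where "m + n \<ge> 2" "induces R X (T4 m n)" unfolding T4_part_def T4s_def by blast
  then show thesis using nonadjacent_pair_T4 that by metis
qed

text \<open>When the sums over \<open>X\<close> and \<open>Y\<close> vanish, the J term disappears
  and \<open>upper\<close> bounds each side by 0. \<open>lower\<close> is the form of D + 3I written
  out; it is one inequality for both sides because K_5 u K_1 needs the help of its partner.\<close>

lemma class_G_if_join_parts:
  assumes J: "join_parts G X Y" and XY: "X \<noteq> {}" "Y \<noteq> {}" and card: "card (pverts G) \<ge> 4"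
    and simple: "simple_on (parcs G) X" "simple_on (parcs G) Y"
    and nonadj: "u0 \<in> pverts G" "v0 \<in> pverts G" "u0 \<noteq> v0" "(u0, v0) \<notin> parcs G"
    and upper: "\<And>x. nform (parcs G) X x \<le> (\<Sum>v\<in>X. x v)\<^sup>2" "\<And>x. nform (parcs G) Y x \<le> (\<Sum>v\<in>Y. x v)\<^sup>2"
    and lower: "\<And>x. 0 \<le> ((\<Sum>v\<in>X. x v) + (\<Sum>v\<in>Y. x v))\<^sup>2 + (nform (parcs G) X x + 2 * (\<Sum>v\<in>X. (x v)\<^sup>2))
      + (nform (parcs G) Y x + 2 * (\<Sum>v\<in>Y. (x v)\<^sup>2))"
  shows "G \<in> class_G"
proof -
  have arcs: "parcs G \<subseteq> pverts G \<times> pverts G" and V: "pverts G = X \<union> Y" "X \<inter> Y = {}"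
    and cross: "\<And>x y. x \<in> X \<Longrightarrow> y \<in> Y \<Longrightarrow> (x, y) \<in> parcs G" "\<And>x y. x \<in> X \<Longrightarrow> y \<in> Y \<Longrightarrow> (y, x) \<in> parcs G"
    using J unfolding join_parts_def by auto
  have fin: "finite X" "finite Y" using simple by (auto simp: simple_on_def)
  have irr: "(v, v) \<notin> parcs G" if "v \<in> pverts G" for v
    using simple that V(1) by (auto simp: simple_on_def)
  have sy: "(v, u) \<in> parcs G" if uv: "(u, v) \<in> parcs G" for u v
  proof -
    have "u \<in> X \<or> u \<in> Y" "v \<in> X \<or> v \<in> Y" using uv arcs V(1) by auto
    then show ?thesis using uv cross simple unfolding simple_on_def by auto
  qed
  have finV: "finite (pverts G)" using fin V by simp
  have PG: "pair_graph G"
  proof unfold_locales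
    show "finite (parcs G)" using finite_subset[OF arcs] finV by simp
    show "Digraph.symmetric (with_proj G)"
      unfolding Digraph.symmetric_def with_proj_simps by (rule symI) (rule sy)
  qed (use arcs irr finV in auto)
  interpret pair_graph G by (rule PG)
  have diam2: "\<exists>w. adj u w \<and> adj w v" if uv: "u \<in> pverts G" "v \<in> pverts G" "coadj u v" for u v
  proof -
    consider "u \<in> X" "v \<in> X" | "u \<in> Y" "v \<in> Y"
      using uv V(1) cross unfolding coadj_def by auto
    then show ?thesis
    proof cases
      case 1
      obtain w where "w \<in> Y" using XY by auto
      then show ?thesis using 1 cross by blast
    next
      case 2
      obtain w where "w \<in> X" using XY by auto
      then show ?thesis using 2 cross by blast
    qed
  qed
  have reach: "(u, v) \<in> rtrancl_on (pverts G) (parcs G)" if uv: "u \<in> pverts G" "v \<in> pverts G" for u v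
  proof -
    have base: "(u, u) \<in> rtrancl_on (pverts G) (parcs G)" using uv by simp
    consider "u = v" | "adj u v" | w where "adj u w" "adj w v"
      using diam2[OF uv] unfolding coadj_def by blast
    then show ?thesis
    proof cases
      case 1 then show ?thesis using base by simp
    next
      case 2 then show ?thesis using rtrancl_on_into_rtrancl_on[OF base] uv by blast
    next
      case 3
      then have "w \<in> pverts G" using adj_in_verts by blast
      then show ?thesis
        using rtrancl_on_into_rtrancl_on[OF rtrancl_on_into_rtrancl_on[OF base 3(1)] 3(2)] uv by blast
    qed
  qed
  have "parcs (mk_symmetric (with_proj G)) = parcs G"
    using adj_mk_symmetric_eq[OF sym_arcs] by simp
  then have conn: "Digraph_Component.connected (with_proj G)"
    using reach XY V unfolding Digraph_Component.connected_def strongly_connected_def reachable_def by simp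
  have noncomplete: "\<not> complete_digraph (card (pverts G)) (with_proj G)"
    using nonadj unfolding complete_digraph_pair_def by auto
  have sums: "(\<Sum>v\<in>pverts G. h v) = (\<Sum>v\<in>X. h v) + (\<Sum>v\<in>Y. h v)" for h :: "'a \<Rightarrow> real"
    unfolding V(1) by (rule sum.union_disjoint[OF fin V(2)])
  have form: "bform (pverts G) (\<lambda>u v. 1 + of_bool (coadj u v) + k * of_bool (u = v)) x x =
      (\<Sum>v\<in>pverts G. x v)\<^sup>2 + nform (parcs G) (pverts G) x + k * (\<Sum>v\<in>pverts G. (x v)\<^sup>2)" for k x
  proof -
    have "bform (pverts G) (\<lambda>u v. 1 + of_bool (coadj u v) + k * of_bool (u = v)) x x =
        (\<Sum>u\<in>pverts G. \<Sum>v\<in>pverts G. x u * x v) + nform (parcs G) (pverts G) x +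
        (\<Sum>u\<in>pverts G. \<Sum>v\<in>pverts G. if u = v then k * (x u)\<^sup>2 else 0)"
      unfolding bform_def nform_def sum.distrib[symmetric]
      by (intro sum.cong refl) (auto simp: coadj_def power2_eq_square algebra_simps)
    also have "(\<Sum>u\<in>pverts G. \<Sum>v\<in>pverts G. if u = v then k * (x u)\<^sup>2 else 0) =
        k * (\<Sum>v\<in>pverts G. (x v)\<^sup>2)"
      using finV by (simp add: sum_distrib_left)
    also have "(\<Sum>u\<in>pverts G. \<Sum>v\<in>pverts G. x u * x v) = (\<Sum>v\<in>pverts G. x v)\<^sup>2"
      unfolding power2_eq_square sum_product ..
    finally show ?thesis .
  qed
  have nf: "nform (parcs G) (pverts G) x = nform (parcs G) X x + nform (parcs G) Y x" for x
    unfolding V(1) using nform_Un[OF fin V(2), of "parcs G" True x] cross by simp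
  have least: "- 3 \<le> distance_eigenvalue G (card (pverts G))"
  proof -
    have "0 \<le> bform (pverts G) (shifted_dist (- 3)) x x" for x
    proof -
      have "bform (pverts G) (shifted_dist (- 3)) x x =
          bform (pverts G) (\<lambda>u v. 1 + of_bool (coadj u v) + 2 * of_bool (u = v)) x x"
        using bform_shifted_dist_diam2[OF diam2, of "- 3" x x] by simp
      also have "\<dots> = ((\<Sum>v\<in>X. x v) + (\<Sum>v\<in>Y. x v))\<^sup>2 + (nform (parcs G) X x + nform (parcs G) Y x)
          + 2 * ((\<Sum>v\<in>X. (x v)\<^sup>2) + (\<Sum>v\<in>Y. (x v)\<^sup>2))"
        unfolding form nf sums ..
      finally show ?thesis using lower[of x] by simp
    qed
    moreover have "pverts G \<noteq> {}" using XY V by simp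
    ultimately show ?thesis using least_distance_eigenvalue_ge_iff by blast
  qed
  have third: "distance_eigenvalue G 3 \<le> - 1"
  proof -
    have "bform (pverts G) (shifted_dist (- 1)) x x \<le> 0"
      if "(\<Sum>v\<in>pverts G. of_bool (v \<in> X) * x v) = 0" "(\<Sum>v\<in>pverts G. of_bool (v \<in> Y) * x v) = 0" for x
    proof -
      have "(\<Sum>v\<in>pverts G. of_bool (v \<in> Z) * x v) = (\<Sum>v\<in>Z. x v)" if "Z \<subseteq> pverts G" for Z
        using finV that by (intro sum.mono_neutral_cong_right) auto
      then have "(\<Sum>v\<in>pverts G. of_bool (v \<in> X) * x v) = (\<Sum>v\<in>X. x v)"
        "(\<Sum>v\<in>pverts G. of_bool (v \<in> Y) * x v) = (\<Sum>v\<in>Y. x v)"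
        using V by blast+
      then have z: "(\<Sum>v\<in>X. x v) = 0" "(\<Sum>v\<in>Y. x v) = 0" using that by simp_all
      have "bform (pverts G) (shifted_dist (- 1)) x x =
          bform (pverts G) (\<lambda>u v. 1 + of_bool (coadj u v) + 0 * of_bool (u = v)) x x"
        using bform_shifted_dist_diam2[OF diam2, of "- 1" x x] by simp
      also have "\<dots> = nform (parcs G) X x + nform (parcs G) Y x"
        unfolding form nf sums z by simp
      also have "\<dots> \<le> 0" using upper[of x] z by simp
      finally show ?thesis .
    qed
    then have "\<exists>f g. \<forall>x. (\<Sum>v\<in>pverts G. f v * x v) = 0 \<longrightarrow> (\<Sum>v\<in>pverts G. g v * x v) = 0 \<longrightarrow>
        bform (pverts G) (shifted_dist (- 1)) x x \<le> 0"
      by - (rule exI[of _ "\<lambda>v. of_bool (v \<in> X)"], rule exI[of _ "\<lambda>v. of_bool (v \<in> Y)"], blast)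
    moreover have "3 \<le> card (pverts G)" using card by simp
    ultimately show ?thesis using third_distance_eigenvalue_le_iff by blast
  qed
  show ?thesis unfolding class_G_def using PG conn card noncomplete least third by simp
qed

text \<open>\<open>X\<close> may be a clique; the non-adjacent pair that keeps \<open>G\<close> from
  being complete is found in \<open>Y\<close>.\<close>

lemma class_G_if_good_parts:
  assumes J: "join_parts G X Y" and "X \<noteq> {}" "Y \<noteq> {}" and card: "card (pverts G) \<ge> 4"
    and good: "good_part (parcs G) X" "good_part (parcs G) Y"
    and T: "T123_part (parcs G) Y \<or> T4_part (parcs G) Y"
  shows "G \<in> class_G"
proof -
  obtain u v where uv: "u \<in> Y" "v \<in> Y" "u \<noteq> v" "(u, v) \<notin> parcs G"
    using nonadjacent_pair_if_T[OF T] by blast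
  moreover have "Y \<subseteq> pverts G" using J by (auto simp: join_parts_def)
  ultimately have uv': "u \<in> pverts G" "v \<in> pverts G" by auto
  show ?thesis
    by (rule class_G_if_join_parts[OF J assms(2-4) _ _ uv' uv(3,4)])
      (use good in \<open>simp_all add: good_part_def\<close>)
qed

section \<open>Graphs satisfying the eigenvalue conditions are among the listed ones\<close>

context pair_graph begin

text \<open>Translates the cases of \<open>part_cases\<close> into the constructions. The sizes (1,
  5) stay separate because they also restrict the opposite part.\<close>

lemma part_types:
  assumes co: "co_graph (pverts G) coadj" and X: "X \<subseteq> pverts G" "X \<noteq> {}"
    and trans: "\<forall>a\<in>X. \<forall>b\<in>X. \<forall>c\<in>X. \<not> coadj a b \<longrightarrow> \<not> coadj b c \<longrightarrow> \<not> coadj a c"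
    and y: "y \<in> pverts G" "y \<notin> X" and yX: "\<forall>x\<in>X. \<not> coadj y x"
  obtains (K) "\<exists>r\<ge>1. induces (parcs G) X (K r)"
  | (T) "T123_part (parcs G) X \<or> T4_part (parcs G) X"
  | (split) A C where "X = A \<union> C" "split_on (parcs G) A C" "card A = 1" "card C = 5"
proof -
  interpret co_graph "pverts G" coadj by (rule co)
  have finX: "finite X" using X(1) pair_finite_verts finite_subset by blast
  have clique_K: "\<exists>r\<ge>1. induces (parcs G) X (K r)" if "\<forall>u\<in>X. \<forall>v\<in>X. \<not> coadj u v"
  proof (intro exI[of _ "card X"] conjI)
    show "1 \<le> card X" using X(2) finX by (simp add: Suc_leI card_gt_0_iff)
    show "induces (parcs G) X (K (card X))"
      unfolding induces_K_iff using that finX adj_irrefl by (auto simp: coadj_def)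
  qed
  show thesis
  proof (rule part_cases[OF X(1) trans y yX])
    assume "\<forall>u\<in>X. \<forall>v\<in>X. \<not> coadj u v"
    then show thesis by (intro K clique_K)
  next
    assume small: "\<forall>a\<in>X. \<forall>b\<in>X. \<forall>c\<in>X. \<not> coadj a b \<longrightarrow> \<not> coadj b c \<longrightarrow> a = b \<or> b = c \<or> a = c"
    \<comment> \<open>A part consisting of one or two mutually adjacent vertices is counted as
      \<open>K r\<close>; otherwise a non-adjacent pair gives m + n >= 2.\<close>
    show thesis
    proof (cases "\<forall>u\<in>X. \<forall>v\<in>X. \<not> coadj u v")
      case True
      then show thesis by (intro K clique_K)
    next
      case False
      then obtain u v where uv: "u \<in> X" "v \<in> X" "coadj u v" by blast
      have "matching (parcs G) X"
        unfolding matching_def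
      proof (intro conjI ballI impI)
        fix u v w assume uvw: "u \<in> X" "v \<in> X" "w \<in> X" and E: "adj u v" "adj u w"
        have "\<not> coadj v u" "\<not> coadj u w" using E adj_sym[OF E(1)] by (simp_all add: coadj_def)
        then have "v = u \<or> u = w \<or> v = w" using small uvw by blast
        then show "v = w" using E adj_irrefl by auto
      qed (use adj_irrefl adj_sym in blast)+
      then obtain m n where mn: "induces (parcs G) X (T4 m n)" by (rule induces_T4_if_matching[OF finX])
      moreover have "m + n \<ge> 2" using T4_parameters_ge_2[OF mn uv(1,2)] uv(3) by (simp add: coadj_def)
      ultimately have "T4_part (parcs G) X" unfolding T4_part_def T4s_def by blast
      then show thesis by (intro T) simp
    qed
  next
    fix A C assume split: "X = A \<union> C" "split_part A C" "(card A, card C) \<in> {(2, 3), (1, 3), (1, 4), (1, 5)}"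
    have "split_on (parcs G) A C"
      unfolding split_on_def
    proof (intro conjI ballI)
      show "finite A" "finite C" using finX split(1) by simp_all
      show "A \<inter> C = {}" using split(2) by (simp add: split_part_def)
      show "\<not> adj u v" if "u \<in> A" "v \<in> A" for u v
        using split(2) that adj_irrefl[of u] by (cases "u = v") (auto simp: split_part_def coadj_def)
      show "adj u v \<longleftrightarrow> u \<noteq> v" if "u \<in> C" "v \<in> C" for u v
        using split(2) that adj_irrefl[of u] by (auto simp: split_part_def coadj_def)
      fix c a assume "c \<in> C" "a \<in> A"
      then have "\<not> adj a c" using split(2) by (simp add: split_part_def coadj_def)
      then show "\<not> adj a c" "\<not> adj c a" using adj_sym by blast+
    qed
    then have "T123_part (parcs G) X" if "card A = 2 \<and> card C = 3 \<or> card A = 1 \<and> card C = 3 \<or> card A = 1 \<and> card C = 4"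
      unfolding T123_part_def T123_def induces_T123_iff
      using that split(1) \<open>split_on (parcs G) A C\<close> by (intro exI[of _ A] exI[of _ C]) auto
    moreover have "card A = 2 \<and> card C = 3 \<or> card A = 1 \<and> card C = 3 \<or> card A = 1 \<and> card C = 4
        \<or> card A = 1 \<and> card C = 5" using split(3) by auto
    ultimately consider "T123_part (parcs G) X" | "card A = 1" "card C = 5" by blast
    then show thesis
    proof cases
      case 1
      then show thesis by (intro T) simp
    next
      case 2
      show thesis by (rule that(3)[OF split(1) \<open>split_on (parcs G) A C\<close> 2])
    qed
  qed
qed

text \<open>By \<open>no_K15_3K1\<close> the opposite part contains no triangle. Since adjacency is
  transitive within \<open>Y\<close>, a vertex with two neighbours would create one, so
  \<open>Y\<close> has maximum degree one. This rules out \<open>T1\<close>, \<open>T2\<close>,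
  \<open>T3\<close> and all cliques on at least three vertices as partners.\<close>

lemma T4_opposite_split:
  assumes co: "co_graph (pverts G) coadj" and Y: "Y \<subseteq> pverts G" "Y \<noteq> {}"
    and trans: "\<forall>a\<in>Y. \<forall>b\<in>Y. \<forall>c\<in>Y. \<not> coadj a b \<longrightarrow> \<not> coadj b c \<longrightarrow> \<not> coadj a c"
    and S: "split_on (parcs G) A C" "card A = 1" "card C = 5" "A \<union> C \<subseteq> pverts G"
    and cross: "\<forall>x\<in>A \<union> C. \<forall>y\<in>Y. \<not> coadj y x" "(A \<union> C) \<inter> Y = {}"
  shows "\<exists>T\<in>T4s 1. induces (parcs G) Y T"
proof -
  interpret co_graph "pverts G" coadj by (rule co)
  have finY: "finite Y" using Y(1) pair_finite_verts finite_subset by blast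
  obtain z where z: "A = {z}" using S(2) by (rule card_1_singletonE)
  have three: False if abc: "{a, b, c} \<subseteq> Y" "\<not> coadj a b" "\<not> coadj b c" "a \<noteq> b" "b \<noteq> c" "a \<noteq> c" for a b c
  proof (rule no_K15_3K1[of z C "{a, b, c}"])
    have "a \<in> Y" "b \<in> Y" "c \<in> Y" using abc(1) by auto
    then have ac: "\<not> coadj a c" using trans abc(2,3) by blast
    have ac': "\<not> coadj c a" "\<not> coadj b a" "\<not> coadj c b" using abc(2,3) ac E_sym by blast+
    show "\<not> coadj u v" if u: "u \<in> {a, b, c}" and v: "v \<in> insert z (C \<union> {a, b, c})" for u v
    proof (cases "v \<in> {a, b, c}")
      case True
      then show ?thesis using u abc(2,3) ac ac' E_irrefl by auto
    next
      case False
      then show ?thesis using cross(1) u v abc(1) z by auto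
    qed
  qed (use S z abc Y(1) cross(2) in \<open>auto simp: split_on_def coadj_def\<close>)
  have "matching (parcs G) Y"
    unfolding matching_def
  proof (intro conjI ballI impI)
    fix u v w assume "u \<in> Y" "v \<in> Y" "w \<in> Y" and E: "adj u v" "adj u w"
    then have "v = u \<or> u = w \<or> v = w"
      using three[of v u w] adj_sym[OF E(1)] by (auto simp: coadj_def)
    then show "v = w" using E adj_irrefl by auto
  qed (use adj_irrefl adj_sym in blast)+
  then obtain m n where mn: "induces (parcs G) Y (T4 m n)" by (rule induces_T4_if_matching[OF finY])
  moreover have "m + n \<ge> 1"
  proof (rule ccontr)
    assume "\<not> m + n \<ge> 1"
    then have "m = 0" "n = 0" by auto
    then show False using mn Y(2) by (auto simp: induces_def T4_def bij_betw_def)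
  qed
  ultimately show ?thesis unfolding T4s_def by blast
qed

end

lemma classes_if_class_G:
  assumes G: "G \<in> class_G"
  shows "G \<in> class_S \<union> class_T1 \<union> class_T2"
proof -
  have PG: "pair_graph G" and conn: "Digraph_Component.connected (with_proj G)"
    and card: "card (pverts G) \<ge> 4" and nc: "\<not> complete_digraph (card (pverts G)) (with_proj G)"
    and eig: "- 3 \<le> distance_eigenvalue G (card (pverts G))" "distance_eigenvalue G 3 \<le> - 1"
    using G unfolding class_G_def by simp_all
  interpret pair_graph G by (rule PG)
  have "3 \<le> card (pverts G)" using card by simp
  then have co: "co_graph (pverts G) coadj" by (rule co_graph_coadj[OF conn _ eig])
  interpret co_graph "pverts G" coadj by (rule co)
  have arcs: "parcs G \<subseteq> pverts G \<times> pverts G"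
  proof
    fix e assume "e \<in> parcs G"
    then show "e \<in> pverts G \<times> pverts G"
      using arc_fst_in_verts[of e] arc_snd_in_verts[of e] by (simp add: mem_Times_iff)
  qed
  obtain x0 y0 where x0: "x0 \<in> pverts G" "y0 \<in> pverts G" "coadj x0 y0"
  proof -
    have "\<exists>u\<in>pverts G. \<exists>v\<in>pverts G. coadj u v"
    proof (rule ccontr)
      assume "\<not> (\<exists>u\<in>pverts G. \<exists>v\<in>pverts G. coadj u v)"
      then have all: "adj u v" if "u \<in> pverts G" "v \<in> pverts G" "u \<noteq> v" for u v
        using that unfolding coadj_def by blast
      have "parcs G = {(u, v). (u, v) \<in> pverts G \<times> pverts G \<and> u \<noteq> v}"
      proof (intro equalityI subsetI)
        fix e assume e: "e \<in> parcs G"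
        then show "e \<in> {(u, v). (u, v) \<in> pverts G \<times> pverts G \<and> u \<noteq> v}"
          using arcs pair_no_loops[OF e] by auto
      qed (use all in auto)
      then show False using nc pair_finite_verts unfolding complete_digraph_pair_def by simp
    qed
    then show thesis using that by blast
  qed
  obtain X Y where XY: "pverts G = X \<union> Y" "X \<inter> Y = {}" "X \<noteq> {}" "Y \<noteq> {}"
    and cross_XY: "\<forall>x\<in>X. \<forall>y\<in>Y. \<not> coadj x y"
    and tX: "\<forall>a\<in>X. \<forall>b\<in>X. \<forall>c\<in>X. \<not> coadj a b \<longrightarrow> \<not> coadj b c \<longrightarrow> \<not> coadj a c"
    and tY: "\<forall>a\<in>Y. \<forall>b\<in>Y. \<forall>c\<in>Y. \<not> coadj a b \<longrightarrow> \<not> coadj b c \<longrightarrow> \<not> coadj a c"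
    by (rule two_parts[OF x0])
  have cross: "\<not> coadj x y" if "x \<in> X" "y \<in> Y" for x y using cross_XY that by blast
  have cross': "\<not> coadj y x" if "x \<in> X" "y \<in> Y" for x y using cross[OF that] E_sym by blast
  have sub: "X \<subseteq> pverts G" "Y \<subseteq> pverts G" using XY by auto
  have adj_cross: "adj x y \<and> adj y x" if "x \<in> X" "y \<in> Y" for x y
  proof -
    have "x \<noteq> y" using that XY(2) by auto
    then show ?thesis using cross[OF that] cross'[OF that] by (simp add: coadj_def)
  qed
  have J: "join_parts G X Y" unfolding join_parts_def using arcs XY(1,2) adj_cross by blast
  obtain x y where xy: "x \<in> X" "y \<in> Y" using XY by blast
  have "x \<in> pverts G" "x \<notin> Y" "y \<in> pverts G" "y \<notin> X" using xy XY by auto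
  have yX: "\<forall>x\<in>X. \<not> coadj y x" and xY: "\<forall>y\<in>Y. \<not> coadj x y" using cross cross' xy by auto
  note tyX = part_types[OF co sub(1) XY(3) tX \<open>y \<in> pverts G\<close> \<open>y \<notin> X\<close> yX]
  note tyY = part_types[OF co sub(2) XY(4) tY \<open>x \<in> pverts G\<close> \<open>x \<notin> Y\<close> xY]
  have split_S: "G \<in> class_S" if J': "join_parts G U W" and T4: "\<exists>T\<in>T4s 1. induces (parcs G) U T"
    and W: "W = A \<union> C" "split_on (parcs G) A C" "card A = 1" "card C = 5" for U W A C
  proof -
    have "induces (parcs G) W (K 5 \<union>\<^sub>G copies_K 1 1)"
      unfolding induces_split_iff using W by blast
    then have "induces (parcs G) W (K 5 \<union>\<^sub>G K 1)" unfolding induces_union_K_1_iff .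
    then show ?thesis unfolding class_S_iff using J' T4 by blast
  qed
  have XS: "G \<in> class_S" if AC: "X = A \<union> C" "split_on (parcs G) A C" "card A = 1" "card C = 5" for A C
  proof (rule split_S[OF join_parts_commute[OF J] _ AC])
    show "\<exists>T\<in>T4s 1. induces (parcs G) Y T"
      using T4_opposite_split[OF co sub(2) XY(4) tY AC(2-4)] sub(1) cross' XY(2) AC(1) by simp
  qed
  have YS: "G \<in> class_S" if AC: "Y = A \<union> C" "split_on (parcs G) A C" "card A = 1" "card C = 5" for A C
  proof (rule split_S[OF J _ AC])
    show "\<exists>T\<in>T4s 1. induces (parcs G) X T"
      using T4_opposite_split[OF co sub(1) XY(3) tX AC(2-4)] sub(2) cross XY(2) AC(1) by (simp add: Int_commute)
  qed
  show ?thesis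
  proof (rule tyX)
    fix A C assume "X = A \<union> C" "split_on (parcs G) A C" "card A = 1" "card C = 5"
    then show ?thesis using XS by blast
  next
    assume KX: "\<exists>r\<ge>1. induces (parcs G) X (K r)"
    show ?thesis
    proof (rule tyY)
      fix A C assume "Y = A \<union> C" "split_on (parcs G) A C" "card A = 1" "card C = 5"
      then show ?thesis using YS by blast
    next
      assume "T123_part (parcs G) Y \<or> T4_part (parcs G) Y"
      then have "G \<in> class_T1" unfolding class_T1_iff using J KX by (intro exI[of _ X] exI[of _ Y] conjI)
      then show ?thesis by simp
    next
      \<comment> \<open>Two cliques completely joined would make \<open>G\<close> complete, against
        the non-adjacent pair x0, y0.\<close>
      assume KY: "\<exists>r\<ge>1. induces (parcs G) Y (K r)"
      have "\<not> coadj u v" if "u \<in> X" "v \<in> X" for u v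
        using KX that unfolding induces_K_iff coadj_def by auto
      moreover have "\<not> coadj u v" if "u \<in> Y" "v \<in> Y" for u v
        using KY that unfolding induces_K_iff coadj_def by auto
      moreover have "x0 \<in> X \<or> x0 \<in> Y" "y0 \<in> X \<or> y0 \<in> Y" using x0 XY(1) by auto
      ultimately have False using x0(3) cross[of x0 y0] cross'[of y0 x0] by auto
      then show ?thesis ..
    qed
  next
    assume TX: "T123_part (parcs G) X \<or> T4_part (parcs G) X"
    show ?thesis
    proof (rule tyY)
      fix A C assume "Y = A \<union> C" "split_on (parcs G) A C" "card A = 1" "card C = 5"
      then show ?thesis using YS by blast
    next
      assume "\<exists>r\<ge>1. induces (parcs G) Y (K r)"
      then have "G \<in> class_T1"
        unfolding class_T1_iff using join_parts_commute[OF J] TX by (intro exI[of _ Y] exI[of _ X] conjI)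
      then show ?thesis by simp
    next
      assume TY: "T123_part (parcs G) Y \<or> T4_part (parcs G) Y"
      \<comment> \<open>\<open>class_T2_iff\<close> lists the mixed case only with the
        \<open>T123\<close> part first, so the other order is obtained by exchanging X and
        Y.\<close>
      have "G \<in> class_T2"
      proof (cases "T4_part (parcs G) X \<and> T123_part (parcs G) Y")
        case True
        then show ?thesis unfolding class_T2_iff using join_parts_commute[OF J] by blast
      next
        case False
        then show ?thesis unfolding class_T2_iff using J TX TY by blast
      qed
      then show ?thesis by simp
    qed
  qed
qed

lemma part_nonempty:
  assumes "T123_part R X \<or> T4_part R X"
  shows "X \<noteq> {}"
  using nonadjacent_pair_if_T[OF assms] by blast

lemma class_G_if_classes:
  assumes G: "G \<in> class_S \<union> class_T1 \<union> class_T2" and card: "card (pverts G) \<ge> 4"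
  shows "G \<in> class_G"
proof -
  consider "G \<in> class_S" | "G \<in> class_T1" | "G \<in> class_T2" using G by blast
  then show ?thesis
  proof cases
    case 1
    then obtain X Y T where J: "join_parts G X Y" and T: "T \<in> T4s 1" "induces (parcs G) X T"
      and Y: "induces (parcs G) Y (K 5 \<union>\<^sub>G K 1)" unfolding class_S_iff by blast
    obtain m n where mn: "m + n \<ge> 1" "T = T4 m n" using T(1) unfolding T4s_def by blast
    have X: "finite X" "matching (parcs G) X"
      using matching_T4_if_induces[of "parcs G" X m n] T(2) mn(2) by auto
    have "X \<noteq> {}"
    proof
      assume "X = {}"
      then have "pverts (T4 m n) = {}" using T(2) mn(2) by (auto simp: induces_def bij_betw_def)
      then show False using mn(1) by (auto simp: T4_def Plus_def lessThan_empty_iff)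
    qed
    obtain A C where AC: "Y = A \<union> C" "split_on (parcs G) A C" "card A = 1" "card C = 5"
      using Y unfolding induces_union_K_1_iff induces_split_iff by blast
    obtain u v where uv: "u \<in> A \<union> C" "v \<in> A \<union> C" "u \<noteq> v" "(u, v) \<notin> parcs G"
      using split_nonadjacent[OF AC(2)] AC(3,4) by auto
    have "Y \<subseteq> pverts G" using J by (auto simp: join_parts_def)
    then have uv': "u \<in> pverts G" "v \<in> pverts G" using uv AC(1) by auto
    have "Y \<noteq> {}" using uv AC(1) by auto
    show ?thesis
    proof (rule class_G_if_join_parts[OF J \<open>X \<noteq> {}\<close> \<open>Y \<noteq> {}\<close> card _ _ uv' uv(3,4)])
      show "simple_on (parcs G) X" using X unfolding simple_on_def matching_def by simp
      show "simple_on (parcs G) Y" using simple_on_split[OF AC(2)] AC(1) by simp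
      show "nform (parcs G) X x \<le> (\<Sum>v\<in>X. x v)\<^sup>2" for x by (rule nform_matching(1)[OF X])
      show "nform (parcs G) Y x \<le> (\<Sum>v\<in>Y. x v)\<^sup>2" for x unfolding AC(1) by (rule split_upper[OF AC(2)])
      show "0 \<le> ((\<Sum>v\<in>X. x v) + (\<Sum>v\<in>Y. x v))\<^sup>2 + (nform (parcs G) X x + 2 * (\<Sum>v\<in>X. (x v)\<^sup>2))
          + (nform (parcs G) Y x + 2 * (\<Sum>v\<in>Y. (x v)\<^sup>2))" for x
        unfolding AC(1) by (rule split_1_5_matching[OF AC(2-4) X])
    qed
  next
    case 2
    then obtain X Y r where J: "join_parts G X Y" and r: "r \<ge> 1" "induces (parcs G) X (K r)"
      and Y: "T123_part (parcs G) Y \<or> T4_part (parcs G) Y" unfolding class_T1_iff by blast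
    have "X \<noteq> {}" using r unfolding induces_K_iff by auto
    then show ?thesis
      by (rule class_G_if_good_parts[OF J _ part_nonempty[OF Y] card good_part_clique[OF r(2)] good_part_if_T[OF Y] Y])
  next
    case 3
    then obtain X Y where J: "join_parts G X Y" and X: "T123_part (parcs G) X \<or> T4_part (parcs G) X"
      and Y: "T123_part (parcs G) Y \<or> T4_part (parcs G) Y" unfolding class_T2_iff by blast
    show ?thesis
      by (rule class_G_if_good_parts[OF J part_nonempty[OF X] part_nonempty[OF Y] card
            good_part_if_T[OF X] good_part_if_T[OF Y] Y])
  qed
qed

theorem theorem3p14:
  shows "(class_G :: 'a pair_pre_digraph set) =
    {G \<in> class_S \<union> class_T1 \<union> class_T2. card (pverts G) \<ge> 4}"
proof (intro equalityI subsetI)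
  fix G :: "'a pair_pre_digraph"
  assume "G \<in> class_G"
  then show "G \<in> {G \<in> class_S \<union> class_T1 \<union> class_T2. card (pverts G) \<ge> 4}"
    using classes_if_class_G[of G] by (simp add: class_G_def)
next
  fix G :: "'a pair_pre_digraph"
  assume "G \<in> {G \<in> class_S \<union> class_T1 \<union> class_T2. card (pverts G) \<ge> 4}"
  then show "G \<in> class_G" using class_G_if_classes[of G] by simp
qed

end
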